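(* Assume (in addition to ZFC) $\mathsf{PBP}$: every projective set of reals has the Baire property. Then for every $n\geqslant 2$ there exist manifolds $M$ and $N$ of dimension $n$ that are not homeomorphic, but such that $\mathrm{Homeo}(M)\equiv\mathrm{Homeo}(N)$.
   Context: Conventions: a manifold is a connected, second countable, Hausdorff topological manifold of positive finite dimension with empty boundary, not necessarily compact. $\mathrm{Homeo}(M)$ is the group of all homeomorphisms of $M$, viewed as a first-order structure in the language $\mathcal L$ of group theory (binary multiplication and identity). $\equiv$ denotes elementary equivalence: the same first-order $\mathcal L$-sentences hold. A subset of a topological space has the Baire property if its symmetric difference with some open set is meager. Projective sets are those in the projective hierarchy of descriptive set theory (boldface $\bigcup_n\mathbf{\Sigma}^1_n$). *)

theory Defs
  imports "HOL-Analysis.Analysis" "HOL-Algebra.Bij"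
begin

section \<open>Manifolds and their homeomorphism groups\<close>

definition locally_Euclidean_space :: "nat \<Rightarrow> 'a topology \<Rightarrow> bool" where
  "locally_Euclidean_space n X \<longleftrightarrow>
     (\<forall>x\<in>topspace X. \<exists>U V. openin X U \<and> x \<in> U \<and> openin (Euclidean_space n) V \<and>
        subtopology X U homeomorphic_space subtopology (Euclidean_space n) V)"

text \<open>Nonemptiness is part of the convention that a manifold is connected; the library's
  \<^const>\<open>connected_space\<close> also holds for the empty space.\<close>

definition manifold :: "nat \<Rightarrow> 'a topology \<Rightarrow> bool" where
  "manifold n X \<longleftrightarrow>
     0 < n \<and> topspace X \<noteq> {} \<and> connected_space X \<and> second_countable X \<and>
     Hausdorff_space X \<and> locally_Euclidean_space n X"

text \<open>As in \<^const>\<open>BijGroup\<close>, a self-map of the space is represented by the function that is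
  \<^const>\<open>undefined\<close> outside of \<^term>\<open>topspace X\<close>, so that each homeomorphism occurs exactly
  once. Multiplication is composition and the unit is the identity map, both inherited from
  \<^const>\<open>BijGroup\<close>.\<close>

definition Homeo :: "'a topology \<Rightarrow> ('a \<Rightarrow> 'a) monoid" where
  "Homeo X = (BijGroup (topspace X))
     \<lparr>carrier := {f \<in> extensional (topspace X). homeomorphic_map X X f}\<rparr>"

lemma carrier_Homeo:
  "carrier (Homeo X) = {f \<in> extensional (topspace X). homeomorphic_map X X f}"
  by (simp add: Homeo_def)

lemma carrier_Homeo_subset: "carrier (Homeo X) \<subseteq> Bij (topspace X)"
proof
  fix f assume "f \<in> carrier (Homeo X)"
  then have "f \<in> extensional (topspace X)" "f ` topspace X = topspace X" "inj_on f (topspace X)"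
    by (auto simp: carrier_Homeo dest: homeomorphic_imp_surjective_map
        homeomorphic_imp_injective_map)
  then show "f \<in> Bij (topspace X)"
    by (simp add: Bij_def bij_betw_def)
qed

lemma mult_Homeo:
  assumes "f \<in> carrier (Homeo X)" "g \<in> carrier (Homeo X)"
  shows "f \<otimes>\<^bsub>Homeo X\<^esub> g = compose (topspace X) f g"
  using assms carrier_Homeo_subset[of X] by (auto simp: Homeo_def BijGroup_def)

lemma one_Homeo: "\<one>\<^bsub>Homeo X\<^esub> = (\<lambda>x\<in>topspace X. x)"
  by (simp add: Homeo_def BijGroup_def)

lemma group_Homeo: "group (Homeo X)"
proof -
  let ?B = "BijGroup (topspace X)"
  have "subgroup (carrier (Homeo X)) ?B"
  proof (rule group.subgroupI[OF group_BijGroup])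
    show "carrier (Homeo X) \<subseteq> carrier ?B"
      using carrier_Homeo_subset by (simp add: BijGroup_def)
    have "homeomorphic_map X X (\<lambda>x\<in>topspace X. x)"
      by (rule homeomorphic_map_eq[of _ _ id]) auto
    then show "carrier (Homeo X) \<noteq> {}"
      by (auto simp: carrier_Homeo)
  next
    fix f assume f: "f \<in> carrier (Homeo X)"
    then obtain g where g: "homeomorphic_maps X X f g"
      by (auto simp: carrier_Homeo homeomorphic_map_maps)
    have "homeomorphic_map X X (\<lambda>x\<in>topspace X. inv_into (topspace X) f x)"
    proof (rule homeomorphic_map_eq)
      show "homeomorphic_map X X g"
        using g homeomorphic_maps_map by blast
      fix x assume "x \<in> topspace X"
      then show "g x = (\<lambda>x\<in>topspace X. inv_into (topspace X) f x) x"
        using g f unfolding homeomorphic_maps_def carrier_Homeo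
        by (auto simp: continuous_map_def Pi_iff
            intro!: inv_into_f_eq[symmetric] homeomorphic_imp_injective_map)
    qed
    then show "inv\<^bsub>?B\<^esub> f \<in> carrier (Homeo X)"
      using f carrier_Homeo_subset[of X] by (auto simp: inv_BijGroup carrier_Homeo)
  next
    fix f g assume fg: "f \<in> carrier (Homeo X)" "g \<in> carrier (Homeo X)"
    then have "homeomorphic_map X X (f \<circ> g)"
      by (auto simp: carrier_Homeo intro: homeomorphic_map_compose)
    then have "homeomorphic_map X X (compose (topspace X) f g)"
      by (rule homeomorphic_map_eq) (simp add: compose_def)
    then have "compose (topspace X) f g \<in> carrier (Homeo X)"
      by (simp add: carrier_Homeo)
    moreover have "f \<otimes>\<^bsub>?B\<^esub> g = compose (topspace X) f g"
      using fg carrier_Homeo_subset[of X] by (auto simp: BijGroup_def)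
    ultimately show "f \<otimes>\<^bsub>?B\<^esub> g \<in> carrier (Homeo X)" by simp
  qed
  then have "group (?B\<lparr>carrier := carrier (Homeo X)\<rparr>)"
    by (rule subgroup.subgroup_is_group) (rule group_BijGroup)
  then show ?thesis
    by (simp add: Homeo_def)
qed


section \<open>First-order logic in the language of groups\<close>

datatype grp_term = Var nat | One | Mult grp_term grp_term

datatype grp_fm =
    Equal grp_term grp_term
  | Neg grp_fm
  | Conj grp_fm grp_fm
  | Exists nat grp_fm

primrec term_vars :: "grp_term \<Rightarrow> nat set" where
  "term_vars (Var i) = {i}"
| "term_vars One = {}"
| "term_vars (Mult s t) = term_vars s \<union> term_vars t"

primrec free_vars :: "grp_fm \<Rightarrow> nat set" where
  "free_vars (Equal s t) = term_vars s \<union> term_vars t"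
| "free_vars (Neg \<phi>) = free_vars \<phi>"
| "free_vars (Conj \<phi> \<psi>) = free_vars \<phi> \<union> free_vars \<psi>"
| "free_vars (Exists i \<phi>) = free_vars \<phi> - {i}"

primrec term_val :: "('a, 'm) monoid_scheme \<Rightarrow> (nat \<Rightarrow> 'a) \<Rightarrow> grp_term \<Rightarrow> 'a" where
  "term_val G e (Var i) = e i"
| "term_val G e One = \<one>\<^bsub>G\<^esub>"
| "term_val G e (Mult s t) = term_val G e s \<otimes>\<^bsub>G\<^esub> term_val G e t"

primrec sat :: "('a, 'm) monoid_scheme \<Rightarrow> (nat \<Rightarrow> 'a) \<Rightarrow> grp_fm \<Rightarrow> bool" where
  "sat G e (Equal s t) \<longleftrightarrow> term_val G e s = term_val G e t"
| "sat G e (Neg \<phi>) \<longleftrightarrow> \<not> sat G e \<phi>"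
| "sat G e (Conj \<phi> \<psi>) \<longleftrightarrow> sat G e \<phi> \<and> sat G e \<psi>"
| "sat G e (Exists i \<phi>) \<longleftrightarrow> (\<exists>a\<in>carrier G. sat G (e(i := a)) \<phi>)"

definition sentence :: "grp_fm \<Rightarrow> bool" where
  "sentence \<phi> \<longleftrightarrow> free_vars \<phi> = {}"

definition models :: "('a, 'm) monoid_scheme \<Rightarrow> grp_fm \<Rightarrow> bool" where
  "models G \<phi> \<longleftrightarrow> (\<forall>e. range e \<subseteq> carrier G \<longrightarrow> sat G e \<phi>)"

definition elementarily_equivalent ::
    "('a, 'm) monoid_scheme \<Rightarrow> ('b, 'k) monoid_scheme \<Rightarrow> bool" where
  "elementarily_equivalent G H \<longleftrightarrow> (\<forall>\<phi>. sentence \<phi> \<longrightarrow> (models G \<phi> \<longleftrightarrow> models H \<phi>))"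


section \<open>Projective sets and the Baire property\<close>

definition nowhere_dense_in :: "'a topology \<Rightarrow> 'a set \<Rightarrow> bool" where
  "nowhere_dense_in X S \<longleftrightarrow> S \<subseteq> topspace X \<and> X interior_of (X closure_of S) = {}"

definition meager_in :: "'a topology \<Rightarrow> 'a set \<Rightarrow> bool" where
  "meager_in X S \<longleftrightarrow>
     (\<exists>\<N>. countable \<N> \<and> (\<forall>N\<in>\<N>. nowhere_dense_in X N) \<and> S = \<Union>\<N>)"

definition Baire_property_in :: "'a topology \<Rightarrow> 'a set \<Rightarrow> bool" where
  "Baire_property_in X A \<longleftrightarrow>
     A \<subseteq> topspace X \<and> (\<exists>U. openin X U \<and> meager_in X (sym_diff A U))"

definition Baire_space :: "(nat \<Rightarrow> nat) topology" where
  "Baire_space = product_topology (\<lambda>_. discrete_topology UNIV) UNIV"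

text \<open>The space \<open>X \<times> \<N>\<^sup>k\<close>, where \<open>\<N>\<close> is Baire space.\<close>

definition prod_Baire :: "'a topology \<Rightarrow> nat \<Rightarrow> ('a \<times> (nat \<Rightarrow> nat \<Rightarrow> nat)) topology" where
  "prod_Baire X k = prod_topology X (product_topology (\<lambda>_. Baire_space) {..<k})"

text \<open>The projection \<open>X \<times> \<N>\<^sup>k\<^sup>+\<^sup>1 \<rightarrow> X \<times> \<N>\<^sup>k\<close> that forgets the last coordinate.\<close>

definition forget_last :: "nat \<Rightarrow> 'a \<times> (nat \<Rightarrow> nat \<Rightarrow> nat) \<Rightarrow> 'a \<times> (nat \<Rightarrow> nat \<Rightarrow> nat)" where
  "forget_last k = (\<lambda>(x, y). (x, restrict y {..<k}))"

text \<open>For \<open>n \<ge> 1\<close>, \<open>boldface_Sigma X n k\<close> is the family of boldface \<open>\<Sigma>\<^sup>1\<^sub>n\<close> subsets of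
  \<open>X \<times> \<N>\<^sup>k\<close> for a Polish space \<open>X\<close>: the \<open>\<Sigma>\<^sup>1\<^sub>1\<close> sets are the projections of closed sets
  (analytic sets), and the \<open>\<Sigma>\<^sup>1\<^bsub>n+1\<^esub>\<close> sets are the projections of complements of \<open>\<Sigma>\<^sup>1\<^sub>n\<close> sets
  along \<open>X \<times> \<N>\<^sup>k\<^sup>+\<^sup>1 \<rightarrow> X \<times> \<N>\<^sup>k\<close>. Starting the recursion with the open sets at level \<open>0\<close> merges
  both clauses; level \<open>0\<close> itself is only auxiliary.\<close>

primrec boldface_Sigma ::
    "'a topology \<Rightarrow> nat \<Rightarrow> nat \<Rightarrow> ('a \<times> (nat \<Rightarrow> nat \<Rightarrow> nat)) set set" where
  "boldface_Sigma X 0 k = {U. openin (prod_Baire X k) U}"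
| "boldface_Sigma X (Suc n) k =
     {forget_last k ` (topspace (prod_Baire X (Suc k)) - C) | C. C \<in> boldface_Sigma X n (Suc k)}"

text \<open>The image under \<^const>\<open>fst\<close> identifies \<open>X \<times> \<N>\<^sup>0\<close> with \<open>X\<close>.\<close>

definition projective_in :: "'a topology \<Rightarrow> 'a set \<Rightarrow> bool" where
  "projective_in X A \<longleftrightarrow> (\<exists>n\<ge>1. \<exists>B\<in>boldface_Sigma X n 0. A = fst ` B)"

definition PBP :: bool where
  "PBP \<longleftrightarrow> (\<forall>A. projective_in euclideanreal A \<longrightarrow> Baire_property_in euclideanreal A)"

end

theory Submission
  imports Defs
begin

text \<open>The complement of a closed nowhere dense subset \<open>K\<close> of a line in \<open>\<real>\<^sup>n\<close> (\<open>n \<ge> 2\<close>) has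
  the end space \<open>K \<union> {\<infinity>}\<close>, and homeomorphisms between such complements extend to the ends.
  Let \<open>\<theta>\<close> be irrational. For every real \<open>t\<close> we choose
  \<open>K = K(t)\<close> as a union of clusters indexed by the integers, where the topology of the \<open>k\<close>-th
  cluster encodes the fractional part of \<open>t + k\<theta>\<close>. The complements \<open>M(t)\<close> and \<open>M(t + \<theta>)\<close> are
  translates of each other and \<open>M(t + 1) = M(t)\<close>, whereas only countably many \<open>s\<close> satisfy
  \<open>M(s) \<cong> M(t)\<close>, since the encoded numbers are recovered from the end space.

  The set of all \<open>t\<close> for which \<open>Homeo(M(t))\<close> satisfies a given sentence is projective, because
  homeomorphisms are coded by reals. So it has the Baire property, and as it is invariant under the
  dense group \<open>\<int> + \<theta>\<int>\<close>, it is meager or comeager. As there are only countably many sentences, the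
  theory of \<open>Homeo(M(t))\<close> is constant on a comeager set of \<open>t\<close>, and this set contains two
  parameters with non-homeomorphic manifolds.\<close>

text \<open>Category and classification pull in opposite directions. A zero-one law wants
  homeomorphism classes that are dense in the parameter line, so the end space must not remember
  which cluster has number 0. Hence the encoding follows an orbit of the rotation by \<theta>:
  fractional parts give invariance under 1, renumbering the clusters gives invariance under
  \<theta>. In return, a homeomorphism preserves only the set of labels that occur, not
  \<open>t\<close> itself; this set being countable is just enough. A cluster stores a Dedekind cut,
  that is, a set of natural numbers. Bit a sits at points of Cantor-Bendixson rank a + 1 that
  accumulate at the centre of the cluster; it is set when Cantor sets are attached to these points.
  The attached sets do not disturb the ranks, because ranks are computed inside the closure of the
  isolated points. That closure is countable, so one end space offers only countably many candidates
  for centres. The condition n \<ge> 2 ensures that a nowhere dense part of a line does not separate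
  small boxes around it, so its points are single ends.\<close>

section \<open>The projective hierarchy over metric spaces\<close>

text \<open>Baire space \<open>nat \<Rightarrow> nat\<close> becomes a metric space through a metric
  on \<open>nat\<close>, and both \<open>nat\<close> and \<open>int\<close> serve as ranges of
  quantifiers. The distance of the line induces the discrete topology on them.\<close>

instantiation nat :: metric_space
begin

definition dist_nat :: "nat \<Rightarrow> nat \<Rightarrow> real" where
  "dist_nat m n = \<bar>real m - real n\<bar>"

definition uniformity_nat :: "(nat \<times> nat) filter" where
  "uniformity_nat = (INF e\<in>{0<..}. principal {(x, y). dist x y < e})"

instance
proof
  fix U :: "nat set"
  have "\<forall>\<^sub>F (x', y) in uniformity. x' = x \<longrightarrow> y \<in> U" if "x \<in> U" for x
    unfolding uniformity_nat_def
  proof (rule eventually_INF1)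
    show "\<forall>\<^sub>F (x', y) in principal {(x, y). dist x y < 1}. x' = x \<longrightarrow> y \<in> U"
    proof -
      have "x = y" if "\<bar>real x - real y\<bar> < 1" for y
        using that by linarith
      then show ?thesis
        using \<open>x \<in> U\<close> by (auto simp: eventually_principal dist_nat_def)
    qed
  qed auto
  then show "open U \<longleftrightarrow> (\<forall>x\<in>U. \<forall>\<^sub>F (x', y) in uniformity. x' = x \<longrightarrow> y \<in> U)"
    by (simp add: open_discrete)
qed (auto simp: dist_nat_def uniformity_nat_def)

end

instantiation int :: metric_space
begin

definition dist_int :: "int \<Rightarrow> int \<Rightarrow> real" where
  "dist_int m n = \<bar>real_of_int m - real_of_int n\<bar>"

definition uniformity_int :: "(int \<times> int) filter" where
  "uniformity_int = (INF e\<in>{0<..}. principal {(x, y). dist x y < e})"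

instance
proof
  fix U :: "int set"
  have "\<forall>\<^sub>F (x', y) in uniformity. x' = x \<longrightarrow> y \<in> U" if "x \<in> U" for x
    unfolding uniformity_int_def
  proof (rule eventually_INF1)
    show "\<forall>\<^sub>F (x', y) in principal {(x, y). dist x y < 1}. x' = x \<longrightarrow> y \<in> U"
    proof -
      have "x = y" if "\<bar>real_of_int x - real_of_int y\<bar> < 1" for y
        using that by linarith
      then show ?thesis
        using \<open>x \<in> U\<close> by (auto simp: eventually_principal dist_int_def)
    qed
  qed auto
  then show "open U \<longleftrightarrow> (\<forall>x\<in>U. \<forall>\<^sub>F (x', y) in uniformity. x' = x \<longrightarrow> y \<in> U)"
    by (simp add: open_discrete)
qed (auto simp: dist_int_def uniformity_int_def)

end

section \<open>Pairing on Baire space\<close>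

definition interleave :: "(nat \<Rightarrow> nat) \<Rightarrow> (nat \<Rightarrow> nat) \<Rightarrow> nat \<Rightarrow> nat" where
  "interleave y z = (\<lambda>m. if even m then y (m div 2) else z (m div 2))"

definition evens :: "(nat \<Rightarrow> nat) \<Rightarrow> nat \<Rightarrow> nat" where
  "evens y = (\<lambda>m. y (2 * m))"

definition odds :: "(nat \<Rightarrow> nat) \<Rightarrow> nat \<Rightarrow> nat" where
  "odds y = (\<lambda>m. y (Suc (2 * m)))"

lemma evens_interleave [simp]: "evens (interleave y z) = y"
  and odds_interleave [simp]: "odds (interleave y z) = z"
  by (auto simp: interleave_def evens_def odds_def)

text \<open>As an introduction rule it matches every function-valued map and splits it into
  coordinates, which competes with the structural rules for \<open>interleave\<close>,
  \<open>evens\<close> and \<open>odds\<close> below.\<close>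

declare continuous_on_coordinatewise_then_product [continuous_intros del]

lemma continuous_on_discrete_fun:
  fixes f :: "'a::topological_space \<Rightarrow> 'b::discrete_topology" and h :: "'b \<Rightarrow> 'c::topological_space"
  assumes "continuous_on S f"
  shows "continuous_on S (\<lambda>x. h (f x))"
proof -
  have "continuous_on UNIV h"
    by (simp add: continuous_on_open_vimage open_discrete)
  then show ?thesis
    by (metis assms continuous_on_compose2 subset_UNIV)
qed

lemma continuous_on_interleave [continuous_intros]:
  assumes "continuous_on S f" "continuous_on S g"
  shows "continuous_on S (\<lambda>x. interleave (f x) (g x))"
proof (rule continuous_on_coordinatewise_then_product)
  show "continuous_on S (\<lambda>x. interleave (f x) (g x) i)" for i
    unfolding interleave_def
    by (cases "even i") (simp_all add: continuous_on_product_then_coordinatewise assms)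
qed

lemma continuous_on_evens [continuous_intros]:
  assumes "continuous_on S f"
  shows "continuous_on S (\<lambda>x. evens (f x))"
  unfolding evens_def
  by (rule continuous_on_coordinatewise_then_product) (rule continuous_on_product_then_coordinatewise[OF assms])

lemma continuous_on_odds [continuous_intros]:
  assumes "continuous_on S f"
  shows "continuous_on S (\<lambda>x. odds (f x))"
  unfolding odds_def
  by (rule continuous_on_coordinatewise_then_product) (rule continuous_on_product_then_coordinatewise[OF assms])

text \<open>The second factor plays the part of all the quantified variables, so that the ambient
  space does not change along the hierarchy.\<close>

definition ex_compl :: "('w \<times> (nat \<Rightarrow> nat)) set \<Rightarrow> ('w \<times> (nat \<Rightarrow> nat)) set" where
  "ex_compl C = {p. \<exists>z. (fst p, interleave (snd p) z) \<notin> C}"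

primrec Sigma_level :: "nat \<Rightarrow> ('w::topological_space \<times> (nat \<Rightarrow> nat)) set set" where
  "Sigma_level 0 = {U. open U}"
| "Sigma_level (Suc n) = ex_compl ` Sigma_level n"

text \<open>The map \<open>g\<close> is generalised in the induction and acts on the second factor
  as well: the pullback of \<open>ex_compl D\<close> is again of this form, for a map
  \<open>h\<close> that carries the witness past \<open>g\<close>.\<close>

lemma Sigma_level_vimage:
  fixes g :: "'v::topological_space \<times> (nat \<Rightarrow> nat) \<Rightarrow> 'w::topological_space \<times> (nat \<Rightarrow> nat)"
  assumes "C \<in> Sigma_level n" "continuous_on UNIV g"
  shows "g -` C \<in> Sigma_level n"
  using assms
proof (induction n arbitrary: C g)
  case 0
  then show ?case
    by (simp add: open_vimage)
next
  case (Suc n)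
  then obtain D where D: "D \<in> Sigma_level n" "C = ex_compl D"
    by auto
  \<comment> \<open>Even positions hold the old second factor, to which \<open>g\<close> applies;
    the witness in the odd positions is copied unchanged.\<close>
  define h where "h p = (fst (g (fst p, evens (snd p))),
      interleave (snd (g (fst p, evens (snd p)))) (odds (snd p)))" for p
  have "continuous_on UNIV (\<lambda>p. g (fst p, evens (snd p)))"
    by (rule continuous_on_compose2[OF Suc.prems(2)]) (auto intro!: continuous_intros)
  then have "continuous_on UNIV h"
    unfolding h_def by (intro continuous_intros)
  then have "h -` D \<in> Sigma_level n"
    using Suc.IH D by blast
  moreover have "g -` C = ex_compl (h -` D)"
    by (auto simp: D h_def ex_compl_def)
  ultimately show ?case
    by simp
qed

text \<open>Complementation exchanges the two operations, so they go through the induction together.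
  For a union one witness serves either set; an intersection needs two witnesses, which are
  interleaved into one.\<close>

lemma Sigma_level_Un_Int:
  assumes "A \<in> Sigma_level n" "B \<in> Sigma_level n"
  shows "A \<union> B \<in> Sigma_level n \<and> A \<inter> B \<in> Sigma_level n"
  using assms
proof (induction n arbitrary: A B)
  case 0
  then show ?case by auto
next
  case (Suc n)
  then obtain C D where CD: "C \<in> Sigma_level n" "D \<in> Sigma_level n" "A = ex_compl C" "B = ex_compl D"
    by auto
  have Un: "A \<union> B = ex_compl (C \<inter> D)"
    by (auto simp: CD ex_compl_def)
  \<comment> \<open>\<open>g evens\<close> and \<open>g odds\<close> read the first and the second
    of the two interleaved witnesses.\<close>
  define g where "g k p = (fst p, interleave (evens (snd p)) (k (odds (snd p))))"
    for k and p :: "'a \<times> (nat \<Rightarrow> nat)"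
  have "continuous_on UNIV (g evens)" "continuous_on UNIV (g odds)"
    unfolding g_def by (intro continuous_intros)+
  then have "g evens -` C \<union> g odds -` D \<in> Sigma_level n"
    using Suc.IH CD Sigma_level_vimage by blast
  moreover have "A \<inter> B = ex_compl (g evens -` C \<union> g odds -` D)"
  proof (rule subset_antisym; rule subsetI)
    fix p assume "p \<in> A \<inter> B"
    then obtain z z' where "(fst p, interleave (snd p) z) \<notin> C" "(fst p, interleave (snd p) z') \<notin> D"
      by (auto simp: CD ex_compl_def)
    then show "p \<in> ex_compl (g evens -` C \<union> g odds -` D)"
      by (auto simp: g_def ex_compl_def intro!: exI[of _ "interleave z z'"])
  qed (auto simp: CD g_def ex_compl_def)
  ultimately show ?case
    using Un Suc.IH CD(1,2) by simp
qed

text \<open>A vacuous quantifier: the pulled back set ignores the odd positions, where the witness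
  is stored.\<close>

lemma Sigma_level_Compl:
  assumes "A \<in> Sigma_level n"
  shows "- A \<in> Sigma_level (Suc n)"
proof -
  have "(\<lambda>p. (fst p, evens (snd p))) -` A \<in> Sigma_level n"
    by (intro Sigma_level_vimage assms continuous_intros)
  moreover have "- A = ex_compl ((\<lambda>p. (fst p, evens (snd p))) -` A)"
    by (auto simp: ex_compl_def)
  ultimately show ?thesis
    by simp
qed

text \<open>Here the metric enters: an open set is a countable union of closed sets, and entry 0 of
  the witness selects one of them.\<close>

lemma open_in_Sigma_level_1:
  fixes U :: "('w::metric_space \<times> (nat \<Rightarrow> nat)) set"
  assumes "open U"
  shows "U \<in> Sigma_level 1"
proof -
  define F where "F i = {p. \<forall>q. q \<notin> U \<longrightarrow> 1 / Suc i \<le> dist p q}" for i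
  have "closed (F i)" for i
  proof -
    have "F i = (\<Inter>q\<in>-U. {p. 1 / Suc i \<le> dist p q})"
      by (auto simp: F_def)
    also have "closed \<dots>"
      by (intro closed_INT ballI closed_Collect_le continuous_intros)
    finally show ?thesis .
  qed
  \<comment> \<open>Membership in \<open>C\<close> says that the index stored in entry 0 of the odd
    part fails to certify membership in \<open>U\<close>. Splitting according to this index makes
    the condition open.\<close>
  define C where "C = (\<Union>i. (\<lambda>p. odds (snd p) 0) -` {i} \<inter> (\<lambda>p. (fst p, evens (snd p))) -` (- F i))"
  have "open ((\<lambda>p :: 'w \<times> (nat \<Rightarrow> nat). odds (snd p) 0) -` {i})" for i
  proof (rule open_vimage[OF open_discrete])
    show "continuous_on UNIV (\<lambda>p :: 'w \<times> (nat \<Rightarrow> nat). odds (snd p) 0)"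
      by (rule continuous_on_product_then_coordinatewise) (intro continuous_intros)
  qed
  moreover have "open ((\<lambda>p :: 'w \<times> (nat \<Rightarrow> nat). (fst p, evens (snd p))) -` (- F i))" for i
    using \<open>closed (F i)\<close> by (intro open_vimage continuous_intros) auto
  ultimately have "open C"
    unfolding C_def by blast
  moreover have "U = ex_compl C"
  proof (rule subset_antisym; rule subsetI)
    fix p assume "p \<in> U"
    then obtain e where e: "e > 0" "\<And>q. dist q p < e \<Longrightarrow> q \<in> U"
      using assms unfolding open_dist by blast
    obtain i where "1 / Suc i < e"
      using e(1) by (rule nat_approx_posE)
    have "1 / Suc i \<le> dist p q" if "q \<notin> U" for q
      using e(2)[of q] that \<open>1 / Suc i < e\<close> by (force simp: dist_commute)
    then have "p \<in> F i"
      by (simp add: F_def)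
    then have "(fst p, interleave (snd p) (\<lambda>_. i)) \<notin> C"
      by (auto simp: C_def)
    then show "p \<in> ex_compl C"
      unfolding ex_compl_def by blast
  next
    fix p assume "p \<in> ex_compl C"
    then obtain z where "p \<in> F (z 0)"
      by (auto simp: C_def ex_compl_def)
    then have "1 / Suc (z 0) \<le> dist p p" if "p \<notin> U"
      using that unfolding F_def by blast
    then show "p \<in> U"
      by (cases "p \<in> U") auto
  qed
  ultimately show ?thesis
    by simp
qed

text \<open>Only the inclusion of level 0 in level 1 needs an argument; every later level is an
  image under the same operator.\<close>

lemma Sigma_level_mono:
  assumes "A \<in> (Sigma_level m :: ('w::metric_space \<times> (nat \<Rightarrow> nat)) set set)" "m \<le> n"
  shows "A \<in> Sigma_level n"
proof -
  have "(Sigma_level m :: ('w \<times> (nat \<Rightarrow> nat)) set set) \<subseteq> Sigma_level (Suc m)" for m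
  proof (induction m)
    case 0
    then show ?case
      using open_in_Sigma_level_1 by fastforce
  next
    case (Suc m)
    then show ?case
      unfolding Sigma_level.simps(2) by (rule image_mono)
  qed
  then show ?thesis
    using lift_Suc_mono_le[of Sigma_level m n] assms by blast
qed

section \<open>Closure properties of projective predicates\<close>

definition projective :: "('w::metric_space \<Rightarrow> bool) \<Rightarrow> bool" where
  "projective P \<longleftrightarrow> (\<exists>n. {p. P (fst p)} \<in> Sigma_level n)"

lemma projective_comp:
  assumes "projective P" "continuous_on UNIV g"
  shows "projective (\<lambda>w. P (g w))"
proof -
  obtain n where n: "{p. P (fst p)} \<in> Sigma_level n"
    using assms by (auto simp: projective_def)
  have "continuous_on UNIV (\<lambda>p. (g (fst p), snd p :: nat \<Rightarrow> nat))"
    by (intro continuous_on_Pair continuous_on_compose2[OF assms(2)] continuous_on_fst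
        continuous_on_snd continuous_on_id subset_UNIV)
  then have "(\<lambda>p. (g (fst p), snd p)) -` {p. P (fst p)} \<in> Sigma_level n"
    using n by (intro Sigma_level_vimage)
  then show ?thesis
    unfolding projective_def by (auto simp: vimage_def)
qed

lemma projective_open:
  assumes "open {w. P w}"
  shows "projective P"
proof -
  have "open (fst -` {w. P w} :: ('a \<times> (nat \<Rightarrow> nat)) set)"
    using assms by (intro open_vimage continuous_intros)
  then show ?thesis
    unfolding projective_def by (auto simp: vimage_def intro!: exI[of _ 0])
qed

lemma projective_not:
  assumes "projective P"
  shows "projective (\<lambda>w. \<not> P w)"
proof -
  obtain n where "{p. P (fst p)} \<in> Sigma_level n"
    using assms by (auto simp: projective_def)
  then have "- {p. P (fst p)} \<in> Sigma_level (Suc n)"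
    by (rule Sigma_level_Compl)
  then show ?thesis
    unfolding projective_def Collect_neg_eq[symmetric] by blast
qed

lemma projective_conj:
  assumes "projective P" "projective Q"
  shows "projective (\<lambda>w. P w \<and> Q w)"
proof -
  obtain m n where mn: "{p. P (fst p)} \<in> Sigma_level m" "{p. Q (fst p)} \<in> Sigma_level n"
    using assms unfolding projective_def by blast
  then have "{p. P (fst p)} \<in> Sigma_level (max m n)" "{p. Q (fst p)} \<in> Sigma_level (max m n)"
    by (auto elim: Sigma_level_mono simp del: Sigma_level.simps)
  then have "{p. P (fst p)} \<inter> {p. Q (fst p)} \<in> Sigma_level (max m n)"
    using Sigma_level_Un_Int by blast
  then show ?thesis
    unfolding projective_def by (auto simp: Collect_conj_eq)
qed

lemma projective_disj:
  assumes "projective P" "projective Q"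
  shows "projective (\<lambda>w. P w \<or> Q w)"
  using projective_not[OF projective_conj[OF projective_not[OF assms(1)] projective_not[OF assms(2)]]]
  by simp

lemma projective_imp:
  assumes "projective P" "projective Q"
  shows "projective (\<lambda>w. P w \<longrightarrow> Q w)"
  using projective_disj[OF projective_not[OF assms(1)] assms(2)] by simp

lemma projective_iff:
  assumes "projective P" "projective Q"
  shows "projective (\<lambda>w. P w \<longleftrightarrow> Q w)"
  unfolding iff_conv_conj_imp by (intro projective_conj projective_imp assms)

text \<open>A projection costs two levels, since \<open>ex_compl\<close> projects complements: the
  set is complemented beforehand, which already raises the level by one.\<close>

lemma projective_ex_baire:
  fixes P :: "'w::metric_space \<Rightarrow> (nat \<Rightarrow> nat) \<Rightarrow> bool"
  assumes "projective (\<lambda>p :: 'w \<times> (nat \<Rightarrow> nat). P (fst p) (snd p))"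
  shows "projective (\<lambda>w. \<exists>z :: nat \<Rightarrow> nat. P w z)"
proof -
  obtain n where n: "{p :: ('w \<times> (nat \<Rightarrow> nat)) \<times> (nat \<Rightarrow> nat). P (fst (fst p)) (snd (fst p))} \<in> Sigma_level n"
    using assms by (auto simp: projective_def)
  \<comment> \<open>The witness moves from the odd positions into the parameter. What remains in the
    second factor does not matter, since the set is independent of it.\<close>
  define g where "g p = ((fst p, odds (snd p)), snd p)" for p :: "'w \<times> (nat \<Rightarrow> nat)"
  have "continuous_on UNIV g"
    unfolding g_def by (intro continuous_intros)
  then have "g -` {p :: ('w \<times> (nat \<Rightarrow> nat)) \<times> (nat \<Rightarrow> nat). P (fst (fst p)) (snd (fst p))} \<in> Sigma_level n"
    using n by (intro Sigma_level_vimage)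
  from Sigma_level_Compl[OF this] obtain C where
    C: "C \<in> Sigma_level (Suc n)" "C = - g -` {p :: ('w \<times> (nat \<Rightarrow> nat)) \<times> (nat \<Rightarrow> nat). P (fst (fst p)) (snd (fst p))}" by blast
  have "{p :: 'w \<times> (nat \<Rightarrow> nat). \<exists>z. P (fst p) z} = ex_compl C"
    by (auto simp: C(2) g_def ex_compl_def)
  also have "\<dots> \<in> Sigma_level (Suc (Suc n))"
    using C(1) by simp
  finally show ?thesis
    unfolding projective_def by blast
qed

text \<open>Continuous images of Baire space, that is, the nonempty analytic spaces among the metric
  ones. A quantifier over such a type pulls back to a quantifier over Baire space, the only kind
  that the hierarchy offers.\<close>

class baire_image = metric_space +
  assumes ex_open_vimage_surj:
    "\<exists>\<rho> :: (nat \<Rightarrow> nat) \<Rightarrow> 'a. (\<forall>U. open U \<longrightarrow> open (\<rho> -` U)) \<and> range \<rho> = UNIV"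

lemma ex_baire_surj:
  "\<exists>\<rho> :: (nat \<Rightarrow> nat) \<Rightarrow> 'a::baire_image. continuous_on UNIV \<rho> \<and> range \<rho> = UNIV"
  using ex_open_vimage_surj[where 'a='a] by (simp add: continuous_on_open_vimage)

lemma baire_imageI:
  fixes \<rho> :: "(nat \<Rightarrow> nat) \<Rightarrow> 'a::metric_space"
  assumes "continuous_on UNIV \<rho>" "range \<rho> = UNIV"
  shows "\<exists>\<rho> :: (nat \<Rightarrow> nat) \<Rightarrow> 'a. (\<forall>U. open U \<longrightarrow> open (\<rho> -` U)) \<and> range \<rho> = UNIV"
  using assms by (auto simp: continuous_on_open_vimage)

lemma projective_ex:
  fixes P :: "'w::metric_space \<Rightarrow> 'a::baire_image \<Rightarrow> bool"
  assumes "projective (\<lambda>p. P (fst p) (snd p))"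
  shows "projective (\<lambda>w. \<exists>a. P w a)"
proof -
  obtain \<rho> :: "(nat \<Rightarrow> nat) \<Rightarrow> 'a" where \<rho>: "continuous_on UNIV \<rho>" "range \<rho> = UNIV"
    using ex_baire_surj by blast
  have "continuous_on UNIV (\<lambda>p :: 'w \<times> (nat \<Rightarrow> nat). (fst p, \<rho> (snd p)))"
    by (intro continuous_on_Pair continuous_on_compose2[OF \<rho>(1)] continuous_on_fst
        continuous_on_snd continuous_on_id subset_UNIV)
  from projective_comp[OF assms this]
  have "projective (\<lambda>w. \<exists>z :: nat \<Rightarrow> nat. P w (\<rho> z))"
    by (intro projective_ex_baire) simp
  moreover have "(\<exists>z :: nat \<Rightarrow> nat. P w (\<rho> z)) \<longleftrightarrow> (\<exists>a. P w a)" for w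
    using \<rho>(2) by (metis rangeE UNIV_I)
  ultimately show ?thesis by simp
qed

lemma projective_all:
  fixes P :: "'w::metric_space \<Rightarrow> 'a::baire_image \<Rightarrow> bool"
  assumes "projective (\<lambda>p. P (fst p) (snd p))"
  shows "projective (\<lambda>w. \<forall>a. P w a)"
  using projective_not[OF projective_ex[of "\<lambda>w a. \<not> P w a"]] projective_not[OF assms] by simp

section \<open>Types that are continuous images of Baire space\<close>

lemma continuous_on_suminf_real:
  fixes g :: "nat \<Rightarrow> 'a::topological_space \<Rightarrow> real"
  assumes "\<And>m. continuous_on UNIV (g m)" "\<And>m x. \<bar>g m x\<bar> \<le> b m" "summable b"
  shows "continuous_on UNIV (\<lambda>x. \<Sum>m. g m x)"
proof (rule uniform_limit_theorem)
  show "uniform_limit UNIV (\<lambda>n x. \<Sum>m<n. g m x) (\<lambda>x. \<Sum>m. g m x) sequentially"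
    using assms by (intro Weierstrass_m_test) auto
  show "\<forall>\<^sub>F n in sequentially. continuous_on UNIV (\<lambda>x. \<Sum>m<n. g m x)"
    by (intro always_eventually allI continuous_on_sum assms)
qed auto

instance nat :: baire_image
proof
  have "continuous_on UNIV (\<lambda>y :: nat \<Rightarrow> nat. y 0)"
    by (rule continuous_on_product_then_coordinatewise[OF continuous_on_id])
  moreover have "range (\<lambda>y :: nat \<Rightarrow> nat. y 0) = UNIV"
    by (auto intro!: surjI[of _ "\<lambda>m _. m"])
  ultimately show "\<exists>\<rho> :: (nat \<Rightarrow> nat) \<Rightarrow> nat. (\<forall>U. open U \<longrightarrow> open (\<rho> -` U)) \<and> range \<rho> = UNIV"
    by (rule baire_imageI)
qed

instance int :: baire_image
proof
  have "continuous_on UNIV (\<lambda>y :: nat \<Rightarrow> nat. int_decode (y 0))"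
    by (rule continuous_on_discrete_fun) (rule continuous_on_product_then_coordinatewise[OF continuous_on_id])
  moreover have "range (\<lambda>y :: nat \<Rightarrow> nat. int_decode (y 0)) = UNIV"
    by (auto intro!: surjI[of _ "\<lambda>m _. int_encode m"])
  ultimately show "\<exists>\<rho> :: (nat \<Rightarrow> nat) \<Rightarrow> int. (\<forall>U. open U \<longrightarrow> open (\<rho> -` U)) \<and> range \<rho> = UNIV"
    by (rule baire_imageI)
qed

instance prod :: (baire_image, baire_image) baire_image
proof
  obtain f :: "(nat \<Rightarrow> nat) \<Rightarrow> 'a" and g :: "(nat \<Rightarrow> nat) \<Rightarrow> 'b" where
    fg: "continuous_on UNIV f" "range f = UNIV" "continuous_on UNIV g" "range g = UNIV"
    using ex_baire_surj by metis
  have "continuous_on UNIV (\<lambda>y. (f (evens y), g (odds y)))"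
    by (intro continuous_on_Pair continuous_on_compose2[OF fg(1)] continuous_on_compose2[OF fg(3)]
        continuous_on_evens continuous_on_odds continuous_on_id subset_UNIV)
  moreover have "range (\<lambda>y. (f (evens y), g (odds y))) = UNIV"
  proof -
    have "\<exists>y. p = (f (evens y), g (odds y))" for p
    proof -
      obtain y z where "f y = fst p" "g z = snd p"
        using fg(2,4) by (metis surjD)
      then show ?thesis
        by (intro exI[of _ "interleave y z"]) simp
    qed
    then show ?thesis
      unfolding surj_def by blast
  qed
  ultimately show "\<exists>\<rho> :: (nat \<Rightarrow> nat) \<Rightarrow> 'a \<times> 'b. (\<forall>U. open U \<longrightarrow> open (\<rho> -` U)) \<and> range \<rho> = UNIV"
    by (rule baire_imageI)
qed

instance "fun" :: (countable, baire_image) baire_image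
proof
  obtain f :: "(nat \<Rightarrow> nat) \<Rightarrow> 'b" where
    f: "continuous_on UNIV f" "range f = UNIV"
    using ex_baire_surj by metis
  \<comment> \<open>The sequence \<open>y\<close> is read as an array whose row
    \<open>to_nat i\<close> codes the value at \<open>i\<close>.\<close>
  define \<rho> :: "(nat \<Rightarrow> nat) \<Rightarrow> 'a \<Rightarrow> 'b" where "\<rho> y i = f (\<lambda>m. y (prod_encode (to_nat i, m)))" for y i
  have "continuous_on UNIV (\<lambda>y. \<rho> y i)" for i
    unfolding \<rho>_def
  proof (rule continuous_on_compose2[OF f(1)])
    show "continuous_on UNIV (\<lambda>y m. y (prod_encode (to_nat i, m)))"
      by (rule continuous_on_coordinatewise_then_product) (rule continuous_on_product_then_coordinatewise[OF continuous_on_id])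
  qed auto
  then have "continuous_on UNIV \<rho>"
    by (rule continuous_on_coordinatewise_then_product)
  moreover have "range \<rho> = UNIV"
  proof -
    have "\<exists>y. x = \<rho> y" for x
    proof -
      have "\<forall>i. \<exists>y. x i = f y"
        using f(2) unfolding surj_def by blast
      then obtain c where "\<forall>i. x i = f (c i)"
        by (rule choice[THEN exE])
      then have "x = \<rho> (\<lambda>k. c (from_nat (fst (prod_decode k))) (snd (prod_decode k)))"
        by (auto simp: \<rho>_def)
      then show ?thesis by blast
    qed
    then show ?thesis
      unfolding surj_def by blast
  qed
  ultimately show "\<exists>\<rho> :: (nat \<Rightarrow> nat) \<Rightarrow> 'a \<Rightarrow> 'b. (\<forall>U. open U \<longrightarrow> open (\<rho> -` U)) \<and> range \<rho> = UNIV"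
    by (rule baire_imageI)
qed

lemma floor_binary_digit:
  fixes v :: real
  shows "\<lfloor>2 * v\<rfloor> - 2 * \<lfloor>v\<rfloor> \<in> {0, 1}"
proof -
  have "\<lfloor>2 * v\<rfloor> - 2 * \<lfloor>v\<rfloor> = 0 \<or> \<lfloor>2 * v\<rfloor> - 2 * \<lfloor>v\<rfloor> = 1"
    by linarith
  then show ?thesis by blast
qed

text \<open>Each numerator is a binary digit of the fractional part, written as a difference so that
  the partial sums telescope.\<close>

lemma binary_expansion:
  fixes x :: real
  shows "(\<lambda>m. (\<lfloor>2 ^ Suc m * x\<rfloor> - 2 * \<lfloor>2 ^ m * x\<rfloor>) / 2 ^ Suc m) sums (x - \<lfloor>x\<rfloor>)"
proof -
  have "(\<Sum>m<N. (\<lfloor>2 ^ Suc m * x\<rfloor> - 2 * \<lfloor>2 ^ m * x\<rfloor>) / 2 ^ Suc m) = \<lfloor>2 ^ N * x\<rfloor> / 2 ^ N - \<lfloor>x\<rfloor>" for N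
    by (induction N) (auto simp: field_simps)
  moreover have "(\<lambda>N. \<lfloor>2 ^ N * x\<rfloor> / 2 ^ N) \<longlonglongrightarrow> x"
  proof (rule tendsto_sandwich)
    have "(\<lambda>N. x - (1 / 2) ^ N) \<longlonglongrightarrow> x - 0"
      by (intro tendsto_intros LIMSEQ_realpow_zero) auto
    then show "(\<lambda>N. x - (1 / 2) ^ N) \<longlonglongrightarrow> x" by simp
    have "x - (1 / 2) ^ N \<le> \<lfloor>2 ^ N * x\<rfloor> / 2 ^ N" for N
    proof -
      have "2 ^ N * x - 1 \<le> \<lfloor>2 ^ N * x\<rfloor>" by linarith
      then have "(2 ^ N * x - 1) / 2 ^ N \<le> \<lfloor>2 ^ N * x\<rfloor> / 2 ^ N"
        by (intro divide_right_mono) auto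
      then show ?thesis by (simp add: field_simps)
    qed
    then show "\<forall>\<^sub>F N in sequentially. x - (1 / 2) ^ N \<le> \<lfloor>2 ^ N * x\<rfloor> / 2 ^ N" by simp
    have "\<lfloor>2 ^ N * x\<rfloor> / 2 ^ N \<le> x" for N
      by (simp add: field_simps)
    then show "\<forall>\<^sub>F N in sequentially. \<lfloor>2 ^ N * x\<rfloor> / 2 ^ N \<le> x" by simp
  qed auto
  ultimately show ?thesis
    unfolding sums_def by (auto intro!: tendsto_intros)
qed

instance real :: baire_image
proof
  \<comment> \<open>Entry 0 codes the integer part, the parities of the later entries are binary
    digits. Reducing mod 2 turns every sequence into a legitimate code, so \<open>\<rho>\<close> is
    total.\<close>
  define g :: "nat \<Rightarrow> (nat \<Rightarrow> nat) \<Rightarrow> real" where "g m y = real (y (Suc m) mod 2) / 2 ^ Suc m" for m y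
  define \<rho> :: "(nat \<Rightarrow> nat) \<Rightarrow> real" where "\<rho> y = of_int (int_decode (y 0)) + (\<Sum>m. g m y)" for y
  have "continuous_on UNIV (\<lambda>y. \<Sum>m. g m y)"
  proof (rule continuous_on_suminf_real)
    show "continuous_on UNIV (g m)" for m
    proof -
      have "continuous_on UNIV (\<lambda>y :: nat \<Rightarrow> nat. (\<lambda>k. real (k mod 2) / 2 ^ Suc m) (y (Suc m)))"
        by (rule continuous_on_discrete_fun) (rule continuous_on_product_then_coordinatewise[OF continuous_on_id])
      then show ?thesis by (simp add: g_def[abs_def])
    qed
    show "\<bar>g m y\<bar> \<le> (1 / 2) ^ Suc m" for m y
    proof -
      have "real (y (Suc m) mod 2) \<le> 1" by linarith
      then show ?thesis
        by (simp add: g_def power_one_over divide_right_mono)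
    qed
    show "summable (\<lambda>m. (1 / 2 :: real) ^ Suc m)"
      by (simp add: summable_geometric)
  qed
  then have "continuous_on UNIV \<rho>"
    unfolding \<rho>_def
    by (intro continuous_on_add continuous_on_discrete_fun[where h="\<lambda>k. of_int (int_decode k)"])
      (rule continuous_on_product_then_coordinatewise[OF continuous_on_id])
  moreover have "range \<rho> = UNIV"
  proof -
    have "\<exists>y. x = \<rho> y" for x
    proof -
      define y where "y k = (case k of 0 \<Rightarrow> int_encode \<lfloor>x\<rfloor>
        | Suc m \<Rightarrow> nat (\<lfloor>2 ^ Suc m * x\<rfloor> - 2 * \<lfloor>2 ^ m * x\<rfloor>))" for k
      have "g m y = (\<lfloor>2 ^ Suc m * x\<rfloor> - 2 * \<lfloor>2 ^ m * x\<rfloor>) / 2 ^ Suc m" for m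
        using floor_binary_digit[of "2 ^ m * x"] by (auto simp: g_def y_def mult.assoc)
      then have "(\<Sum>m. g m y) = x - \<lfloor>x\<rfloor>"
        using binary_expansion[of x] by (simp add: sums_iff)
      then show ?thesis
        by (auto simp: \<rho>_def y_def intro!: exI[of _ y])
    qed
    then show ?thesis
      unfolding surj_def by blast
  qed
  ultimately show "\<exists>\<rho> :: (nat \<Rightarrow> nat) \<Rightarrow> real. (\<forall>U. open U \<longrightarrow> open (\<rho> -` U)) \<and> range \<rho> = UNIV"
    by (rule baire_imageI)
qed

section \<open>Comparison with the boldface classes over the reals\<close>

lemma Baire_space_eq_euclidean: "Baire_space = euclidean"
proof -
  have "discrete_topology (UNIV :: nat set) = euclidean"
    by (metis discrete_topology_unique open_discrete open_openin topspace_euclidean)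
  then show ?thesis
    by (simp add: Baire_space_def euclidean_product_topology)
qed

lemma topspace_prod_Baire:
  "topspace (prod_Baire X k) = topspace X \<times> PiE {..<k} (\<lambda>_. UNIV)"
  by (simp add: prod_Baire_def Baire_space_eq_euclidean)

lemma continuous_map_forget_last:
  "continuous_map (prod_Baire X (Suc k)) (prod_Baire X k) (forget_last k)"
proof -
  have "continuous_map (product_topology (\<lambda>_. Baire_space) {..<Suc k})
      (product_topology (\<lambda>_. Baire_space) {..<k}) (\<lambda>y. restrict y {..<k})"
    by (auto simp: continuous_map_componentwise intro: continuous_map_product_projection)
  then have "continuous_map (prod_Baire X (Suc k)) (prod_Baire X k) (\<lambda>p. (fst p, restrict (snd p) {..<k}))"
    unfolding prod_Baire_def
    using continuous_map_compose[OF continuous_map_snd] unfolding o_def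
    by (intro continuous_map_pairedI continuous_map_fst) blast
  then show ?thesis
    by (simp add: forget_last_def case_prod_unfold)
qed

text \<open>The boldface classes add one Baire factor per quantifier, whereas
  \<open>Sigma_level\<close> interleaves all of them into one. The continuous map \<open>g\<close>
  folds the k factors present so far into a single one, and each step of the induction folds in the
  next factor.\<close>

lemma boldface_Sigma_vimage:
  fixes g :: "'a \<times> (nat \<Rightarrow> nat \<Rightarrow> nat) \<Rightarrow> 'w::topological_space \<times> (nat \<Rightarrow> nat)"
  assumes "C \<in> Sigma_level n" "continuous_map (prod_Baire X k) euclidean g"
  shows "{x \<in> topspace (prod_Baire X k). g x \<in> C} \<in> boldface_Sigma X n k"
  using assms
proof (induction n arbitrary: C g k)
  case 0
  then show ?case
    using openin_continuous_map_preimage by fastforce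
next
  case (Suc n)
  then obtain D where D: "D \<in> Sigma_level n" "C = ex_compl D"
    by auto
  let ?T = "topspace (prod_Baire X (Suc k))"
  define h where "h x = (fst (g (forget_last k x)), interleave (snd (g (forget_last k x))) (snd x k))" for x
  have g: "continuous_map (prod_Baire X (Suc k)) euclidean (\<lambda>x. g (forget_last k x))"
    using continuous_map_compose[OF continuous_map_forget_last Suc.prems(2)] by (simp add: o_def)
  have "continuous_map (prod_Baire X (Suc k)) Baire_space (\<lambda>x. snd x k)"
    using continuous_map_compose[OF continuous_map_snd continuous_map_product_projection[of k "{..<Suc k}"]]
    unfolding prod_Baire_def o_def by blast
  with g have gk: "continuous_map (prod_Baire X (Suc k)) euclidean (\<lambda>x. (g (forget_last k x), snd x k))"
    unfolding Baire_space_eq_euclidean prod_topology_euclidean[symmetric]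
    by (rule continuous_map_pairedI)
  have "continuous_on UNIV (\<lambda>p :: ('w \<times> (nat \<Rightarrow> nat)) \<times> (nat \<Rightarrow> nat).
      (fst (fst p), interleave (snd (fst p)) (snd p)))"
    by (intro continuous_intros)
  then have "continuous_map euclidean euclidean (\<lambda>p :: ('w \<times> (nat \<Rightarrow> nat)) \<times> (nat \<Rightarrow> nat).
      (fst (fst p), interleave (snd (fst p)) (snd p)))"
    by simp
  from continuous_map_compose[OF gk this]
  have "continuous_map (prod_Baire X (Suc k)) euclidean h"
    by (simp add: h_def[abs_def] o_def)
  then have "{x \<in> ?T. h x \<in> D} \<in> boldface_Sigma X n (Suc k)"
    using Suc.IH D(1) by blast
  moreover have "{x \<in> topspace (prod_Baire X k). g x \<in> C} = forget_last k ` (?T - {x \<in> ?T. h x \<in> D})"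
  proof (rule subset_antisym; rule subsetI)
    fix x assume "x \<in> {x \<in> topspace (prod_Baire X k). g x \<in> C}"
    then obtain z where x: "x \<in> topspace (prod_Baire X k)" "(fst (g x), interleave (snd (g x)) z) \<notin> D"
      by (auto simp: D ex_compl_def)
    \<comment> \<open>The witness becomes the new last coordinate.\<close>
    define x' where "x' = (fst x, (snd x)(k := z))"
    have snd_x: "snd x \<in> PiE {..<k} (\<lambda>_. UNIV)" and fst_x: "fst x \<in> topspace X"
      using x(1) unfolding topspace_prod_Baire by (auto simp: mem_Times_iff)
    have 1: "x' \<in> ?T"
      using PiE_fun_upd[OF UNIV_I snd_x, where x=k and y=z] fst_x
      unfolding topspace_prod_Baire x'_def lessThan_Suc by simp
    have "restrict ((snd x)(k := z)) {..<k} = snd x"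
      using PiE_restrict[OF snd_x] by (simp add: restrict_fupd)
    then have 2: "forget_last k x' = x"
      by (simp add: forget_last_def x'_def)
    have "h x' \<notin> D"
      using x(2) unfolding h_def 2 by (simp add: x'_def)
    with 1 2 show "x \<in> forget_last k ` (?T - {x \<in> ?T. h x \<in> D})"
      by (metis (no_types, lifting) DiffI imageI mem_Collect_eq)
  next
    fix x assume "x \<in> forget_last k ` (?T - {x \<in> ?T. h x \<in> D})"
    then obtain x' where x': "x' \<in> ?T" "h x' \<notin> D" "x = forget_last k x'"
      by blast
    have "x \<in> topspace (prod_Baire X k)"
      using continuous_map_funspace[OF continuous_map_forget_last] x'(1,3) by blast
    then show "x \<in> {x \<in> topspace (prod_Baire X k). g x \<in> C}"
      using x'(2,3) by (auto simp: D ex_compl_def h_def)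
  qed
  ultimately show ?case
    unfolding boldface_Sigma.simps by blast
qed

lemma projective_imp_projective_in:
  fixes P :: "real \<Rightarrow> bool"
  assumes "projective P"
  shows "projective_in euclideanreal {t. P t}"
proof -
  obtain m where "{p. P (fst p)} \<in> Sigma_level m"
    using assms by (auto simp: projective_def)
  then have n: "{p. P (fst p)} \<in> Sigma_level (Suc m)"
    by (rule Sigma_level_mono) simp
  \<comment> \<open>No quantified variable is present yet, so the Baire factor is filled with a
    constant sequence.\<close>
  have "continuous_map (prod_Baire euclideanreal 0) euclidean (\<lambda>x. (fst x, (\<lambda>_. 0) :: nat \<Rightarrow> nat))"
    unfolding prod_Baire_def prod_topology_euclidean[symmetric]
    by (intro continuous_map_pairedI continuous_map_fst) auto
  from boldface_Sigma_vimage[OF n this]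
  have "{x \<in> topspace (prod_Baire euclideanreal 0). P (fst x)} \<in> boldface_Sigma euclideanreal (Suc m) 0"
    by simp
  moreover have "{t. P t} = fst ` {x \<in> topspace (prod_Baire euclideanreal 0). P (fst x)}"
    by (force simp: topspace_prod_Baire)
  moreover have "1 \<le> Suc m"
    by simp
  ultimately show ?thesis
    unfolding projective_in_def by blast
qed

section \<open>Satisfaction in homeomorphism groups is projective\<close>

text \<open>The empty set is adjoined so that the empty union, too, is a union indexed by all
  natural numbers.\<close>

definition basic_open :: "nat \<Rightarrow> 'a::second_countable_topology set" where
  "basic_open = from_nat_into (insert {} (SOME B. countable B \<and> topological_basis B))"

lemma range_basic_open:
  "\<exists>B :: 'a::second_countable_topology set set. topological_basis B \<and> range basic_open = insert {} B"
proof -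
  define B where "B = (SOME B :: 'a set set. countable B \<and> topological_basis B)"
  have "countable B \<and> topological_basis B"
    unfolding B_def using ex_countable_basis by (rule someI_ex)
  moreover have "basic_open = from_nat_into (insert {} B)"
    by (simp add: basic_open_def B_def)
  ultimately show ?thesis
    by (metis countable_insert insert_not_empty range_from_nat_into)
qed

lemma open_basic_open [simp]: "open (basic_open m)"
proof -
  obtain B :: "'a set set" where "topological_basis B" "range basic_open = insert {} B"
    using range_basic_open by blast
  then show ?thesis
    by (metis insertE open_empty rangeI topological_basis_open)
qed

lemma open_eq_Union_basic_open:
  assumes "open W"
  shows "\<exists>c :: nat \<Rightarrow> nat. W = (\<Union>m. basic_open (c m))"
proof -
  obtain B :: "'a set set" where B: "topological_basis B" "range basic_open = insert {} B"
    using range_basic_open by blast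
  then obtain B' where B': "B' \<subseteq> B" "\<Union> B' = W"
    using assms unfolding topological_basis_def by blast
  define J where "J = {m. (basic_open m :: 'a set) \<in> insert {} B'}"
  have "J \<noteq> {}"
  proof -
    have "{} \<in> range (basic_open :: nat \<Rightarrow> 'a set)"
      using B(2) by simp
    then obtain m where "{} = (basic_open m :: 'a set)"
      by (rule rangeE)
    then have "m \<in> J"
      by (simp add: J_def)
    then show ?thesis by blast
  qed
  then have "range (from_nat_into J) = J"
    by (intro range_from_nat_into) auto
  moreover have "W = (\<Union>m\<in>J. basic_open m)"
  proof
    show "W \<subseteq> (\<Union>m\<in>J. basic_open m)"
    proof
      fix x assume "x \<in> W"
      then obtain V where V: "V \<in> B'" "x \<in> V"
        using B'(2) by blast
      then obtain m where "V = basic_open m"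
        using B(2) B'(1) by blast
      then show "x \<in> (\<Union>m\<in>J. basic_open m)"
        using V unfolding J_def by blast
    qed
    show "(\<Union>m\<in>J. basic_open m) \<subseteq> W"
      using B'(2) unfolding J_def by auto
  qed
  ultimately have "W = (\<Union>m :: nat. basic_open (from_nat_into J m))"
    by (metis image_image)
  then show ?thesis
    by (intro exI[of _ "from_nat_into J"])
qed

lemma projective_mem_basic_open:
  fixes f :: "'w::metric_space \<Rightarrow> 'a::second_countable_topology" and h :: "'w \<Rightarrow> nat"
  assumes "continuous_on UNIV f" "continuous_on UNIV h"
  shows "projective (\<lambda>w. f w \<in> basic_open (h w))"
proof (rule projective_open)
  have "{w. f w \<in> basic_open (h w)} = (\<Union>j. h -` {j} \<inter> f -` basic_open j)"
    by auto
  also have "open \<dots>"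
    by (intro open_UN open_Int ballI open_vimage assms open_discrete open_basic_open)
  finally show "open {w. f w \<in> basic_open (h w)}" .
qed

lemma projective_dist_less:
  fixes f g :: "'w::metric_space \<Rightarrow> 'a::metric_space"
  assumes "continuous_on UNIV f" "continuous_on UNIV g" "continuous_on UNIV d"
  shows "projective (\<lambda>w. dist (f w) (g w) < d w)"
  by (intro projective_open open_Collect_less continuous_on_dist assms)

lemma projective_less:
  fixes f g :: "'w::metric_space \<Rightarrow> real"
  assumes "continuous_on UNIV f" "continuous_on UNIV g"
  shows "projective (\<lambda>w. f w < g w)"
  by (intro projective_open open_Collect_less assms)

lemma projective_eq:
  fixes f g :: "'w::metric_space \<Rightarrow> 'a::metric_space"
  assumes "continuous_on UNIV f" "continuous_on UNIV g"
  shows "projective (\<lambda>w. f w = g w)"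
proof -
  have "projective (\<lambda>w. \<not> 0 < dist (f w) (g w))"
    by (intro projective_not projective_less continuous_on_dist continuous_on_const assms)
  then show ?thesis by simp
qed

lemma homeomorphic_maps_top_of_set:
  "homeomorphic_maps (top_of_set S) (top_of_set T) f g \<longleftrightarrow> homeomorphism S T f g"
proof -
  have "homeomorphic_maps (top_of_set S) (top_of_set T) f g \<longleftrightarrow>
      (continuous_on S f \<and> f ` S \<subseteq> T) \<and> (continuous_on T g \<and> g ` T \<subseteq> S) \<and>
      (\<forall>x\<in>S. g (f x) = x) \<and> (\<forall>y\<in>T. f (g y) = y)"
    by (simp add: homeomorphic_maps_def continuous_map_subtopology_eu image_subset_iff_funcset)
  also have "\<dots> \<longleftrightarrow> homeomorphism S T f g"
    unfolding homeomorphism_def by (metis image_eqI image_subset_iff subsetI subset_antisym)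
  finally show ?thesis .
qed

text \<open>Evaluation is jointly continuous when the index is discrete, because preimages can be
  split according to the index.\<close>

lemma continuous_on_apply_discrete:
  fixes f :: "'a::topological_space \<Rightarrow> 'i::discrete_topology \<Rightarrow> 'c::topological_space"
  assumes "continuous_on UNIV f" "continuous_on UNIV h"
  shows "continuous_on UNIV (\<lambda>x. f x (h x))"
proof -
  have "open ((\<lambda>x. f x (h x)) -` B)" if "open B" for B
  proof -
    have "(\<lambda>x. f x (h x)) -` B = (\<Union>i. (\<lambda>x. f x i) -` B \<inter> h -` {i})"
      by auto
    also have "open \<dots>"
      by (intro open_UN ballI open_Int open_vimage that open_discrete assms
          continuous_on_product_then_coordinatewise[OF assms(1)])
    finally show ?thesis .
  qed
  then show ?thesis
    by (simp add: continuous_on_open_vimage)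
qed

section \<open>Homeomorphisms coded by elements of Baire space\<close>

locale projective_family =
  fixes U :: "'w::metric_space \<Rightarrow> 'p::{baire_image, second_countable_topology} set"
  assumes projective_mem: "projective (\<lambda>x. snd x \<in> U (fst x))"
begin

abbreviation G where "G t \<equiv> Homeo (top_of_set (U t))"

text \<open>A homeomorphism is coded by a sequence of basic open sets that exhausts the complement
  of its graph.\<close>

definition graph_of :: "'w \<Rightarrow> (nat \<Rightarrow> nat) \<Rightarrow> 'p \<Rightarrow> 'p \<Rightarrow> bool" where
  "graph_of t c p q \<longleftrightarrow> p \<in> U t \<and> q \<in> U t \<and> (\<forall>m. (p, q) \<notin> basic_open (c m))"

definition codes :: "'w \<Rightarrow> (nat \<Rightarrow> nat) \<Rightarrow> ('p \<Rightarrow> 'p) \<Rightarrow> bool" where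
  "codes t c f \<longleftrightarrow> f \<in> carrier (G t) \<and> (\<forall>p\<in>U t. \<forall>q\<in>U t. graph_of t c p q \<longleftrightarrow> f p = q)"

text \<open>Avoids quantifying over homeomorphisms: totality, functionality and \<epsilon>-\<delta>
  continuity, each in both directions, speak of points and reals only, which keeps the condition
  projective in \<open>t\<close> and \<open>c\<close>.\<close>

definition valid :: "'w \<Rightarrow> (nat \<Rightarrow> nat) \<Rightarrow> bool" where
  "valid t c \<longleftrightarrow>
     (\<forall>p. p \<in> U t \<longrightarrow> (\<exists>q. graph_of t c p q)) \<and>
     (\<forall>q. q \<in> U t \<longrightarrow> (\<exists>p. graph_of t c p q)) \<and>
     (\<forall>p q q'. graph_of t c p q \<and> graph_of t c p q' \<longrightarrow> q = q') \<and>
     (\<forall>p p' q. graph_of t c p q \<and> graph_of t c p' q \<longrightarrow> p = p') \<and>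
     (\<forall>p q. graph_of t c p q \<longrightarrow> (\<forall>e::real. 0 < e \<longrightarrow> (\<exists>d::real. 0 < d \<and>
        (\<forall>p' q'. graph_of t c p' q' \<and> dist p' p < d \<longrightarrow> dist q' q < e)))) \<and>
     (\<forall>p q. graph_of t c p q \<longrightarrow> (\<forall>e::real. 0 < e \<longrightarrow> (\<exists>d::real. 0 < d \<and>
        (\<forall>p' q'. graph_of t c p' q' \<and> dist q' q < d \<longrightarrow> dist p' p < e))))"

lemma projective_U:
  assumes "continuous_on UNIV t" "continuous_on UNIV p"
  shows "projective (\<lambda>w. p w \<in> U (t w))"
  using projective_comp[OF projective_mem continuous_on_Pair[OF assms]] by simp

lemma projective_graph_of:
  fixes t :: "'v::metric_space \<Rightarrow> 'w"
  assumes "continuous_on UNIV t" "continuous_on UNIV c" "continuous_on UNIV p" "continuous_on UNIV q"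
  shows "projective (\<lambda>w. graph_of (t w) (c w) (p w) (q w))"
proof -
  have "continuous_on UNIV (\<lambda>x :: 'v \<times> nat. c (fst x))"
    by (rule continuous_on_compose2[OF assms(2) continuous_on_fst[OF continuous_on_id]]) simp
  then have "continuous_on UNIV (\<lambda>x :: 'v \<times> nat. c (fst x) (snd x))"
    by (rule continuous_on_apply_discrete[OF _ continuous_on_snd[OF continuous_on_id]])
  then show ?thesis
    unfolding graph_of_def
    by (intro projective_conj projective_U projective_all projective_not projective_mem_basic_open assms
        continuous_on_Pair continuous_on_compose2[OF assms(3) continuous_on_fst]
        continuous_on_compose2[OF assms(4) continuous_on_fst] continuous_on_id subset_UNIV)
qed

lemma projective_valid:
  assumes "continuous_on UNIV t" "continuous_on UNIV c"
  shows "projective (\<lambda>w. valid (t w) (c w))"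
proof -
  have "projective (\<lambda>x. valid (fst x) (snd x))"
    unfolding valid_def
    by (intro projective_conj projective_imp projective_all projective_ex projective_U
        projective_graph_of projective_eq projective_less projective_dist_less
        continuous_on_fst continuous_on_snd continuous_on_id continuous_on_const)
  from projective_comp[OF this continuous_on_Pair[OF assms]] show ?thesis by simp
qed

lemma codes_unique:
  assumes "codes t c f" "codes t c g"
  shows "f = g"
proof (rule extensionalityI)
  show "f \<in> extensional (U t)" "g \<in> extensional (U t)"
    using assms by (auto simp: codes_def carrier_Homeo)
  fix p assume "p \<in> U t"
  moreover from this have "f p \<in> U t"
    using assms(1) by (auto simp: codes_def carrier_Homeo dest!: homeomorphic_imp_surjective_map)
  ultimately show "f p = g p"
    using assms unfolding codes_def by metis
qed

lemma carrier_G: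
  "carrier (G t) = {f \<in> extensional (U t). \<exists>g. homeomorphism (U t) (U t) f g}"
  by (auto simp: carrier_Homeo homeomorphic_map_maps homeomorphic_maps_top_of_set)

text \<open>The graph is closed in \<open>U t \<times> U t\<close>, hence the trace of a closed set
  \<open>T\<close> of the ambient product, and basic open sets exhaust the complement of
  \<open>T\<close>.\<close>

lemma ex_codes:
  assumes "f \<in> carrier (G t)"
  shows "\<exists>c. codes t c f"
proof -
  obtain g where "homeomorphism (U t) (U t) f g"
    using assms by (auto simp: carrier_G)
  then have f: "continuous_on (U t) f" "f ` U t = U t"
    by (auto simp: homeomorphism_def)
  have "closedin (top_of_set (U t \<times> U t)) {x \<in> U t \<times> U t. f (fst x) = snd x}"
  proof -
    have "continuous_on (U t \<times> U t) (\<lambda>x. dist (f (fst x)) (snd x))"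
      by (intro continuous_on_dist continuous_on_compose2[OF f(1)] continuous_on_fst
          continuous_on_snd continuous_on_id) auto
    from continuous_closedin_preimage_constant[OF this, of 0] show ?thesis
      by (simp add: vimage_def Int_def)
  qed
  then obtain T where T: "closed T" "{x \<in> U t \<times> U t. f (fst x) = snd x} = U t \<times> U t \<inter> T"
    unfolding closedin_closed by blast
  have "open (- T)"
    using T(1) by (rule open_Compl)
  from open_eq_Union_basic_open[OF this] obtain c :: "nat \<Rightarrow> nat" where c: "- T = (\<Union>m. basic_open (c m))"
    by blast
  have "graph_of t c p q \<longleftrightarrow> f p = q" if "p \<in> U t" "q \<in> U t" for p q
  proof -
    have "(\<forall>m. (p, q) \<notin> basic_open (c m)) \<longleftrightarrow> (p, q) \<in> T"
      using arg_cong[OF c, of "\<lambda>A. (p, q) \<in> A"] by auto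
    also have "\<dots> \<longleftrightarrow> f p = q"
      using arg_cong[OF T(2), of "\<lambda>A. (p, q) \<in> A"] that by auto
    finally show ?thesis
      using that by (simp add: graph_of_def)
  qed
  then show ?thesis
    unfolding codes_def using assms by blast
qed

lemma codes_imp_valid:
  assumes "codes t c f"
  shows "valid t c"
proof -
  obtain g where "homeomorphism (U t) (U t) f g"
    using assms by (auto simp: codes_def carrier_G)
  then have fg: "continuous_on (U t) f" "f ` U t = U t" "continuous_on (U t) g" "g ` U t = U t"
    "\<And>p. p \<in> U t \<Longrightarrow> g (f p) = p" "\<And>p. p \<in> U t \<Longrightarrow> f (g p) = p"
    by (auto simp: homeomorphism_def)
  have graph: "graph_of t c p q \<longleftrightarrow> p \<in> U t \<and> q \<in> U t \<and> f p = q" for p q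
    using assms unfolding codes_def graph_of_def by blast
  have graph': "graph_of t c p q \<longleftrightarrow> p \<in> U t \<and> q \<in> U t \<and> g q = p" for p q
    unfolding graph using fg by metis
  show ?thesis
    unfolding valid_def
  proof (intro conjI allI impI)
    show "\<exists>q. graph_of t c p q" if "p \<in> U t" for p
      using that fg(2) unfolding graph by blast
    show "\<exists>p. graph_of t c p q" if "q \<in> U t" for q
      using that fg(4) unfolding graph' by blast
    show "q = q'" if "graph_of t c p q \<and> graph_of t c p q'" for p q q'
      using that unfolding graph by auto
    show "p = p'" if "graph_of t c p q \<and> graph_of t c p' q" for p p' q
      using that unfolding graph' by auto
    show "\<exists>d>0. \<forall>p' q'. graph_of t c p' q' \<and> dist p' p < d \<longrightarrow> dist q' q < e"
      if "graph_of t c p q" "0 < e" for p q e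
      using fg(1) that unfolding continuous_on_iff graph by blast
    show "\<exists>d>0. \<forall>p' q'. graph_of t c p' q' \<and> dist q' q < d \<longrightarrow> dist p' p < e"
      if "graph_of t c p q" "0 < e" for p q e
      using fg(3) that unfolding continuous_on_iff graph' by blast
  qed
qed

text \<open>The totality clauses yield \<open>f\<close> and \<open>g\<close> by choice, and the
  functionality clauses make them mutually inverse. Restriction to \<open>U t\<close> gives the
  extensional representative that \<open>Homeo\<close> requires.\<close>

lemma valid_imp_codes:
  assumes "valid t c"
  shows "\<exists>f. codes t c f"
proof -
  have v: "\<forall>p. p \<in> U t \<longrightarrow> (\<exists>q. graph_of t c p q)"
     "\<forall>q. q \<in> U t \<longrightarrow> (\<exists>p. graph_of t c p q)"
     "\<forall>p q q'. graph_of t c p q \<and> graph_of t c p q' \<longrightarrow> q = q'"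
     "\<forall>p p' q. graph_of t c p q \<and> graph_of t c p' q \<longrightarrow> p = p'"
     "\<forall>p q. graph_of t c p q \<longrightarrow> (\<forall>e::real. 0 < e \<longrightarrow> (\<exists>d::real. 0 < d \<and>
        (\<forall>p' q'. graph_of t c p' q' \<and> dist p' p < d \<longrightarrow> dist q' q < e)))"
     "\<forall>p q. graph_of t c p q \<longrightarrow> (\<forall>e::real. 0 < e \<longrightarrow> (\<exists>d::real. 0 < d \<and>
        (\<forall>p' q'. graph_of t c p' q' \<and> dist q' q < d \<longrightarrow> dist p' p < e)))"
    using assms unfolding valid_def by - (elim conjE, assumption)+
  obtain f where f: "\<forall>p\<in>U t. graph_of t c p (f p)"
    using v(1) by metis
  obtain g where g: "\<forall>q\<in>U t. graph_of t c (g q) q"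
    using v(2) by metis
  have in_U: "p \<in> U t" "q \<in> U t" if "graph_of t c p q" for p q
    using that by (auto simp: graph_of_def)
  have f_eq: "q = f p" if "graph_of t c p q" for p q
    using v(3) f that in_U(1)[OF that] by blast
  have g_eq: "p = g q" if "graph_of t c p q" for p q
    using v(4) g that in_U(2)[OF that] by blast
  have mem: "f p \<in> U t" "g p \<in> U t" if "p \<in> U t" for p
    using f g that in_U by blast+
  have gf: "g (f p) = p" "f (g p) = p" if "p \<in> U t" for p
    using f_eq[of "g p" p] g_eq[of p "f p"] f g that by auto
  have "continuous_on (U t) f"
    unfolding continuous_on_iff
  proof (intro ballI allI impI)
    fix p e assume "p \<in> U t" "(0::real) < e"
    then obtain d where "d > 0" "\<forall>p' q'. graph_of t c p' q' \<and> dist p' p < d \<longrightarrow> dist q' (f p) < e"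
      using v(5) f by blast
    then show "\<exists>d>0. \<forall>p'\<in>U t. dist p' p < d \<longrightarrow> dist (f p') (f p) < e"
      using f by blast
  qed
  moreover have "continuous_on (U t) g"
    unfolding continuous_on_iff
  proof (intro ballI allI impI)
    fix q e assume "q \<in> U t" "(0::real) < e"
    then obtain d where "d > 0" "\<forall>p' q'. graph_of t c p' q' \<and> dist q' q < d \<longrightarrow> dist p' (g q) < e"
      using v(6) g by blast
    then show "\<exists>d>0. \<forall>q'\<in>U t. dist q' q < d \<longrightarrow> dist (g q') (g q) < e"
      using g by blast
  qed
  ultimately have "homeomorphism (U t) (U t) f g"
    using mem gf unfolding homeomorphism_def by (auto simp: image_iff) metis+
  then have "homeomorphism (U t) (U t) (restrict f (U t)) g"
    by (rule homeomorphism_cong) auto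
  then have "restrict f (U t) \<in> carrier (G t)"
    unfolding carrier_G by blast
  moreover have "graph_of t c p q \<longleftrightarrow> f p = q" if "p \<in> U t" for p q
    using f f_eq that by blast
  ultimately have "codes t c (restrict f (U t))"
    unfolding codes_def by simp
  then show ?thesis by blast
qed

section \<open>Terms and formulas as projective relations between codes\<close>

definition represents_term ::
    "grp_term \<Rightarrow> ('w \<times> (nat \<Rightarrow> nat \<Rightarrow> nat) \<times> (nat \<Rightarrow> nat) \<Rightarrow> bool) \<Rightarrow> bool" where
  "represents_term s P \<longleftrightarrow> projective P \<and> (\<forall>t c e d g. (\<forall>i. codes t (c i) (e i)) \<longrightarrow> codes t d g \<longrightarrow>
      (term_val (G t) e s = g \<longleftrightarrow> P (t, c, d)))"

lemma represents_termI:
  assumes "projective P"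
    and "\<And>t c e d g. (\<forall>i. codes t (c i) (e i)) \<Longrightarrow> codes t d g \<Longrightarrow>
      (term_val (G t) e s = g \<longleftrightarrow> P (t, c, d))"
  shows "\<exists>P. represents_term s P"
  using assms unfolding represents_term_def by blast

lemma represents_termD:
  assumes "represents_term s P"
  shows "projective P"
    and "(\<forall>i. codes t (c i) (e i)) \<Longrightarrow> codes t d g \<Longrightarrow>
      (term_val (G t) e s = g \<longleftrightarrow> P (t, c, d))"
  using assms unfolding represents_term_def by blast+

definition represents_fm :: "grp_fm \<Rightarrow> ('w \<times> (nat \<Rightarrow> nat \<Rightarrow> nat) \<Rightarrow> bool) \<Rightarrow> bool" where
  "represents_fm \<phi> P \<longleftrightarrow> projective P \<and>
      (\<forall>t c e. (\<forall>i. codes t (c i) (e i)) \<longrightarrow> (sat (G t) e \<phi> \<longleftrightarrow> P (t, c)))"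

lemma represents_fmI:
  assumes "projective P"
    and "\<And>t c e. (\<forall>i. codes t (c i) (e i)) \<Longrightarrow> (sat (G t) e \<phi> \<longleftrightarrow> P (t, c))"
  shows "\<exists>P. represents_fm \<phi> P"
  using assms unfolding represents_fm_def by blast

lemma represents_fmD:
  assumes "represents_fm \<phi> P"
  shows "projective P"
    and "(\<forall>i. codes t (c i) (e i)) \<Longrightarrow> (sat (G t) e \<phi> \<longleftrightarrow> P (t, c))"
  using assms unfolding represents_fm_def by blast+

lemma term_val_closed:
  assumes "range e \<subseteq> carrier (G t)"
  shows "term_val (G t) e s \<in> carrier (G t)"
proof (induction s)
  case (Mult s1 s2)
  then show ?case
    using group.is_monoid[OF group_Homeo, THEN monoid.m_closed] by simp
qed (use assms group.is_monoid[OF group_Homeo, THEN monoid.one_closed] in auto)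

text \<open>A homeomorphism has many codes, so a term is represented not by a function on codes but
  by the relation that its value is the homeomorphism coded by \<open>d\<close>. Intermediate values
  are quantified existentially through valid codes.\<close>

lemma ex_represents_term: "\<exists>P. represents_term s P"
proof (induction s)
  case (Var i)
  let ?P = "\<lambda>x. \<forall>p q. graph_of (fst x) (fst (snd x) i) p q \<longleftrightarrow> graph_of (fst x) (snd (snd x)) p q"
  have P1: "projective ?P"
    by (intro projective_all projective_iff projective_graph_of continuous_on_fst continuous_on_snd
        continuous_on_id continuous_on_product_then_coordinatewise)
  have P2: "term_val (G t) e (Var i) = g \<longleftrightarrow> ?P (t, c, d)"
    if c: "\<forall>i. codes t (c i) (e i)" "codes t d g" for t c e d g
  proof
    assume "term_val (G t) e (Var i) = g"
    then show "?P (t, c, d)"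
      using that unfolding codes_def graph_of_def by (simp, metis)
  next
    assume P: "?P (t, c, d)"
    then have "codes t (c i) g"
      using c(2) unfolding codes_def by simp
    then show "term_val (G t) e (Var i) = g"
      using c(1) codes_unique by simp blast
  qed
  show ?case
    by (rule represents_termI[OF P1]) (rule P2)
next
  case One
  let ?P = "\<lambda>x. \<forall>p. p \<in> U (fst x) \<longrightarrow> graph_of (fst x) (snd (snd x)) p p"
  have P1: "projective ?P"
    by (intro projective_all projective_imp projective_U projective_graph_of continuous_on_fst
        continuous_on_snd continuous_on_id)
  have P2: "term_val (G t) e One = g \<longleftrightarrow> ?P (t, c, d)" if "codes t d g" for t c e d g
  proof -
    have "g \<in> extensional (U t)"
      using that by (simp add: codes_def carrier_Homeo)
    then have "g = (\<lambda>x\<in>U t. x) \<longleftrightarrow> (\<forall>p\<in>U t. g p = p)"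
      by (metis extensional_restrict restrict_apply' restrict_ext)
    also have "\<dots> \<longleftrightarrow> ?P (t, c, d)"
      using that unfolding codes_def by auto
    finally show ?thesis
      by (auto simp: one_Homeo)
  qed
  show ?case
    by (rule represents_termI[OF P1]) (rule P2)
next
  case (Mult s1 s2)
  then obtain P Q where PQ: "represents_term s1 P" "represents_term s2 Q"
    by blast
  note P = represents_termD[OF PQ(1)] and Q = represents_termD[OF PQ(2)]
  \<comment> \<open>The right factor of a composition acts first, so the chain runs from
    \<open>p\<close> along \<open>d2\<close> to \<open>q\<close> and then along \<open>d1\<close> to
    \<open>r\<close>.\<close>
  let ?P = "\<lambda>x. \<exists>d1 d2. valid (fst x) d1 \<and> valid (fst x) d2 \<and>
    P (fst x, fst (snd x), d1) \<and> Q (fst x, fst (snd x), d2) \<and>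
    (\<forall>p q r. graph_of (fst x) d2 p q \<and> graph_of (fst x) d1 q r \<longrightarrow> graph_of (fst x) (snd (snd x)) p r)"
  have P1: "projective ?P"
    by (intro projective_ex projective_conj projective_valid projective_comp[OF P(1)]
        projective_comp[OF Q(1)] projective_all projective_imp projective_graph_of
        continuous_on_Pair continuous_on_fst continuous_on_snd continuous_on_id)
  have P2: "term_val (G t) e (Mult s1 s2) = g \<longleftrightarrow> ?P (t, c, d)"
    if c: "\<forall>i. codes t (c i) (e i)" "codes t d g" for t c e d g
  proof -
    have val: "term_val (G t) e s \<in> carrier (G t)" for s
      using c(1) by (intro term_val_closed) (auto simp: codes_def)
    define f1 f2 where "f1 = term_val (G t) e s1" and "f2 = term_val (G t) e s2"
    have f12: "f1 \<in> carrier (G t)" "f2 \<in> carrier (G t)"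
      using val by (auto simp: f1_def f2_def)
    have f12U: "f1 p \<in> U t" "f2 p \<in> U t" if "p \<in> U t" for p
      using f12 that by (auto simp: carrier_Homeo dest!: homeomorphic_imp_surjective_map)
    have mult: "term_val (G t) e (Mult s1 s2) = compose (U t) f1 f2"
      using mult_Homeo[OF f12] by (simp add: f1_def f2_def)
    have *: "compose (U t) f1 f2 = g \<longleftrightarrow> (\<forall>p q r. graph_of t d2 p q \<and> graph_of t d1 q r \<longrightarrow> graph_of t d p r)"
      if d12: "codes t d1 f1" "codes t d2 f2" for d1 d2
    proof -
      have gr: "graph_of t d1 p q \<longleftrightarrow> p \<in> U t \<and> q \<in> U t \<and> f1 p = q"
        "graph_of t d2 p q \<longleftrightarrow> p \<in> U t \<and> q \<in> U t \<and> f2 p = q"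
        "graph_of t d p q \<longleftrightarrow> p \<in> U t \<and> q \<in> U t \<and> g p = q" for p q
        using c(2) d12 unfolding codes_def graph_of_def by blast+
      have "g \<in> extensional (U t)"
        using c(2) by (simp add: codes_def carrier_Homeo)
      then have "compose (U t) f1 f2 = g \<longleftrightarrow> (\<forall>p\<in>U t. g p = f1 (f2 p))"
        by (metis compose_eq compose_extensional extensionalityI)
      also have "\<dots> \<longleftrightarrow> (\<forall>p q r. graph_of t d2 p q \<and> graph_of t d1 q r \<longrightarrow> graph_of t d p r)"
        unfolding gr using f12U by auto
      finally show ?thesis .
    qed
    obtain d1 d2 where d12: "codes t d1 f1" "codes t d2 f2"
      using ex_codes f12 by blast
    show ?thesis
    proof
      assume "term_val (G t) e (Mult s1 s2) = g"
      then have "\<forall>p q r. graph_of t d2 p q \<and> graph_of t d1 q r \<longrightarrow> graph_of t d p r"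
        using *[OF d12] mult by simp
      moreover have "P (t, c, d1)" "Q (t, c, d2)"
        using P(2)[OF c(1) d12(1)] Q(2)[OF c(1) d12(2)] by (simp_all add: f1_def f2_def)
      ultimately show "?P (t, c, d)"
        using d12[THEN codes_imp_valid] by auto
    next
      assume "?P (t, c, d)"
      then obtain d1 d2 where d: "valid t d1" "valid t d2" "P (t, c, d1)" "Q (t, c, d2)"
        "\<forall>p q r. graph_of t d2 p q \<and> graph_of t d1 q r \<longrightarrow> graph_of t d p r"
        by auto
      obtain g1 g2 where "codes t d1 g1" "codes t d2 g2"
        using valid_imp_codes d(1,2) by blast
      moreover from this have "g1 = f1" "g2 = f2"
        using P(2)[OF c(1), of d1 g1] Q(2)[OF c(1), of d2 g2] d(3,4) by (auto simp: f1_def f2_def)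
      ultimately show "term_val (G t) e (Mult s1 s2) = g"
        using * d(5) mult by simp
    qed
  qed
  show ?case
    by (rule represents_termI[OF P1]) (rule P2)
qed

lemma ex_represents_fm: "\<exists>P. represents_fm \<phi> P"
proof (induction \<phi>)
  case (Equal s1 s2)
  obtain P Q where PQ: "represents_term s1 P" "represents_term s2 Q"
    using ex_represents_term by blast
  note P = represents_termD[OF PQ(1)] and Q = represents_termD[OF PQ(2)]
  \<comment> \<open>Values are accessible only through codes, so equality of two terms is expressed
    by a common code.\<close>
  let ?P = "\<lambda>x. \<exists>d. valid (fst x) d \<and> P (fst x, snd x, d) \<and> Q (fst x, snd x, d)"
  have P1: "projective ?P"
    by (intro projective_ex projective_conj projective_valid projective_comp[OF P(1)]
        projective_comp[OF Q(1)] continuous_on_Pair continuous_on_fst continuous_on_snd continuous_on_id)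
  have P2: "sat (G t) e (Equal s1 s2) \<longleftrightarrow> ?P (t, c)" if c: "\<forall>i. codes t (c i) (e i)" for t c e
  proof
    assume eq: "sat (G t) e (Equal s1 s2)"
    have "term_val (G t) e s1 \<in> carrier (G t)"
      using c by (intro term_val_closed) (auto simp: codes_def)
    then obtain d where d: "codes t d (term_val (G t) e s1)"
      using ex_codes by blast
    then show "?P (t, c)"
      using P(2)[OF c d] Q(2)[OF c d] codes_imp_valid eq by auto
  next
    assume "?P (t, c)"
    then obtain d where d: "valid t d" "P (t, c, d)" "Q (t, c, d)"
      by auto
    then obtain g where g: "codes t d g"
      using valid_imp_codes by blast
    show "sat (G t) e (Equal s1 s2)"
      using P(2)[OF c g] Q(2)[OF c g] d(2,3) by simp
  qed
  show ?case
    by (rule represents_fmI[OF P1]) (rule P2)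
next
  case (Neg \<phi>)
  then obtain P where "represents_fm \<phi> P"
    by blast
  note P = represents_fmD[OF this]
  show ?case
    by (rule represents_fmI[OF projective_not[OF P(1)]]) (simp add: P(2))
next
  case (Conj \<phi> \<psi>)
  then obtain P Q where PQ: "represents_fm \<phi> P" "represents_fm \<psi> Q"
    by blast
  note P = represents_fmD[OF PQ(1)] and Q = represents_fmD[OF PQ(2)]
  show ?case
    by (rule represents_fmI[OF projective_conj[OF P(1) Q(1)]]) (simp add: P(2) Q(2))
next
  case (Exists j \<phi>)
  then obtain P where "represents_fm \<phi> P"
    by blast
  note P = represents_fmD[OF this]
  let ?P = "\<lambda>x. \<exists>d. valid (fst x) d \<and> P (fst x, (snd x)(j := d))"
  \<comment> \<open>The codes of all variables form one point of a fixed space, so binding a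
    variable is a coordinate update, and this has to be continuous.\<close>
  have upd: "continuous_on UNIV (\<lambda>w. (c w)(j := d w))"
    if "continuous_on UNIV c" "continuous_on UNIV d"
    for c :: "'v::metric_space \<Rightarrow> nat \<Rightarrow> nat \<Rightarrow> nat" and d
  proof (rule continuous_on_coordinatewise_then_product)
    show "continuous_on UNIV (\<lambda>w. ((c w)(j := d w)) i)" for i
      using that continuous_on_product_then_coordinatewise[OF that(1), of i] by (cases "i = j") auto
  qed
  have P1: "projective ?P"
    by (intro projective_ex projective_conj projective_valid projective_comp[OF P(1)] upd
        continuous_on_Pair continuous_on_fst continuous_on_snd continuous_on_id)
  have P2: "sat (G t) e (Exists j \<phi>) \<longleftrightarrow> ?P (t, c)" if c: "\<forall>i. codes t (c i) (e i)" for t c e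
  proof
    assume "sat (G t) e (Exists j \<phi>)"
    then obtain a where a: "a \<in> carrier (G t)" "sat (G t) (e(j := a)) \<phi>"
      by auto
    then obtain d where d: "codes t d a"
      using ex_codes by blast
    then have "\<forall>i. codes t ((c(j := d)) i) ((e(j := a)) i)"
      using c by simp
    then have "P (t, c(j := d))"
      using P(2) a(2) by blast
    then show "?P (t, c)"
      using codes_imp_valid[OF d] by auto
  next
    assume "?P (t, c)"
    then obtain d where d: "valid t d" "P (t, c(j := d))"
      by auto
    then obtain a where a: "codes t d a"
      using valid_imp_codes by blast
    then have "\<forall>i. codes t ((c(j := d)) i) ((e(j := a)) i)"
      using c by simp
    then have "sat (G t) (e(j := a)) \<phi>"
      using P(2) d(2) by blast
    then show "sat (G t) e (Exists j \<phi>)"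
      using a by (auto simp: codes_def)
  qed
  show ?case
    by (rule represents_fmI[OF P1]) (rule P2)
qed

text \<open>The environments in \<open>models\<close> are traded for sequences of valid codes, so
  that the outer quantifier ranges over a continuous image of Baire space.\<close>

theorem projective_models: "projective (\<lambda>t. models (G t) \<phi>)"
proof -
  obtain P where "represents_fm \<phi> P"
    using ex_represents_fm by blast
  note P = represents_fmD[OF this]
  have "projective (\<lambda>t. \<forall>c :: nat \<Rightarrow> nat \<Rightarrow> nat. (\<forall>i. valid t (c i)) \<longrightarrow> P (t, c))"
  proof (intro projective_all projective_imp projective_valid)
    show "continuous_on UNIV (\<lambda>x :: ('w \<times> (nat \<Rightarrow> nat \<Rightarrow> nat)) \<times> nat. snd (fst x) (snd x))"
      by (rule continuous_on_apply_discrete[OF continuous_on_snd[OF continuous_on_fst[OF continuous_on_id]]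
            continuous_on_snd[OF continuous_on_id]])
  qed (simp_all add: P continuous_on_fst continuous_on_id)
  moreover have "models (G t) \<phi> \<longleftrightarrow> (\<forall>c. (\<forall>i. valid t (c i)) \<longrightarrow> P (t, c))" for t
  proof
    assume m: "models (G t) \<phi>"
    show "\<forall>c. (\<forall>i. valid t (c i)) \<longrightarrow> P (t, c)"
    proof (intro allI impI)
      fix c :: "nat \<Rightarrow> nat \<Rightarrow> nat" assume "\<forall>i. valid t (c i)"
      then have "\<forall>i. \<exists>f. codes t (c i) f"
        using valid_imp_codes by blast
      then obtain e where "\<forall>i. codes t (c i) (e i)"
        by (rule choice[THEN exE])
      moreover from this have "sat (G t) e \<phi>"
        using m unfolding models_def codes_def by blast
      ultimately show "P (t, c)"
        using P(2) by blast
    qed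
  next
    assume *: "\<forall>c. (\<forall>i. valid t (c i)) \<longrightarrow> P (t, c)"
    show "models (G t) \<phi>"
      unfolding models_def
    proof (intro allI impI)
      fix e :: "nat \<Rightarrow> 'p \<Rightarrow> 'p" assume "range e \<subseteq> carrier (G t)"
      then have "\<forall>i :: nat. \<exists>c. codes t c (e i)"
        using ex_codes by blast
      then obtain c where c: "\<forall>i :: nat. codes t (c i) (e i)"
        by (rule choice[THEN exE])
      then have "P (t, c)"
        using * codes_imp_valid by blast
      then show "sat (G t) e \<phi>"
        using P(2)[OF c] by simp
    qed
  qed
  ultimately show ?thesis by simp
qed

end

section \<open>Homeomorphisms extend to the ends\<close>

text \<open>The features of a Freudenthal compactification of \<open>topspace X - E\<close> that the
  extension argument uses: \<open>E\<close> is zero-dimensional, as witnessed by open sets of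
  \<open>X\<close>, and it does not separate small neighbourhoods of its points.\<close>

definition end_compactification :: "'a topology \<Rightarrow> 'a set \<Rightarrow> bool" where
  "end_compactification X E \<longleftrightarrow>
     compact_space X \<and> Hausdorff_space X \<and> closedin X E \<and>
     (\<forall>e\<in>E. \<forall>W. openin X W \<and> e \<in> W \<longrightarrow>
        (\<exists>V. openin X V \<and> e \<in> V \<and> V \<subseteq> W \<and> connectedin X (V - E) \<and> V - E \<noteq> {})) \<and>
     (\<forall>e\<in>E. \<forall>W. openin X W \<and> e \<in> W \<longrightarrow>
        (\<exists>V V'. openin X V \<and> openin X V' \<and> disjnt V V' \<and> e \<in> V \<and> V \<subseteq> W \<and> E \<subseteq> V \<union> V'))"

lemma end_compactificationD:
  assumes "end_compactification X E"
  shows "compact_space X" "Hausdorff_space X" "closedin X E"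
    and "\<And>e W. e \<in> E \<Longrightarrow> openin X W \<Longrightarrow> e \<in> W \<Longrightarrow>
      \<exists>V. openin X V \<and> e \<in> V \<and> V \<subseteq> W \<and> connectedin X (V - E) \<and> V - E \<noteq> {}"
    and "\<And>e W. e \<in> E \<Longrightarrow> openin X W \<Longrightarrow> e \<in> W \<Longrightarrow>
      \<exists>V V'. openin X V \<and> openin X V' \<and> disjnt V V' \<and> e \<in> V \<and> V \<subseteq> W \<and> E \<subseteq> V \<union> V'"
  using assms unfolding end_compactification_def by blast+

lemma end_compactification_dense:
  assumes "end_compactification X E"
  shows "X closure_of (topspace X - E) = topspace X"
proof (rule subset_antisym[OF closure_of_subset_topspace subsetI])
  fix x assume x: "x \<in> topspace X"
  have "\<exists>y. y \<in> topspace X - E \<and> y \<in> W" if W: "openin X W" "x \<in> W" for W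
  proof (cases "x \<in> E")
    case True
    then obtain V where "openin X V" "V \<subseteq> W" "V - E \<noteq> {}"
      using end_compactificationD(4)[OF assms True W] by blast
    then show ?thesis
      using openin_subset by blast
  qed (use x W in blast)
  then show "x \<in> X closure_of (topspace X - E)"
    using x unfolding closure_of_def by blast
qed

text \<open>Otherwise each point of the compact space has an open neighbourhood missed by the image
  of \<open>V \<inter> D\<close> for some neighbourhood \<open>V\<close> of \<open>e\<close>.
  Finitely many of these cover the space, and the intersection of the corresponding \<open>V\<close>
  contradicts density of \<open>D\<close> at \<open>e\<close>.\<close>

lemma ex_cluster_point:
  assumes "compact_space Y" "e \<in> topspace X" "h ` D \<subseteq> topspace Y"
    and dense: "\<And>V. openin X V \<Longrightarrow> e \<in> V \<Longrightarrow> V \<inter> D \<noteq> {}"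
  shows "\<exists>c\<in>topspace Y. \<forall>V G. openin X V \<and> e \<in> V \<and> openin Y G \<and> c \<in> G \<longrightarrow>
    h ` (V \<inter> D) \<inter> G \<noteq> {}"
proof (rule ccontr)
  assume "\<not> ?thesis"
  then have no: "\<exists>V G. openin X V \<and> e \<in> V \<and> openin Y G \<and> c \<in> G \<and> h ` (V \<inter> D) \<inter> G = {}"
    if "c \<in> topspace Y" for c
    using that by blast
  define \<U> where "\<U> = {G. openin Y G \<and> (\<exists>V. openin X V \<and> e \<in> V \<and> h ` (V \<inter> D) \<inter> G = {})}"
  have "topspace Y \<subseteq> \<Union>\<U>"
  proof
    fix c assume "c \<in> topspace Y"
    from no[OF this] obtain V G where "openin X V" "e \<in> V" "openin Y G" "c \<in> G" "h ` (V \<inter> D) \<inter> G = {}"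
      by (elim exE conjE)
    then have "G \<in> \<U>"
      unfolding \<U>_def by auto
    with \<open>c \<in> G\<close> show "c \<in> \<Union>\<U>"
      by (rule UnionI[rotated])
  qed
  moreover have "\<forall>U\<in>\<U>. openin Y U"
    by (simp add: \<U>_def)
  ultimately obtain \<F> where \<F>: "finite \<F>" "\<F> \<subseteq> \<U>" "topspace Y \<subseteq> \<Union>\<F>"
    using assms(1) unfolding compact_space_alt by meson
  have "\<exists>V. openin X V \<and> e \<in> V \<and> h ` (V \<inter> D) \<inter> G = {}" if "G \<in> \<F>" for G
    using \<F>(2) that by (auto simp: \<U>_def)
  then obtain V where V: "\<And>G. G \<in> \<F> \<Longrightarrow> openin X (V G) \<and> e \<in> V G \<and> h ` (V G \<inter> D) \<inter> G = {}"
    by metis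
  define V0 where "V0 = topspace X \<inter> \<Inter>(V ` \<F>)"
  have "openin X V0"
  proof (cases "\<F> = {}")
    case False
    then have "openin X (\<Inter>(V ` \<F>))"
      using V \<F>(1) by (intro openin_Inter) auto
    then show ?thesis
      unfolding V0_def by (intro openin_Int) auto
  qed (simp add: V0_def)
  moreover have "e \<in> V0"
    using assms(2) V by (simp add: V0_def)
  ultimately obtain x where x: "x \<in> V0" "x \<in> D"
    using dense[of V0] by auto
  then have "h x \<in> topspace Y"
    using assms(3) by auto
  then obtain G where "G \<in> \<F>" "h x \<in> G"
    using \<F>(3) by auto
  moreover from this have "x \<in> V G \<inter> D"
    using x by (auto simp: V0_def)
  ultimately show False
    using V[of G] by auto
qed

text \<open>A cluster point of the homeomorphism at an end is an end. It is the limit, because the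
  connected punctured neighbourhoods of an end have images that avoid a given compact set and
  hence lie on one side of a clopen partition of the ends.\<close>

lemma homeomorphic_limit_at_end:
  assumes X: "end_compactification X E" and Y: "end_compactification Y F"
    and h: "homeomorphic_maps (subtopology X (topspace X - E)) (subtopology Y (topspace Y - F)) h h'"
    and e: "e \<in> E"
  shows "\<exists>l. limitin Y h l (atin_within X e (topspace X - E))"
proof -
  define D D' where "D = topspace X - E" and "D' = topspace Y - F"
  note XE = end_compactificationD[OF X] and YF = end_compactificationD[OF Y]
  have cont: "continuous_map (subtopology X D) Y h" "continuous_map (subtopology Y D') X h'"
    and hD: "h ` D \<subseteq> D'" "h' ` D' \<subseteq> D"
    and inv: "\<And>x. x \<in> D \<Longrightarrow> h' (h x) = x" "\<And>y. y \<in> D' \<Longrightarrow> h (h' y) = y"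
    using h unfolding homeomorphic_maps_def D_def D'_def
    by (auto simp: continuous_map_in_subtopology)
  have eX: "e \<in> topspace X" "e \<notin> D"
    using e closedin_subset[OF XE(3)] by (auto simp: D_def)
  have openD: "openin X D" "openin Y D'"
    unfolding D_def D'_def using XE(3) YF(3) by (simp_all add: closedin_def)
  have dense: "V \<inter> D \<noteq> {}" if V: "openin X V" "e \<in> V" for V
  proof -
    obtain V' where "openin X V'" "V' \<subseteq> V" "V' - E \<noteq> {}"
      using XE(4)[OF e V] by blast
    then show ?thesis
      using openin_subset[of X V'] unfolding D_def by blast
  qed
  have "h ` D \<subseteq> topspace Y"
    using hD(1) by (auto simp: D'_def)
  from ex_cluster_point[OF YF(1) eX(1) this dense] obtain c where c: "c \<in> topspace Y"
    and cluster: "\<forall>V G. openin X V \<and> e \<in> V \<and> openin Y G \<and> c \<in> G \<longrightarrow> h ` (V \<inter> D) \<inter> G \<noteq> {}"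
    by blast
  have cluster: "\<exists>x\<in>V \<inter> D. h x \<in> G" if "openin X V" "e \<in> V" "openin Y G" "c \<in> G" for V G
    using cluster that by blast
  \<comment> \<open>Were \<open>c\<close> in \<open>D'\<close>, continuity of \<open>h'\<close>
    would keep its values near \<open>h' c\<close> and away from \<open>e\<close>, while the cluster
    property supplies points of \<open>D\<close> close to \<open>e\<close> that are mapped close to
    \<open>c\<close>.\<close>
  have "c \<in> F"
  proof (rule ccontr)
    assume "c \<notin> F"
    then have cD: "c \<in> D'"
      using c by (simp add: D'_def)
    then have "h' c \<in> D"
      using hD(2) by blast
    then have "h' c \<in> topspace X" "h' c \<noteq> e"
      using eX by (auto simp: D_def)
    then obtain A V where AV: "openin X A" "openin X V" "h' c \<in> A" "e \<in> V" "disjnt A V"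
      using XE(2) eX(1) unfolding Hausdorff_space_def by blast
    define G where "G = {y \<in> D'. h' y \<in> A}"
    have "openin (subtopology Y D') G"
      using openin_continuous_map_preimage[OF cont(2) AV(1)] openin_subset[OF openD(2)]
      by (simp add: G_def Int_absorb1)
    then have "openin Y G"
      using openD(2) openin_trans_full by blast
    moreover have "c \<in> G"
      using cD AV(3) by (simp add: G_def)
    ultimately obtain x where "x \<in> V" "x \<in> D" "h x \<in> G"
      using cluster[OF AV(2,4)] by blast
    then show False
      using AV(5) inv(1) unfolding G_def disjnt_def by auto
  qed
  have "\<exists>T. openin X T \<and> e \<in> T \<and> (\<forall>x\<in>T. x \<in> D \<and> x \<noteq> e \<longrightarrow> h x \<in> W)"
    if W: "openin Y W" "c \<in> W" for W
  proof -
    obtain V V' where V: "openin Y V" "openin Y V'" "disjnt V V'" "c \<in> V" "V \<subseteq> W" "F \<subseteq> V \<union> V'"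
      using YF(5)[OF \<open>c \<in> F\<close> W] by blast
    define K where "K = topspace Y - (V \<union> V')"
    have "closedin Y K"
      unfolding K_def using V(1,2) by blast
    then have "compactin Y K"
      using YF(1) closedin_compact_space by blast
    have KD: "K \<subseteq> D'"
      using V(6) by (auto simp: K_def D'_def)
    then have "compactin (subtopology Y D') K"
      using \<open>compactin Y K\<close> by (simp add: compactin_subtopology)
    then have "compactin X (h' ` K)"
      using cont(2) image_compactin by blast
    then have "closedin X (h' ` K)"
      using XE(2) compactin_imp_closedin by blast
    then have K1: "openin X (topspace X - h' ` K)"
      by blast
    have K2: "e \<in> topspace X - h' ` K"
      using eX hD(2) KD by blast
    from XE(4)[OF e K1 K2] obtain T where
      T: "openin X T" "e \<in> T" "T \<subseteq> topspace X - h' ` K" "connectedin X (T - E)"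
      by (elim exE conjE)
    have TE: "T - E = T \<inter> D"
      using openin_subset[OF T(1)] by (auto simp: D_def)
    have "connectedin (subtopology X D) (T \<inter> D)"
      using T(4) unfolding TE by (simp add: connectedin_subtopology)
    then have conn: "connectedin Y (h ` (T \<inter> D))"
      using cont(1) connectedin_continuous_map_image by blast
    have cover: "h ` (T \<inter> D) \<subseteq> V \<union> V'"
    proof
      fix y assume "y \<in> h ` (T \<inter> D)"
      then obtain x where x: "x \<in> T" "x \<in> D" "y = h x"
        by blast
      have "y \<notin> K"
        using x T(3) inv(1)[of x] by force
      moreover have "y \<in> topspace Y"
        using x hD(1) by (auto simp: D'_def)
      ultimately show "y \<in> V \<union> V'"
        by (simp add: K_def)
    qed
    obtain x where "x \<in> T \<inter> D" "h x \<in> V"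
      using cluster[OF T(1,2) V(1,4)] by blast
    then have "V \<inter> h ` (T \<inter> D) \<noteq> {}"
      by blast
    moreover have "V \<inter> V' \<inter> h ` (T \<inter> D) = {}"
      using V(3) by (auto simp: disjnt_def)
    ultimately have "V' \<inter> h ` (T \<inter> D) = {}"
      using conn cover V(1,2) unfolding connectedin by meson
    then have "h x \<in> W" if "x \<in> T" "x \<in> D" for x
      using cover that V(5) by auto
    then show ?thesis
      using T(1,2) by auto
  qed
  then have "limitin Y h c (atin_within X e D)"
    using c unfolding limitin_def eventually_atin_within by blast
  then show ?thesis
    unfolding D_def by blast
qed

text \<open>Pointwise limits at the ends suffice, because the domain is dense and the target, being
  compact Hausdorff, is regular.\<close>

lemma continuous_extension_to_ends:
  assumes X: "end_compactification X E" and Y: "end_compactification Y F"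
    and h: "homeomorphic_maps (subtopology X (topspace X - E)) (subtopology Y (topspace Y - F)) h h'"
  obtains k where "continuous_map X Y k" "\<And>x. x \<in> topspace X - E \<Longrightarrow> k x = h x"
proof (rule continuous_map_extension_pointwise_alt[of Y "topspace X - E" "topspace X" X h])
  show "regular_space Y"
    using end_compactificationD(1,2)[OF Y] compact_Hausdorff_imp_regular_space by blast
  show "topspace X \<subseteq> X closure_of (topspace X - E)"
    using end_compactification_dense[OF X] by simp
  show "continuous_map (subtopology X (topspace X - E)) Y h"
    using h unfolding homeomorphic_maps_def by (auto simp: continuous_map_in_subtopology)
  show "\<exists>l. limitin Y h l (atin_within X t (topspace X - E))"
    if "t \<in> topspace X - (topspace X - E)" for t
    using homeomorphic_limit_at_end[OF X Y h] that by blast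
qed (use that in \<open>auto simp: subtopology_topspace\<close>)

lemma end_extensions_inverse:
  assumes X: "end_compactification X E" and x: "x \<in> topspace X"
    and k: "continuous_map X Y k" "continuous_map Y X k'"
    and inv: "\<And>x. x \<in> topspace X - E \<Longrightarrow> k' (k x) = x"
  shows "k' (k x) = x"
proof -
  have "x \<in> X closure_of (topspace X - E)"
    using x end_compactification_dense[OF X] by simp
  from forall_in_closure_of_eq[OF this end_compactificationD(2)[OF X],
      where f="k' \<circ> k" and g=id] show ?thesis
    using continuous_map_compose[OF k] inv by simp
qed

text \<open>The extensions of a homeomorphism and of its inverse remain mutually inverse by density.
  An end cannot be sent outside \<open>F\<close>, since from there the inverse leads back outside
  \<open>E\<close>.\<close>

theorem homeomorphic_end_spaces:
  assumes X: "end_compactification X E" and Y: "end_compactification Y F"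
    and hom: "subtopology X (topspace X - E) homeomorphic_space subtopology Y (topspace Y - F)"
  shows "subtopology X E homeomorphic_space subtopology Y F"
proof -
  obtain h h' where h: "homeomorphic_maps (subtopology X (topspace X - E)) (subtopology Y (topspace Y - F)) h h'"
    using hom unfolding homeomorphic_space_def by blast
  then have h': "homeomorphic_maps (subtopology Y (topspace Y - F)) (subtopology X (topspace X - E)) h' h"
    by (rule homeomorphic_maps_sym[THEN iffD1])
  have hD: "\<And>x. x \<in> topspace X - E \<Longrightarrow> h x \<in> topspace Y - F \<and> h' (h x) = x"
    "\<And>y. y \<in> topspace Y - F \<Longrightarrow> h' y \<in> topspace X - E \<and> h (h' y) = y"
    using h unfolding homeomorphic_maps_def continuous_map_def by auto
  obtain k where k: "continuous_map X Y k" "\<And>x. x \<in> topspace X - E \<Longrightarrow> k x = h x"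
    using continuous_extension_to_ends[OF X Y h] by blast
  obtain k' where k': "continuous_map Y X k'" "\<And>y. y \<in> topspace Y - F \<Longrightarrow> k' y = h' y"
    using continuous_extension_to_ends[OF Y X h'] by blast
  have k'k: "k' (k x) = x" if "x \<in> topspace X" for x
    by (rule end_extensions_inverse[OF X that k(1) k'(1)]) (use k(2) k'(2) hD(1) in simp)
  have kk': "k (k' y) = y" if "y \<in> topspace Y" for y
    by (rule end_extensions_inverse[OF Y that k'(1) k(1)]) (use k(2) k'(2) hD(2) in simp)
  have maps: "homeomorphic_maps X Y k k'"
    using k(1) k'(1) k'k kk' by (simp add: homeomorphic_maps_def)
  have sub: "E \<subseteq> topspace X" "F \<subseteq> topspace Y"
    using end_compactificationD(3)[OF X] end_compactificationD(3)[OF Y] closedin_subset by blast+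
  have kE: "k x \<in> F" if "x \<in> E" for x
  proof (rule ccontr)
    assume "k x \<notin> F"
    moreover have "k x \<in> topspace Y"
      using k(1) that sub(1) unfolding continuous_map_def by auto
    ultimately have "k' (k x) \<in> topspace X - E"
      using k'(2)[of "k x"] hD(2)[of "k x"] by auto
    then show False
      using k'k that sub(1) by auto
  qed
  have k'F: "k' y \<in> E" if "y \<in> F" for y
  proof (rule ccontr)
    assume "k' y \<notin> E"
    moreover have "k' y \<in> topspace X"
      using k'(1) that sub(2) unfolding continuous_map_def by auto
    ultimately have "k (k' y) \<in> topspace Y - F"
      using k(2)[of "k' y"] hD(1)[of "k' y"] by auto
    then show False
      using kk' that sub(2) by auto
  qed
  have "homeomorphic_maps (subtopology X E) (subtopology Y F) k k'"
    using maps by (rule homeomorphic_maps_subtopologies_alt) (use kE k'F in auto)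
  then show ?thesis
    unfolding homeomorphic_space_def by blast
qed

section \<open>An invariant of end spaces\<close>

definition isolated_points :: "'a topology \<Rightarrow> 'a set" where
  "isolated_points Z = topspace Z - Z derived_set_of topspace Z"

text \<open>The Cantor-Bendixson process, started at the closure of the isolated points instead of
  the whole space. Perfect pieces away from isolated points are thereby invisible to it.\<close>

primrec rank_ge :: "'a topology \<Rightarrow> nat \<Rightarrow> 'a set" where
  "rank_ge Z 0 = Z closure_of isolated_points Z"
| "rank_ge Z (Suc j) = Z derived_set_of rank_ge Z j"

text \<open>The bits of the encoding: a point of exact rank \<open>i\<close> is marked when the part
  of the space that is invisible to \<open>rank_ge\<close> accumulates at it.\<close>

definition marked :: "'a topology \<Rightarrow> nat \<Rightarrow> 'a set" where
  "marked Z i = (rank_ge Z i - rank_ge Z (Suc i)) \<inter> Z closure_of (topspace Z - rank_ge Z 0)"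

text \<open>The set of natural numbers that is encoded at \<open>p\<close>, namely the ranks of the
  marked points arbitrarily close to \<open>p\<close>.\<close>

definition label :: "'a topology \<Rightarrow> 'a \<Rightarrow> nat set" where
  "label Z p = {i. p \<in> Z closure_of marked Z i}"

lemma rank_ge_subset: "rank_ge Z j \<subseteq> topspace Z"
  by (cases j) (simp_all add: closure_of_subset_topspace derived_set_of_subset_topspace)

lemma marked_subset: "marked Z i \<subseteq> topspace Z"
  using rank_ge_subset[of Z i] unfolding marked_def by blast

lemma rank_ge_homeomorphic:
  assumes "homeomorphic_map Z Z' f"
  shows "rank_ge Z' j = f ` rank_ge Z j"
proof (induction j)
  case 0
  have f: "f ` topspace Z = topspace Z'" "inj_on f (topspace Z)"
    using assms by (auto dest: homeomorphic_imp_surjective_map homeomorphic_imp_injective_map)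
  have "isolated_points Z' = f ` isolated_points Z"
    unfolding isolated_points_def f(1)[symmetric] homeomorphic_map_derived_set_of[OF assms subset_refl]
    using f(2) by (simp add: inj_on_image_set_diff[OF _ _ derived_set_of_subset_topspace])
  moreover have "isolated_points Z \<subseteq> topspace Z"
    by (auto simp: isolated_points_def)
  ultimately show ?case
    using homeomorphic_map_closure_of[OF assms] by simp
next
  case (Suc j)
  then show ?case
    using homeomorphic_map_derived_set_of[OF assms rank_ge_subset] by simp
qed

lemma marked_homeomorphic:
  assumes "homeomorphic_map Z Z' f"
  shows "marked Z' i = f ` marked Z i"
proof -
  have f: "f ` topspace Z = topspace Z'" "inj_on f (topspace Z)"
    using assms by (auto dest: homeomorphic_imp_surjective_map homeomorphic_imp_injective_map)
  have diff: "f ` A - f ` B = f ` (A - B)" if "A \<subseteq> topspace Z" "B \<subseteq> topspace Z" for A B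
    using inj_on_image_set_diff[OF f(2), of A B] that by blast
  have "Z' closure_of (topspace Z' - rank_ge Z' 0) = f ` (Z closure_of (topspace Z - rank_ge Z 0))"
    unfolding rank_ge_homeomorphic[OF assms] f(1)[symmetric] diff[OF subset_refl rank_ge_subset]
    by (rule homeomorphic_map_closure_of[OF assms]) auto
  then show ?thesis
    unfolding marked_def rank_ge_homeomorphic[OF assms] diff[OF rank_ge_subset rank_ge_subset]
    using inj_on_image_Int[OF f(2), of "rank_ge Z i - rank_ge Z (Suc i)"
        "Z closure_of (topspace Z - rank_ge Z 0)"] rank_ge_subset[of Z i]
      closure_of_subset_topspace[of Z "topspace Z - rank_ge Z 0"] by auto
qed

lemma label_homeomorphic:
  assumes "homeomorphic_map Z Z' f" "p \<in> topspace Z"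
  shows "label Z' (f p) = label Z p"
proof -
  have "inj_on f (topspace Z)"
    using assms by (auto dest: homeomorphic_imp_injective_map)
  then have "f p \<in> f ` (Z closure_of marked Z i) \<longleftrightarrow> p \<in> Z closure_of marked Z i" for i
    using assms(2) closure_of_subset_topspace[of Z "marked Z i"] by (meson inj_on_image_mem_iff)
  then show ?thesis
    unfolding label_def marked_homeomorphic[OF assms(1)]
    by (simp add: homeomorphic_map_closure_of[OF assms(1) marked_subset])
qed

section \<open>Locality of the invariant\<close>

lemma derived_set_of_subtopology_open:
  assumes "openin Z U"
  shows "(subtopology Z U) derived_set_of (U \<inter> S) = U \<inter> Z derived_set_of S"
  using openin_Int_derived_set_of_eq[OF assms, of S] by (simp add: derived_set_of_subtopology)

lemma closure_of_subtopology_open_Int: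
  assumes "openin Z U"
  shows "(subtopology Z U) closure_of (U \<inter> S) = U \<inter> Z closure_of S"
  using openin_Int_closure_of_eq[OF assms, of S] by (simp add: closure_of_subtopology)

text \<open>Locality permits computing ranks and labels of finite ends after the end at infinity has
  been removed.\<close>

lemma rank_ge_open_subtopology:
  assumes "openin Z U"
  shows "rank_ge (subtopology Z U) j = U \<inter> rank_ge Z j"
proof (induction j)
  case 0
  have U: "topspace (subtopology Z U) = U \<inter> topspace Z"
    by auto
  have "isolated_points (subtopology Z U) = U \<inter> isolated_points Z"
    unfolding isolated_points_def U derived_set_of_subtopology_open[OF assms] by blast
  then show ?case
    by (simp add: closure_of_subtopology_open_Int[OF assms])
next
  case (Suc j)
  then show ?case
    by (simp add: derived_set_of_subtopology_open[OF assms])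
qed

lemma marked_open_subtopology:
  assumes "openin Z U"
  shows "marked (subtopology Z U) i = U \<inter> marked Z i"
proof -
  have "topspace (subtopology Z U) - U \<inter> rank_ge Z 0 = U \<inter> (topspace Z - rank_ge Z 0)"
    by auto
  then show ?thesis
    unfolding marked_def rank_ge_open_subtopology[OF assms]
    by (simp only: closure_of_subtopology_open_Int[OF assms]) blast
qed

lemma label_open_subtopology:
  assumes "openin Z U" "p \<in> U"
  shows "label (subtopology Z U) p = label Z p"
  using assms by (simp add: label_def marked_open_subtopology closure_of_subtopology_open_Int)

section \<open>A family of end spaces\<close>

text \<open>Number of the cluster, characteristic function of a set of natural numbers, and position
  in a Cantor set attached at that set. Below these are called \<open>k\<close>, \<open>F\<close>
  and \<open>G\<close>.\<close>

type_synonym code_point = "int \<times> (nat \<Rightarrow> bool) \<times> (nat \<Rightarrow> bool)"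

definition agree :: "nat \<Rightarrow> (nat \<Rightarrow> bool) \<Rightarrow> (nat \<Rightarrow> bool) \<Rightarrow> bool" where
  "agree N x y \<longleftrightarrow> (\<forall>i<N. x i = y i)"

definition cylinder :: "nat \<Rightarrow> code_point \<Rightarrow> code_point set" where
  "cylinder N p = {q. fst q = fst p \<and> agree N (fst (snd p)) (fst (snd q)) \<and> agree N (snd (snd p)) (snd (snd q))}"

lemma mem_cylinder [simp]:
  "(k', F', G') \<in> cylinder N (k, F, G) \<longleftrightarrow> k' = k \<and> agree N F F' \<and> agree N G G'"
  by (simp add: cylinder_def)

lemma agree_refl [simp]: "agree N x x"
  by (simp add: agree_def)

lemma agree_mono: "agree N x y \<Longrightarrow> M \<le> N \<Longrightarrow> agree M x y"
  by (simp add: agree_def)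

lemma open_agree: "open {y. agree N x y}"
proof -
  have "{y. agree N x y} = {y. \<forall>i\<in>{..<N}. y (id i) \<in> {x i}}"
    by (auto simp: agree_def)
  also have "open \<dots>"
    by (rule product_topology_basis') (auto intro: open_discrete)
  finally show ?thesis .
qed

lemma agree_nhds:
  assumes "open U" "x \<in> U"
  shows "\<exists>N. \<forall>y. agree N x y \<longrightarrow> y \<in> U"
proof -
  have "openin (product_topology (\<lambda>_. euclidean) UNIV) U"
    using assms(1) by (simp add: open_fun_def)
  from bspec[OF this[unfolded openin_product_topology_alt] assms(2)] obtain V where
    "finite {i \<in> UNIV. V i \<noteq> topspace euclidean}" "x \<in> PiE UNIV V" "PiE UNIV V \<subseteq> U"
    by (elim exE conjE)
  then have V: "finite {i. V i \<noteq> topspace euclidean}" "x \<in> PiE UNIV V" "PiE UNIV V \<subseteq> U"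
    by simp_all
  from finite_nat_set_iff_bounded[THEN iffD1, OF V(1)]
  obtain N where N: "\<forall>i\<in>{i. V i \<noteq> topspace euclidean}. i < N"
    by (elim exE)
  have "y \<in> U" if "agree N x y" for y
  proof -
    have "y i \<in> V i" for i
    proof (cases "i < N")
      case True
      then have "x i = y i"
        using that by (simp add: agree_def)
      moreover have "x i \<in> V i"
        using V(2) by (simp add: PiE_iff)
      ultimately show ?thesis
        by (rule subst[where P="\<lambda>b. b \<in> V i"])
    next
      case False
      then have "V i = UNIV"
        using N by auto
      then show ?thesis by simp
    qed
    then show ?thesis
      using V(3) by (auto simp: PiE_iff)
  qed
  then show ?thesis by blast
qed

lemma open_cylinder: "open (cylinder N p)"
proof -
  have "cylinder N p = {fst p} \<times> {y. agree N (fst (snd p)) y} \<times> {y. agree N (snd (snd p)) y}"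
    by (auto simp: cylinder_def)
  then show ?thesis
    by (simp add: open_Times open_agree open_discrete)
qed

lemma self_in_cylinder [simp]: "p \<in> cylinder N p"
  by (simp add: cylinder_def)

lemma cylinder_nhds:
  assumes "open W" "p \<in> W"
  shows "\<exists>N. cylinder N p \<subseteq> W"
proof -
  obtain A B where AB: "open A" "open B" "p \<in> A \<times> B" "A \<times> B \<subseteq> W"
    using open_prod_elim[OF assms] by blast
  then have "open B" "snd p \<in> B"
    by auto
  then obtain C D where CD: "open C" "open D" "snd p \<in> C \<times> D" "C \<times> D \<subseteq> B"
    using open_prod_elim by blast
  have mem: "fst (snd p) \<in> C" "snd (snd p) \<in> D"
    using CD(3) by (auto simp: mem_Times_iff)
  from agree_nhds[OF CD(1) mem(1)] obtain M where M: "\<forall>y. agree M (fst (snd p)) y \<longrightarrow> y \<in> C"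
    by (elim exE)
  from agree_nhds[OF CD(2) mem(2)] obtain N where N: "\<forall>y. agree N (snd (snd p)) y \<longrightarrow> y \<in> D"
    by (elim exE)
  have "cylinder (max M N) p \<subseteq> W"
  proof
    fix q assume q: "q \<in> cylinder (max M N) p"
    then have "fst (snd q) \<in> C" "snd (snd q) \<in> D" "fst q = fst p"
      using M N agree_mono[of "max M N"] by (auto simp: cylinder_def)
    then have "q \<in> A \<times> B"
      using CD(4) AB(3) by (auto simp: mem_Times_iff)
    then show "q \<in> W"
      using AB(4) by blast
  qed
  then show ?thesis by blast
qed

lemma derived_set_of_cylinder:
  assumes "S \<subseteq> Z"
  shows "p \<in> top_of_set Z derived_set_of S \<longleftrightarrow> p \<in> Z \<and> (\<forall>N. \<exists>q\<in>S. q \<noteq> p \<and> q \<in> cylinder N p)"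
proof
  assume p: "p \<in> top_of_set Z derived_set_of S"
  have "\<exists>q\<in>S. q \<noteq> p \<and> q \<in> cylinder N p" for N
  proof -
    have "openin (top_of_set Z) (Z \<inter> cylinder N p)"
      using open_cylinder by (rule openin_open_Int)
    moreover have "p \<in> Z \<inter> cylinder N p"
      using p by (simp add: in_derived_set_of)
    moreover note p[unfolded in_derived_set_of, THEN conjunct2]
    ultimately show ?thesis
      by (meson IntD2)
  qed
  then show "p \<in> Z \<and> (\<forall>N. \<exists>q\<in>S. q \<noteq> p \<and> q \<in> cylinder N p)"
    using p by (simp add: in_derived_set_of)
next
  assume p: "p \<in> Z \<and> (\<forall>N. \<exists>q\<in>S. q \<noteq> p \<and> q \<in> cylinder N p)"
  have "\<exists>q. q \<noteq> p \<and> q \<in> S \<and> q \<in> T" if T: "openin (top_of_set Z) T" "p \<in> T" for T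
  proof -
    obtain W where W: "open W" "T = Z \<inter> W"
      using T(1) unfolding openin_open by auto
    then have "p \<in> W"
      using T(2) by simp
    from cylinder_nhds[OF W(1) this] obtain N where N: "cylinder N p \<subseteq> W"
      by (elim exE)
    obtain q where q: "q \<in> S" "q \<noteq> p \<and> q \<in> cylinder N p"
      using p by blast
    then show ?thesis
      using N W(2) assms by blast
  qed
  then show "p \<in> top_of_set Z derived_set_of S"
    using p unfolding in_derived_set_of by simp
qed

lemma closure_of_cylinder:
  assumes "S \<subseteq> Z"
  shows "p \<in> top_of_set Z closure_of S \<longleftrightarrow> p \<in> Z \<and> (\<forall>N. \<exists>q\<in>S. q \<in> cylinder N p)"
  unfolding closure_of Int_iff Un_iff derived_set_of_cylinder[OF assms] topspace_euclidean_subtopology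
  using self_in_cylinder[of p] assms by (cases "p \<in> S") (blast, metis)

abbreviation emp :: "nat \<Rightarrow> bool" where "emp \<equiv> \<lambda>_. False"

abbreviation sing :: "nat \<Rightarrow> nat \<Rightarrow> bool" where "sing m \<equiv> \<lambda>i. i = m"

definition least :: "(nat \<Rightarrow> bool) \<Rightarrow> nat \<Rightarrow> bool" where
  "least F m \<longleftrightarrow> F m \<and> (\<forall>i<m. \<not> F i)"

lemma least_unique: "least F m \<Longrightarrow> least F m' \<Longrightarrow> m = m'"
  unfolding least_def by (metis nat_neq_iff)

lemma ex_least: "F \<noteq> emp \<Longrightarrow> \<exists>m. least F m"
  unfolding least_def fun_eq_iff by (metis LeastI not_less_Least)

lemma least_sing: "least (sing m) m' \<longleftrightarrow> m' = m"
  by (auto simp: least_def)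

lemma not_least_emp [simp]: "\<not> least emp m"
  by (simp add: least_def)

text \<open>As a component of the pairing it takes every value infinitely often, so that singletons
  of each rank occur arbitrarily close to the empty set.\<close>

definition level :: "nat \<Rightarrow> nat" where
  "level m = fst (prod_decode m)"

lemma ex_level: "\<exists>m\<ge>N. level m = a"
  using le_prod_encode_2[of N a] by (intro exI[of _ "prod_encode (a, N)"]) (simp add: level_def)

text \<open>The finite sets \<open>F\<close> with \<open>|F| \<le> level (min F) + 2\<close> form a compact subspace of the Cantor
  space, in the style of the Schreier family. All its members near \<open>F \<noteq> {}\<close> arise from \<open>F\<close> by
  appending large elements, so that the Cantor-Bendixson rank of \<open>F\<close> is
  \<open>level (min F) + 2 - |F|\<close>, while the empty set has infinite rank.\<close>

definition family :: "nat \<Rightarrow> (nat \<Rightarrow> bool) set" where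
  "family j = {F. \<forall>m. least F m \<longrightarrow> finite (Collect F) \<and> card (Collect F) + j \<le> level m + 2}"

text \<open>At the point \<open>{m}\<close> a Cantor set is attached whenever \<open>D k (level m)\<close> holds.\<close>

definition end_codes :: "(int \<Rightarrow> nat \<Rightarrow> bool) \<Rightarrow> code_point set" where
  "end_codes D = {(k, F, G). F \<in> family 0 \<and>
     (G = emp \<or> (\<exists>m. F = sing m \<and> D k (level m) \<and> (\<forall>i. G i \<longrightarrow> m \<le> i)))}"

lemma emp_in_family [simp]: "emp \<in> family j"
  by (simp add: family_def)

lemma familyI:
  assumes "least F m" "finite (Collect F)" "card (Collect F) + j \<le> level m + 2"
  shows "F \<in> family j"
  unfolding family_def
proof (intro CollectI allI impI)
  fix m' assume "least F m'"
  then have "m' = m"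
    using assms(1) by (rule least_unique)
  then show "finite (Collect F) \<and> card (Collect F) + j \<le> level m' + 2"
    using assms(2,3) by simp
qed

lemma family_finite:
  assumes "F \<in> family j"
  shows "finite (Collect F)"
proof (cases "F = emp")
  case False
  then show ?thesis
    using assms ex_least[OF False] by (auto simp: family_def)
qed simp

lemma family_subset: "family j \<subseteq> family 0"
  by (auto simp: family_def)

lemma sing_in_family: "sing m \<in> family j \<longleftrightarrow> j \<le> Suc (level m)"
  by (auto simp: family_def least_sing)

lemma finite_bounded:
  assumes "finite (Collect F)"
  obtains M where "M \<ge> N" "\<And>i :: nat. F i \<Longrightarrow> i < M"
proof -
  obtain M where "\<forall>i\<in>Collect F. i < M"
    using assms finite_nat_set_iff_bounded by blast
  then show ?thesis
    by (intro that[of "max M N"]) auto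
qed

lemma agree_extends:
  assumes "agree N F F'" "\<And>i. F i \<Longrightarrow> i < N"
  shows "Collect F \<subseteq> Collect F'"
  using assms by (auto simp: agree_def)

lemma agree_least:
  assumes "agree N F F'" "\<And>i. F i \<Longrightarrow> i < N" "least F m"
  shows "least F' m"
  using assms unfolding agree_def least_def by (metis less_trans)

text \<open>A block of \<open>r\<close> consecutive elements is placed beyond \<open>N\<close> and
  beyond all elements of \<open>F\<close>. Raising the cardinality while keeping the minimum lowers
  the rank without leaving a given neighbourhood.\<close>

lemma append_block:
  assumes "finite (Collect F)"
  obtains F' where "agree N F F'" "finite (Collect F')" "card (Collect F') = card (Collect F) + r"
    "\<And>m. least F m \<Longrightarrow> least F' m" "r > 0 \<Longrightarrow> F' \<noteq> F"
proof -
  obtain M where M: "M \<ge> N" "\<And>i. F i \<Longrightarrow> i < M"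
    using finite_bounded[OF assms] by blast
  define F' where "F' i \<longleftrightarrow> F i \<or> M \<le> i \<and> i < M + r" for i
  have C: "Collect F' = Collect F \<union> {M..<M + r}"
    by (auto simp: F'_def)
  have "agree M F F'"
    by (auto simp: agree_def F'_def)
  show ?thesis
  proof
    show "agree N F F'"
      using \<open>agree M F F'\<close> M(1) by (rule agree_mono)
    show "finite (Collect F')"
      using assms by (simp add: C)
    have "Collect F \<inter> {M..<M + r} = {}"
      using M(2) by force
    then show "card (Collect F') = card (Collect F) + r"
      using assms by (simp add: C card_Un_disjoint)
    show "least F' m" if "least F m" for m
      using \<open>agree M F F'\<close> M(2) that by (rule agree_least)
    show "F' \<noteq> F" if "r > 0"
    proof -
      have "F' M" "\<not> F M"
        using that M(2) by (auto simp: F'_def)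
      then show ?thesis by auto
    qed
  qed
qed

section \<open>Ranks and labels in the end space\<close>

context
  fixes D :: "int \<Rightarrow> nat \<Rightarrow> bool"
begin

text \<open>The points with trivial Cantor coordinate. For each \<open>j\<close> these turn out to
  be the points of rank at least \<open>j\<close>, in all clusters at once.\<close>

definition scattered :: "nat \<Rightarrow> code_point set" where
  "scattered j = {(k, F, G). F \<in> family j \<and> G = emp}"

lemma scattered_subset: "scattered j \<subseteq> end_codes D"
  using family_subset by (auto simp: scattered_def end_codes_def)

lemma isolated_subset: "isolated_points (top_of_set (end_codes D)) \<subseteq> scattered 0"
proof
  fix p assume p: "p \<in> isolated_points (top_of_set (end_codes D))"
  obtain k F G where kFG: "p = (k, F, G)"
    by (cases p)
  have pZ: "(k, F, G) \<in> end_codes D"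
    using p by (simp add: isolated_points_def kFG)
  have "G = emp"
  proof (rule ccontr)
    assume "G \<noteq> emp"
    then obtain m where m: "F = sing m" "D k (level m)" "\<forall>i. G i \<longrightarrow> m \<le> i" "F \<in> family 0"
      using pZ by (auto simp: end_codes_def)
    have "\<exists>q\<in>end_codes D. q \<noteq> (k, F, G) \<and> q \<in> cylinder N (k, F, G)" for N
    proof (intro bexI conjI)
      \<comment> \<open>Flipping a bit at a position beyond \<open>N\<close> stays in the cylinder,
        and a position beyond \<open>m\<close> respects the support condition on
        \<open>G\<close>.\<close>
      let ?i = "max N m"
      let ?G = "G(?i := \<not> G ?i)"
      show "(k, F, ?G) \<noteq> (k, F, G)"
        by (auto simp: fun_eq_iff)
      show "(k, F, ?G) \<in> cylinder N (k, F, G)"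
        by (auto simp: agree_def)
      show "(k, F, ?G) \<in> end_codes D"
        using m by (auto simp: end_codes_def)
    qed
    then have "(k, F, G) \<in> top_of_set (end_codes D) derived_set_of end_codes D"
      using pZ derived_set_of_cylinder[of "end_codes D" "end_codes D"] by blast
    then show False
      using p by (simp add: isolated_points_def kFG)
  qed
  then show "p \<in> scattered 0"
    using pZ by (auto simp: kFG scattered_def end_codes_def)
qed

text \<open>Nothing can be appended to a member of maximal cardinality. The constant 2 in
  \<open>family\<close> matters here: such a member has at least two elements, so it is not a
  singleton and carries no Cantor set that would destroy its isolation.\<close>

lemma isolatedI:
  assumes "F \<in> family 0" "least F m" "card (Collect F) = level m + 2"
  shows "(k, F, emp) \<in> isolated_points (top_of_set (end_codes D))"
proof -
  have fin: "finite (Collect F)"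
    using assms(1) by (rule family_finite)
  obtain N where N: "\<And>i. F i \<Longrightarrow> i < N"
    using finite_bounded[OF fin] by blast
  have "q = (k, F, emp)" if "q \<in> end_codes D" "q \<in> cylinder N (k, F, emp)" for q
  proof -
    obtain F' G' where q: "q = (k, F', G')" "agree N F F'"
      using \<open>q \<in> cylinder N (k, F, emp)\<close> by (cases q) auto
    have F': "F' \<in> family 0"
      using \<open>q \<in> end_codes D\<close> by (auto simp: q end_codes_def)
    have "least F' m"
      using agree_least[OF q(2) N assms(2)] by blast
    then have "finite (Collect F')" "card (Collect F') \<le> card (Collect F)"
      using F' assms(3) by (auto simp: family_def)
    moreover have "Collect F \<subseteq> Collect F'"
      using agree_extends[OF q(2) N] .
    ultimately have "Collect F = Collect F'"
      using card_seteq by blast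
    then have "F = F'"
      by (simp add: Collect_inj)
    moreover have "F \<noteq> sing m'" for m'
      using assms(3) by auto
    ultimately show ?thesis
      using \<open>q \<in> end_codes D\<close> by (auto simp: q end_codes_def)
  qed
  then have "(k, F, emp) \<notin> top_of_set (end_codes D) derived_set_of end_codes D"
    using derived_set_of_cylinder[of "end_codes D" "end_codes D"] by blast
  moreover have "(k, F, emp) \<in> end_codes D"
    using assms(1) by (simp add: end_codes_def)
  ultimately show ?thesis
    by (simp add: isolated_points_def)
qed

text \<open>Padding a finite set with large elements up to the maximal cardinality produces isolated
  points nearby. Conversely, isolated points have trivial Cantor coordinate, and this passes to
  limits.\<close>

lemma closure_isolated: "top_of_set (end_codes D) closure_of isolated_points (top_of_set (end_codes D)) = scattered 0"
proof -
  have sub: "isolated_points (top_of_set (end_codes D)) \<subseteq> end_codes D"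
    by (auto simp: isolated_points_def)
  show ?thesis
  proof (rule subset_antisym; rule subsetI)
    fix p assume "p \<in> top_of_set (end_codes D) closure_of isolated_points (top_of_set (end_codes D))"
    then have p: "p \<in> end_codes D" "\<And>N. \<exists>q\<in>isolated_points (top_of_set (end_codes D)). q \<in> cylinder N p"
      unfolding closure_of_cylinder[OF sub] by blast+
    obtain k F G where kFG: "p = (k, F, G)"
      by (cases p)
    have "\<not> G i" for i
    proof -
      obtain q where "q \<in> scattered 0" "q \<in> cylinder (Suc i) p"
        using p(2) isolated_subset by blast
      then show ?thesis
        by (auto simp: kFG scattered_def agree_def)
    qed
    then show "p \<in> scattered 0"
      using p(1) by (auto simp: kFG scattered_def end_codes_def)
  next
    fix p assume pS: "p \<in> scattered 0"
    then obtain k F where p: "p = (k, F, emp)" "F \<in> family 0"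
      by (auto simp: scattered_def)
    have "\<exists>q\<in>isolated_points (top_of_set (end_codes D)). q \<in> cylinder N p" for N
    proof (cases "F = emp")
      case True
      \<comment> \<open>An isolated point near the empty set: a block with minimum \<open>N\<close>,
        as long as the level of \<open>N\<close> permits.\<close>
      define F' where "F' i \<longleftrightarrow> N \<le> i \<and> i < N + (level N + 2)" for i
      have C: "Collect F' = {N..<N + (level N + 2)}"
        by (auto simp: F'_def)
      have L: "least F' N"
        by (auto simp: F'_def least_def)
      have card: "card (Collect F') = level N + 2"
        unfolding C by simp
      have "F' \<in> family 0"
        by (rule familyI[OF L]) (simp_all add: card, simp add: C)
      from isolatedI[OF this L card] have "(k, F', emp) \<in> isolated_points (top_of_set (end_codes D))" .
      moreover have "agree N F F'"
        by (auto simp: True agree_def F'_def)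
      ultimately show ?thesis
        by (intro bexI[of _ "(k, F', emp)"]) (simp_all add: p)
    next
      case False
      then obtain m where m: "least F m"
        using ex_least by blast
      then have fin: "finite (Collect F)" "card (Collect F) \<le> level m + 2"
        using p(2) by (auto simp: family_def)
      obtain F' where F': "agree N F F'" "finite (Collect F')"
        "card (Collect F') = card (Collect F) + (level m + 2 - card (Collect F))" "least F' m"
        using append_block[OF fin(1), of N "level m + 2 - card (Collect F)"] m by metis
      then have card: "card (Collect F') = level m + 2"
        using fin(2) by simp
      have "F' \<in> family 0"
        by (rule familyI[OF F'(4,2)]) (simp add: card)
      from isolatedI[OF this F'(4) card]
      have "(k, F', emp) \<in> isolated_points (top_of_set (end_codes D))" .
      then show ?thesis
        using F'(1) by (intro bexI[of _ "(k, F', emp)"]) (simp_all add: p)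
    qed
    then show "p \<in> top_of_set (end_codes D) closure_of isolated_points (top_of_set (end_codes D))"
      unfolding closure_of_cylinder[OF sub] using pS scattered_subset by blast
  qed
qed

text \<open>Near a nonempty \<open>F\<close> every other member properly contains \<open>F\<close>
  and has the same minimum, so its rank is smaller by at least one. The empty set is approached by
  singletons of every level and survives each derivative.\<close>

lemma derived_scattered: "top_of_set (end_codes D) derived_set_of scattered j = scattered (Suc j)"
proof (rule subset_antisym; rule subsetI)
  fix p assume "p \<in> top_of_set (end_codes D) derived_set_of scattered j"
  then have p: "p \<in> end_codes D" "\<And>N. \<exists>q\<in>scattered j. q \<noteq> p \<and> q \<in> cylinder N p"
    unfolding derived_set_of_cylinder[OF scattered_subset] by blast+
  obtain k F G where kFG: "p = (k, F, G)"
    by (cases p)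
  have "\<not> G i" for i
  proof -
    obtain q where "q \<in> scattered j" "q \<in> cylinder (Suc i) p"
      using p(2) by blast
    then show ?thesis
      by (auto simp: kFG scattered_def agree_def)
  qed
  then have G: "G = emp"
    by auto
  have F: "F \<in> family 0"
    using p(1) by (auto simp: kFG end_codes_def)
  have "F \<in> family (Suc j)"
    unfolding family_def
  proof (intro CollectI allI impI)
    fix m assume m: "least F m"
    have fin: "finite (Collect F)"
      using F by (rule family_finite)
    obtain N where N: "\<And>i. F i \<Longrightarrow> i < N"
      using finite_bounded[OF fin] by blast
    obtain q where q: "q \<in> scattered j" "q \<noteq> p" "q \<in> cylinder N p"
      using p(2) by blast
    obtain k' F' G' where q': "q = (k', F', G')"
      by (cases q)
    have F': "F' \<in> family j" "F' \<noteq> F" "agree N F F'"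
      using q unfolding q' kFG G scattered_def by simp_all
    have "least F' m"
      using agree_least[OF F'(3) N m] by blast
    then have "finite (Collect F')" "card (Collect F') + j \<le> level m + 2"
      using F'(1) by (auto simp: family_def)
    moreover have "Collect F \<subset> Collect F'"
      using agree_extends[OF F'(3) N] F'(2) by (metis Collect_inj psubsetI)
    ultimately show "finite (Collect F) \<and> card (Collect F) + Suc j \<le> level m + 2"
      using fin psubset_card_mono[of "Collect F'" "Collect F"] by simp
  qed
  then show "p \<in> scattered (Suc j)"
    by (simp add: kFG G scattered_def)
next
  fix p assume pS: "p \<in> scattered (Suc j)"
  then obtain k F where p: "p = (k, F, emp)" "F \<in> family (Suc j)"
    by (auto simp: scattered_def)
  have "\<exists>q\<in>scattered j. q \<noteq> p \<and> q \<in> cylinder N p" for N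
  proof (cases "F = emp")
    case True
    \<comment> \<open>A singleton of level \<open>j\<close> has rank j + 1, which suffices for
      \<open>family j\<close>.\<close>
    obtain m where m: "m \<ge> N" "level m = j"
      using ex_level by blast
    have "sing m \<in> family j"
      using m(2) by (simp add: sing_in_family)
    moreover have "agree N emp (sing m)"
      using m(1) by (auto simp: agree_def)
    moreover have "sing m \<noteq> emp"
      by (auto simp: fun_eq_iff)
    ultimately show ?thesis
      by (intro bexI[of _ "(k, sing m, emp)"]) (simp_all add: p True scattered_def)
  next
    case False
    then obtain m where m: "least F m"
      using ex_least by blast
    then have fin: "finite (Collect F)" "card (Collect F) + Suc j \<le> level m + 2"
      using p(2) by (auto simp: family_def)
    obtain F' where F': "agree N F F'" "finite (Collect F')" "card (Collect F') = card (Collect F) + 1"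
      "least F' m" "F' \<noteq> F"
      using append_block[OF fin(1), of N 1] m by (metis zero_less_one)
    have "F' \<in> family j"
      using F'(3) fin(2) by (intro familyI[OF F'(4,2)]) simp
    then show ?thesis
      using F'(1,5) by (intro bexI[of _ "(k, F', emp)"]) (simp_all add: p scattered_def)
  qed
  then show "p \<in> top_of_set (end_codes D) derived_set_of scattered j"
    unfolding derived_set_of_cylinder[OF scattered_subset] using pS scattered_subset by blast
qed

lemma rank_ge_end_codes: "rank_ge (top_of_set (end_codes D)) j = scattered j"
  by (induction j) (simp_all add: closure_isolated derived_scattered)

text \<open>Points outside \<open>scattered 0\<close> lie on Cantor sets over singletons, and a
  cylinder longer than \<open>F\<close> recognises the singleton. The rank of {m} is
  \<open>level m\<close> + 2 - 1, whence the successor.\<close>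

lemma marked_end_codes:
  "marked (top_of_set (end_codes D)) i = {(k, F, G). \<exists>m. F = sing m \<and> G = emp \<and> D k (level m) \<and> i = Suc (level m)}"
proof -
  have sub: "end_codes D - scattered 0 \<subseteq> end_codes D"
    by blast
  have mark: "marked (top_of_set (end_codes D)) i =
      (scattered i - scattered (Suc i)) \<inter> top_of_set (end_codes D) closure_of (end_codes D - scattered 0)"
    unfolding marked_def rank_ge_end_codes by simp
  show ?thesis
    unfolding mark
  proof (rule subset_antisym; rule subsetI)
    fix p assume p: "p \<in> (scattered i - scattered (Suc i)) \<inter> top_of_set (end_codes D) closure_of (end_codes D - scattered 0)"
    have near: "\<exists>q\<in>end_codes D - scattered 0. q \<in> cylinder N p" for N
      using closure_of_cylinder[OF sub, THEN iffD1, OF IntD2[OF p]] by blast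
    obtain k F where kF: "p = (k, F, emp)" "F \<in> family i" "F \<notin> family (Suc i)"
      using p by (auto simp: scattered_def)
    then have "F \<noteq> emp"
      using emp_in_family by blast
    then obtain i0 where i0: "F i0"
      by auto
    obtain N where N: "\<And>i. F i \<Longrightarrow> i < N"
      using finite_bounded[OF family_finite[OF kF(2)]] by blast
    obtain q where q: "q \<in> end_codes D - scattered 0" "q \<in> cylinder N p"
      using near by blast
    obtain k' F' G' where q': "q = (k', F', G')"
      by (cases q)
    have "k' = k" "agree N F F'" and qZ: "(k', F', G') \<in> end_codes D" and "(k', F', G') \<notin> scattered 0"
      using q unfolding q' kF by simp_all
    moreover from this have "G' \<noteq> emp"
      unfolding scattered_def end_codes_def by blast
    ultimately obtain m where m: "D k (level m)" "agree N F (sing m)"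
      unfolding end_codes_def by blast
    have "i = m" if "F i" for i
      using m(2) N[OF that] that by (auto simp: agree_def)
    then have "F = sing m"
      using i0 by auto
    moreover from this have "i = Suc (level m)"
      using kF(2,3) by (simp add: sing_in_family)
    ultimately show "p \<in> {(k, F, G). \<exists>m. F = sing m \<and> G = emp \<and> D k (level m) \<and> i = Suc (level m)}"
      using m(1) by (auto simp: kF(1))
  next
    fix p assume "p \<in> {(k, F, G). \<exists>m. F = sing m \<and> G = emp \<and> D k (level m) \<and> i = Suc (level m)}"
    then obtain k m where p: "p = (k, sing m, emp)" "D k (level m)" "i = Suc (level m)"
      by auto
    have pS: "p \<in> scattered i - scattered (Suc i)"
      by (simp add: p scattered_def sing_in_family)
    have "\<exists>q\<in>end_codes D - scattered 0. q \<in> cylinder N p" for N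
    proof (intro bexI)
      \<comment> \<open>A single Cantor bit beyond both \<open>N\<close> and \<open>m\<close> is
        invisible to the cylinder, yet takes the point out of \<open>scattered 0\<close>.\<close>
      let ?q = "(k, sing m, sing (max N m))"
      show "?q \<in> cylinder N p"
        by (auto simp: p agree_def)
      have "sing (max N m) \<noteq> emp"
        by (auto simp: fun_eq_iff)
      then show "?q \<in> end_codes D - scattered 0"
        using p(2) by (auto simp: end_codes_def scattered_def sing_in_family intro!: exI[of _ m])
    qed
    moreover have "p \<in> end_codes D"
      using pS scattered_subset by blast
    ultimately have "p \<in> top_of_set (end_codes D) closure_of (end_codes D - scattered 0)"
      unfolding closure_of_cylinder[OF sub] by blast
    then show "p \<in> (scattered i - scattered (Suc i)) \<inter> top_of_set (end_codes D) closure_of (end_codes D - scattered 0)"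
      using pS by blast
  qed
qed

text \<open>The empty set is the centre of its cluster: each level is attained by arbitrarily large
  \<open>m\<close>, so all marked ranks of cluster \<open>k\<close> accumulate there, while the
  integer coordinate shields it from the other clusters.\<close>

lemma label_end_codes: "label (top_of_set (end_codes D)) (k, emp, emp) = Suc ` {a. D k a}"
proof -
  have sub: "marked (top_of_set (end_codes D)) i \<subseteq> end_codes D" for i
    using marked_subset[of "top_of_set (end_codes D)" i] by simp
  have "(k, emp, emp) \<in> end_codes D"
    by (simp add: end_codes_def)
  then have "i \<in> label (top_of_set (end_codes D)) (k, emp, emp) \<longleftrightarrow>
      (\<forall>N. \<exists>q\<in>marked (top_of_set (end_codes D)) i. q \<in> cylinder N (k, emp, emp))" for i
    unfolding label_def by (simp add: closure_of_cylinder[OF sub])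
  also have "\<dots> i \<longleftrightarrow> i \<in> Suc ` {a. D k a}" for i
  proof
    assume "\<forall>N. \<exists>q\<in>marked (top_of_set (end_codes D)) i. q \<in> cylinder N (k, emp, emp)"
    then obtain q where "q \<in> marked (top_of_set (end_codes D)) i" "q \<in> cylinder 0 (k, emp, emp)"
      by blast
    then show "i \<in> Suc ` {a. D k a}"
      unfolding marked_end_codes by auto
  next
    assume "i \<in> Suc ` {a. D k a}"
    then obtain a where a: "i = Suc a" "D k a"
      by blast
    show "\<forall>N. \<exists>q\<in>marked (top_of_set (end_codes D)) i. q \<in> cylinder N (k, emp, emp)"
    proof
      fix N
      obtain m where m: "m \<ge> N" "level m = a"
        using ex_level by blast
      have "agree N emp (sing m)"
        using m(1) by (auto simp: agree_def)
      moreover have "(k, sing m, emp) \<in> marked (top_of_set (end_codes D)) i"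
        unfolding marked_end_codes using a m(2) by auto
      ultimately show "\<exists>q\<in>marked (top_of_set (end_codes D)) i. q \<in> cylinder N (k, emp, emp)"
        by (intro bexI[of _ "(k, sing m, emp)"]) simp_all
    qed
  qed
  finally show ?thesis by blast
qed

text \<open>Members of the family are finite sets. This countability bounds the number of labels
  available in one end space, and thereby the size of homeomorphism classes of parameters.\<close>

lemma countable_rank_ge_end_codes: "countable (rank_ge (top_of_set (end_codes D)) 0)"
proof -
  have "rank_ge (top_of_set (end_codes D)) 0 \<subseteq> UNIV \<times> (\<lambda>A i. i \<in> A) ` {A. finite A} \<times> {emp}"
  proof
    fix p assume "p \<in> rank_ge (top_of_set (end_codes D)) 0"
    then obtain k F where p: "p = (k, F, emp)" "F \<in> family 0"
      unfolding rank_ge_end_codes by (auto simp: scattered_def)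
    have "F \<in> (\<lambda>A i. i \<in> A) ` {A. finite A}"
      using family_finite[OF p(2)] by (intro image_eqI[of _ _ "Collect F"]) auto
    then show "p \<in> UNIV \<times> (\<lambda>A i. i \<in> A) ` {A. finite A} \<times> {emp}"
      by (simp add: p)
  qed
  moreover have "countable ((UNIV :: int set) \<times> (\<lambda>A (i :: nat). i \<in> A) ` {A. finite A} \<times> {emp})"
    by (intro countable_SIGMA countable_image countable_Collect_finite) auto
  ultimately show ?thesis
    by (rule countable_subset)
qed

text \<open>Both conditions pass to limits: the cardinality bound because a finite cylinder fixes
  the minimum of \<open>F\<close>, the support condition because a nonzero bit of \<open>G\<close>
  bounds \<open>m\<close>, so that the singleton stabilises.\<close>

lemma closed_end_codes: "closed (end_codes D)"
proof -
  have "\<exists>N. cylinder N p \<inter> end_codes D = {}" if "p \<notin> end_codes D" for p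
  proof (rule ccontr)
    assume "\<nexists>N. cylinder N p \<inter> end_codes D = {}"
    then have near: "\<And>N. \<exists>F' G'. (fst p, F', G') \<in> end_codes D \<and> agree N (fst (snd p)) F' \<and> agree N (snd (snd p)) G'"
      by (fastforce simp: cylinder_def)
    obtain k F G where kFG: "p = (k, F, G)"
      by (cases p)
    have "F \<in> family 0"
      unfolding family_def
    proof (intro CollectI allI impI)
      fix m assume m: "least F m"
      have *: "card {i. i < N \<and> F i} \<le> level m + 2" for N
      proof -
        obtain F' G' where F': "(k, F', G') \<in> end_codes D" "agree (max N (Suc m)) F F'"
          using near[of "max N (Suc m)"] by (auto simp: kFG)
        have "least F' m"
          using m F'(2) by (auto simp: least_def agree_def)
        then have "finite (Collect F')" "card (Collect F') \<le> level m + 2"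
          using F'(1) by (auto simp: end_codes_def family_def)
        moreover have "{i. i < N \<and> F i} \<subseteq> Collect F'"
          using F'(2) by (auto simp: agree_def)
        ultimately show ?thesis
          using card_mono le_trans by blast
      qed
      have fin: "finite (Collect F)"
      proof (rule ccontr)
        assume "infinite (Collect F)"
        then obtain A where A: "A \<subseteq> Collect F" "finite A" "card A = level m + 3"
          using infinite_arbitrarily_large by blast
        then obtain N where "\<forall>i\<in>A. i < N"
          using finite_nat_set_iff_bounded by blast
        then have "A \<subseteq> {i. i < N \<and> F i}"
          using A(1) by blast
        then have "card A \<le> card {i. i < N \<and> F i}"
          by (intro card_mono) auto
        then show False
          using *[of N] A(3) by simp
      qed
      obtain N where "\<And>i. F i \<Longrightarrow> i < N"
        using finite_bounded[OF fin] by blast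
      then have "Collect F = {i. i < N \<and> F i}"
        by blast
      then show "finite (Collect F) \<and> card (Collect F) + 0 \<le> level m + 2"
        using fin *[of N] by simp
    qed
    moreover have "\<exists>m. F = sing m \<and> D k (level m) \<and> (\<forall>i. G i \<longrightarrow> m \<le> i)" if ne: "G \<noteq> emp"
    proof -
      obtain i0 where i0: "G i0"
        using ne by auto
      obtain N where N: "N \<ge> Suc i0" "\<And>i. F i \<Longrightarrow> i < N"
        using finite_bounded[OF family_finite[OF \<open>F \<in> family 0\<close>]] by blast
      obtain F' G' where q: "(k, F', G') \<in> end_codes D" "agree N F F'" "agree N G G'"
        using near[of N] by (auto simp: kFG)
      have "G' i0"
        using i0 N(1) q(3) by (auto simp: agree_def)
      then obtain m where m: "F' = sing m" "D k (level m)" "\<forall>i. G' i \<longrightarrow> m \<le> i"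
        using q(1) by (auto simp: end_codes_def)
      \<comment> \<open>The support condition forces \<open>m \<le> i0\<close>, which keeps the
        singletons carrying these Cantor sets from escaping to infinity.\<close>
      have "m < N"
        using m(3) \<open>G' i0\<close> N(1) by force
      have F: "F i \<longleftrightarrow> i = m" for i
        using q(2) N(2) \<open>m < N\<close> unfolding m(1) agree_def by blast
      have "m \<le> i" if "G i" for i
      proof (rule ccontr)
        assume "\<not> m \<le> i"
        then have "i < N"
          using \<open>m < N\<close> by simp
        then have "G' i"
          using that q(3) by (simp add: agree_def)
        then show False
          using m(3) \<open>\<not> m \<le> i\<close> by blast
      qed
      then show ?thesis
        using F m(2) by blast
    qed
    ultimately have "p \<in> end_codes D"
      unfolding kFG end_codes_def by blast
    then show False
      using that by blast
  qed
  then have "\<exists>T. open T \<and> p \<in> T \<and> T \<subseteq> - end_codes D" if "p \<in> - end_codes D" for p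
    using open_cylinder self_in_cylinder that by (metis ComplD disjoint_eq_subset_Compl)
  then have "open (- end_codes D)"
    by (subst open_subopen) blast
  then show ?thesis
    by (simp add: closed_def)
qed

end

subsection \<open>Embedding into the line\<close>

text \<open>With digits 0 and 1 in base 4, everything after the first digit adds up to at most 1/12,
  less than the weight 1/4 of that digit, so the digits can be recovered. All values lie in [0,1/3],
  which leaves gaps between consecutive clusters.\<close>

definition cantor :: "(nat \<Rightarrow> bool) \<Rightarrow> real" where
  "cantor x = (\<Sum>i. of_bool (x i) * (1 / 4) ^ Suc i)"

lemma sums_quarter: "(\<lambda>i. (1 / 4 :: real) ^ Suc i) sums (1 / 3)"
  using sums_mult[OF geometric_sums[of "1 / 4 :: real"], of "1 / 4"] by simp

lemma summable_cantor: "summable (\<lambda>i. of_bool (x i) * (1 / 4 :: real) ^ Suc i)"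
  by (rule summable_comparison_test'[OF sums_summable[OF sums_quarter], of 0]) simp

lemma cantor_bounds: "0 \<le> cantor x" "cantor x \<le> 1 / 3"
proof -
  show "0 \<le> cantor x"
    unfolding cantor_def by (rule suminf_nonneg[OF summable_cantor]) simp
  have "cantor x \<le> (\<Sum>i. (1 / 4) ^ Suc i)"
    unfolding cantor_def
    by (rule suminf_le[OF _ summable_cantor sums_summable[OF sums_quarter]]) simp
  then show "cantor x \<le> 1 / 3"
    using sums_quarter by (simp add: sums_iff)
qed

lemma cantor_rec: "cantor x = of_bool (x 0) / 4 + cantor (\<lambda>i. x (Suc i)) / 4"
proof -
  have "cantor x = of_bool (x 0) / 4 + (\<Sum>i. of_bool (x (Suc i)) * (1 / 4) ^ Suc (Suc i))"
    unfolding cantor_def using suminf_split_head[OF summable_cantor[of x]] by simp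
  also have "(\<Sum>i. of_bool (x (Suc i)) * (1 / 4 :: real) ^ Suc (Suc i)) = cantor (\<lambda>i. x (Suc i)) / 4"
    unfolding cantor_def using suminf_mult[OF summable_cantor[of "\<lambda>i. x (Suc i)"], of "1 / 4"]
    by (simp add: mult.left_commute)
  finally show ?thesis .
qed

lemma cantor_eq_digit:
  assumes "cantor x = cantor y"
  shows "x 0 = y 0" "cantor (\<lambda>i. x (Suc i)) = cantor (\<lambda>i. y (Suc i))"
proof -
  have eq: "of_bool (x 0) / 4 + cantor (\<lambda>i. x (Suc i)) / 4 = of_bool (y 0) / 4 + cantor (\<lambda>i. y (Suc i)) / 4"
    using assms cantor_rec[of x] cantor_rec[of y] by simp
  show "x 0 = y 0"
    using eq cantor_bounds[of "\<lambda>i. x (Suc i)"] cantor_bounds[of "\<lambda>i. y (Suc i)"]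
    by (cases "x 0"; cases "y 0") auto
  then show "cantor (\<lambda>i. x (Suc i)) = cantor (\<lambda>i. y (Suc i))"
    using eq by simp
qed

lemma cantor_inj:
  assumes "cantor x = cantor y"
  shows "x = y"
proof
  fix i
  show "x i = y i"
    using assms
  proof (induction i arbitrary: x y)
    case 0
    then show ?case by (rule cantor_eq_digit)
  next
    case (Suc i)
    then show ?case
      using cantor_eq_digit(2) by blast
  qed
qed

lemma continuous_on_cantor: "continuous_on UNIV cantor"
  unfolding cantor_def
proof (rule continuous_on_suminf_real)
  show "continuous_on UNIV (\<lambda>x :: nat \<Rightarrow> bool. of_bool (x i) * (1 / 4 :: real) ^ Suc i)" for i
    by (rule continuous_on_discrete_fun[where h="\<lambda>b. of_bool b * (1 / 4 :: real) ^ Suc i"])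
      (rule continuous_on_product_then_coordinatewise[OF continuous_on_id])
  show "summable (\<lambda>i. (1 / 4 :: real) ^ Suc i)"
    by (rule sums_summable[OF sums_quarter])
qed simp

definition merge_bits :: "(nat \<Rightarrow> bool) \<Rightarrow> (nat \<Rightarrow> bool) \<Rightarrow> nat \<Rightarrow> bool" where
  "merge_bits F G i = (if even i then F (i div 2) else G (i div 2))"

lemma merge_bits_inj:
  assumes "merge_bits F G = merge_bits F' G'"
  shows "F = F'" "G = G'"
proof -
  have "F i = F' i" "G i = G' i" for i
    using fun_cong[OF assms, of "2 * i"] fun_cong[OF assms, of "Suc (2 * i)"]
    by (simp_all add: merge_bits_def)
  then show "F = F'" "G = G'" by auto
qed

definition real_code :: "code_point \<Rightarrow> real" where
  "real_code p = of_int (fst p) + cantor (merge_bits (fst (snd p)) (snd (snd p)))"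

lemma real_code_bounds: "of_int (fst p) \<le> real_code p" "real_code p \<le> of_int (fst p) + 1 / 3"
  using cantor_bounds by (auto simp: real_code_def)

lemma real_code_inj: "inj real_code"
proof (rule injI)
  fix p q assume eq: "real_code p = real_code q"
  have floor: "\<lfloor>real_code p\<rfloor> = fst p" for p
    using real_code_bounds[of p] by linarith
  then have fst: "fst p = fst q"
    using eq by metis
  then have "cantor (merge_bits (fst (snd p)) (snd (snd p))) = cantor (merge_bits (fst (snd q)) (snd (snd q)))"
    using eq by (simp add: real_code_def)
  then have "merge_bits (fst (snd p)) (snd (snd p)) = merge_bits (fst (snd q)) (snd (snd q))"
    by (rule cantor_inj)
  from merge_bits_inj[OF this] show "p = q"
    using fst by (intro prod_eqI) simp_all
qed

lemma continuous_on_real_code: "continuous_on S real_code"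
proof -
  have "continuous_on UNIV (\<lambda>p :: code_point. merge_bits (fst (snd p)) (snd (snd p)))"
  proof (rule continuous_on_coordinatewise_then_product)
    fix i
    have "continuous_on UNIV (\<lambda>p :: code_point. fst (snd p) (i div 2))"
      "continuous_on UNIV (\<lambda>p :: code_point. snd (snd p) (i div 2))"
      by (rule continuous_on_product_then_coordinatewise, intro continuous_intros)+
    then show "continuous_on UNIV (\<lambda>p :: code_point. merge_bits (fst (snd p)) (snd (snd p)) i)"
      by (cases "even i") (simp_all add: merge_bits_def)
  qed
  then have "continuous_on UNIV (\<lambda>p :: code_point. cantor (merge_bits (fst (snd p)) (snd (snd p))))"
    by (rule continuous_on_compose2[OF continuous_on_cantor]) simp
  moreover have "continuous_on UNIV (\<lambda>p :: code_point. real_of_int (fst p))"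
    by (rule continuous_on_discrete_fun) (intro continuous_intros)
  ultimately have "continuous_on UNIV real_code"
    unfolding real_code_def by (intro continuous_on_add)
  then show ?thesis
    by (rule continuous_on_subset) simp
qed

text \<open>The family is locally finite: a ball of radius 1/3 meets only sets whose index is close
  to the integer part of its centre.\<close>

lemma closed_Union_int:
  fixes C :: "int \<Rightarrow> real set"
  assumes "\<And>k. closed (C k)" "\<And>k. C k \<subseteq> {of_int k..of_int k + 1 / 3}"
  shows "closed (\<Union>k. C k)"
proof -
  have "\<exists>T. open T \<and> x \<in> T \<and> T \<subseteq> - (\<Union>k. C k)" if x: "x \<in> - (\<Union>k. C k)" for x
  proof (intro exI conjI)
    let ?T = "ball x (1 / 3) \<inter> - (\<Union>k\<in>{\<lfloor>x\<rfloor> - 1, \<lfloor>x\<rfloor>, \<lfloor>x\<rfloor> + 1}. C k)"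
    show "open ?T"
      using assms(1) by (intro open_Int open_ball open_Compl closed_UN) auto
    show "x \<in> ?T"
      using x by auto
    show "?T \<subseteq> - (\<Union>k. C k)"
    proof
      fix y assume y: "y \<in> ?T"
      have "y \<notin> C k" for k
      proof
        assume "y \<in> C k"
        then have "of_int k \<le> y" "y \<le> of_int k + 1 / 3"
          using assms(2)[of k] by auto
        moreover have "\<bar>x - y\<bar> < 1 / 3"
          using y by (simp add: dist_real_def)
        ultimately have "of_int k - 1 / 3 < x" "x < of_int k + 2 / 3"
          by linarith+
        then have "k = \<lfloor>x\<rfloor> \<or> k = \<lfloor>x\<rfloor> + 1"
          by linarith
        then show False
          using y \<open>y \<in> C k\<close> by auto
      qed
      then show "y \<in> - (\<Union>k. C k)" by blast
    qed
  qed
  then have "open (- (\<Union>k. C k))"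
    by (subst open_subopen) blast
  then show ?thesis
    by (simp add: closed_def)
qed

lemma compact_UNIV_bool: "compact (UNIV :: (nat \<Rightarrow> bool) set)"
proof -
  have "compact (UNIV :: bool set)"
    by (rule finite_imp_compact) simp
  then have "compact_space (euclidean :: bool topology)"
    by (simp add: compact_space_def)
  then have "compact_space (product_topology (\<lambda>_ :: nat. euclidean :: bool topology) UNIV)"
    by (simp add: compact_space_product_topology)
  then show ?thesis
    by (simp add: euclidean_product_topology compact_space_def)
qed

text \<open>Each cluster is compact, hence has a closed image, and the images lie in intervals
  spread along the line.\<close>

lemma closed_real_code_image:
  assumes "closed S"
  shows "closed (real_code ` S)"
proof -
  define C where "C k = real_code ` (S \<inter> {k} \<times> UNIV)" for k
  have "compact ({k} \<times> (UNIV :: ((nat \<Rightarrow> bool) \<times> (nat \<Rightarrow> bool)) set))" for k :: int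
    using compact_Times[OF _ compact_Times[OF compact_UNIV_bool compact_UNIV_bool], of "{k}"] by simp
  then have "compact (S \<inter> {k} \<times> UNIV)" for k
    using assms by (intro closed_Int_compact)
  then have "closed (C k)" for k
    unfolding C_def by (intro compact_imp_closed compact_continuous_image continuous_on_real_code)
  moreover have "C k \<subseteq> {of_int k..of_int k + 1 / 3}" for k
    using real_code_bounds by (fastforce simp: C_def)
  ultimately have "closed (\<Union>k. C k)"
    by (rule closed_Union_int)
  moreover have "(\<Union>k. C k) = real_code ` S"
    by (force simp: C_def)
  ultimately show ?thesis by simp
qed

lemma homeomorphism_real_code:
  assumes "closed S"
  shows "\<exists>g. homeomorphism S (real_code ` S) real_code g"
proof -
  have "closedin (top_of_set (real_code ` S)) (real_code ` U)" if "closedin (top_of_set S) U" for U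
  proof -
    have "closed U" "U \<subseteq> S"
      using that assms closedin_closed_trans closedin_imp_subset by blast+
    then show ?thesis
      using closed_real_code_image by (intro closed_subset) auto
  qed
  then show ?thesis
    using homeomorphism_injective_closed_map[OF continuous_on_real_code refl, of S]
      inj_on_subset[OF real_code_inj subset_UNIV] by metis
qed

lemma connected_discrete_constant:
  fixes h :: "'a::topological_space \<Rightarrow> 'b::discrete_topology"
  assumes "connected I" "continuous_on I h" "a \<in> I" "b \<in> I"
  shows "h a = h b"
proof (rule ccontr)
  assume "h a \<noteq> h b"
  have "connected (h ` I)"
    using assms(1,2) connected_continuous_image by blast
  from connectedD[OF this open_discrete open_discrete, of "{h a}" "- {h a}"]
  have "{h a} \<inter> h ` I = {} \<or> - {h a} \<inter> h ` I = {}"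
    by simp
  moreover have "h a \<in> {h a} \<inter> h ` I" "h b \<in> - {h a} \<inter> h ` I"
    using assms(3,4) \<open>h a \<noteq> h b\<close> by simp_all
  ultimately show False
    by (metis empty_iff)
qed

text \<open>The continuous inverse would carry an interval in the range into a totally disconnected
  space. Each discrete coordinate would be constant there, although distinct reals have distinct
  codes.\<close>

lemma not_in_range_real_code:
  assumes "a < b"
  shows "\<exists>s. a < s \<and> s < b \<and> s \<notin> range real_code"
proof (rule ccontr)
  assume "\<not> ?thesis"
  then have sub: "{a<..<b} \<subseteq> range real_code"
    by auto
  obtain g where g: "homeomorphism UNIV (range real_code) real_code g"
    using homeomorphism_real_code[OF closed_UNIV] by blast
  then have cont: "continuous_on {a<..<b} g" and inv: "\<And>s. s \<in> {a<..<b} \<Longrightarrow> real_code (g s) = s"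
    using sub unfolding homeomorphism_def by (auto intro: continuous_on_subset)
  define s s' where "s = (2 * a + b) / 3" and "s' = (a + 2 * b) / 3"
  have mem: "s \<in> {a<..<b}" "s' \<in> {a<..<b}" and "s \<noteq> s'"
    using assms by (auto simp: s_def s'_def field_simps)
  have conn: "connected {a<..<b}"
    by (rule connected_Ioo)
  have "fst (g s) = fst (g s')"
    using cont by (intro connected_discrete_constant[OF conn _ mem] continuous_intros)
  moreover have "fst (snd (g s)) i = fst (snd (g s')) i" for i
    using cont by (intro connected_discrete_constant[OF conn _ mem, of "\<lambda>s. fst (snd (g s)) i"]
        continuous_on_product_then_coordinatewise[of _ "\<lambda>s. fst (snd (g s))"] continuous_intros)
  moreover have "snd (snd (g s)) i = snd (snd (g s')) i" for i
    using cont by (intro connected_discrete_constant[OF conn _ mem, of "\<lambda>s. snd (snd (g s)) i"]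
        continuous_on_product_then_coordinatewise[of _ "\<lambda>s. snd (snd (g s))"] continuous_intros)
  ultimately have "g s = g s'"
    by (intro prod_eqI ext)
  then show False
    using inv mem \<open>s \<noteq> s'\<close> by metis
qed

section \<open>Complements of nowhere dense closed subsets of an axis\<close>

definition Rn :: "nat \<Rightarrow> (nat \<Rightarrow> real) set" where
  "Rn n = {x. \<forall>i\<ge>n. x i = 0}"

lemma Euclidean_space_eq: "Euclidean_space n = top_of_set (Rn n)"
  by (simp add: Euclidean_space_def euclidean_product_topology Rn_def)

lemma topspace_Rn: "topspace (Euclidean_space n) = Rn n"
  by (simp add: Euclidean_space_eq)

lemma connected_product:
  fixes S :: "nat \<Rightarrow> real set"
  assumes "\<And>i. connected (S i)"
  shows "connected {x. \<forall>i. x i \<in> S i}"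
proof -
  have "connectedin (product_topology (\<lambda>_ :: nat. euclideanreal) UNIV) (PiE UNIV S)"
    unfolding connectedin_PiE using assms by simp
  moreover have "PiE UNIV S = {x. \<forall>i. x i \<in> S i}"
    by (auto simp: PiE_iff)
  ultimately show ?thesis
    by (simp add: euclidean_product_topology)
qed

lemma compact_product:
  fixes S :: "nat \<Rightarrow> real set"
  assumes "\<And>i. compact (S i)"
  shows "compact {x. \<forall>i. x i \<in> S i}"
proof -
  have "compactin (product_topology (\<lambda>_ :: nat. euclideanreal) UNIV) (PiE UNIV S)"
    unfolding compactin_PiE using assms by simp
  moreover have "PiE UNIV S = {x. \<forall>i. x i \<in> S i}"
    by (auto simp: PiE_iff)
  ultimately show ?thesis
    by (simp add: euclidean_product_topology)
qed

lemma open_coordinates: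
  fixes S :: "nat \<Rightarrow> real set"
  assumes "\<And>i. i < n \<Longrightarrow> open (S i)"
  shows "open {x. \<forall>i<n. x i \<in> S i}"
proof -
  have "open {x :: nat \<Rightarrow> real. \<forall>i\<in>{..<n}. x (id i) \<in> S i}"
    by (rule product_topology_basis') (use assms in auto)
  moreover have "{x :: nat \<Rightarrow> real. \<forall>i\<in>{..<n}. x (id i) \<in> S i} = {x. \<forall>i<n. x i \<in> S i}"
    by auto
  ultimately show ?thesis by simp
qed

lemma closed_Rn: "closed (Rn n)"
  using closedin_topspace[of "Euclidean_space n"] by (simp add: closedin_Euclidean_space_iff topspace_Rn)

lemma open_contains_coordinate_cube:
  fixes W :: "(nat \<Rightarrow> real) set"
  assumes "open W" "p \<in> W"
  obtains e where "e > 0" "\<And>x. (\<And>i. i < n \<Longrightarrow> \<bar>x i - p i\<bar> < e) \<Longrightarrow> (\<And>i. i \<ge> n \<Longrightarrow> x i = p i) \<Longrightarrow> x \<in> W"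
proof -
  have "openin (product_topology (\<lambda>_. euclidean) UNIV) W"
    using assms(1) by (simp add: open_fun_def)
  from bspec[OF this[unfolded openin_product_topology_alt] assms(2)] obtain V where
    "\<forall>i\<in>UNIV. openin euclidean (V i)" "p \<in> PiE UNIV V" "PiE UNIV V \<subseteq> W"
    by (elim exE conjE)
  then have V: "\<And>i. open (V i)" "\<And>i. p i \<in> V i" "\<And>x. (\<And>i. x i \<in> V i) \<Longrightarrow> x \<in> W"
    by (auto simp: PiE_iff subset_iff)
  have "\<exists>e>0. \<forall>y. \<bar>y - p i\<bar> < e \<longrightarrow> y \<in> V i" for i
    using V(1)[of i] V(2)[of i] unfolding open_dist by (auto simp: dist_real_def)
  then obtain e where e: "\<And>i. e i > 0" "\<And>i y. \<bar>y - p i\<bar> < e i \<Longrightarrow> y \<in> V i"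
    by metis
  define d where "d = Min (insert 1 (e ` {..<n}))"
  show ?thesis
  proof
    show "d > 0"
      unfolding d_def using e(1) by simp
    fix x assume x: "\<And>i. i < n \<Longrightarrow> \<bar>x i - p i\<bar> < d" "\<And>i. i \<ge> n \<Longrightarrow> x i = p i"
    have "x i \<in> V i" for i
    proof (cases "i < n")
      case True
      then have "d \<le> e i"
        unfolding d_def by (intro Min_le) auto
      then show ?thesis
        using e(2) x(1)[OF True] by force
    next
      case False
      then show ?thesis
        using x(2)[of i] V(2)[of i] by simp
    qed
    then show "x \<in> W"
      by (rule V(3))
  qed
qed

section \<open>The coordinate axis\<close>

definition on_axis :: "real \<Rightarrow> nat \<Rightarrow> real" where
  "on_axis s = (\<lambda>i. if i = 0 then s else 0)"

lemma on_axis_simps [simp]: "on_axis s 0 = s" "i \<noteq> 0 \<Longrightarrow> on_axis s i = 0"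
  by (simp_all add: on_axis_def)

lemma on_axis_in_image [simp]: "on_axis s \<in> on_axis ` K \<longleftrightarrow> s \<in> K"
  by (metis image_eqI imageE on_axis_simps(1))

lemma on_axis_in_Rn: "0 < n \<Longrightarrow> on_axis s \<in> Rn n"
  by (simp add: on_axis_def Rn_def)

lemma on_axis_image_eq: "on_axis ` K = {x. x 0 \<in> K \<and> (\<forall>i. i \<noteq> 0 \<longrightarrow> x i = 0)}"
proof -
  have "x = on_axis (x 0)" if "\<forall>i. i \<noteq> 0 \<longrightarrow> x i = 0" for x
    using that by (auto simp: on_axis_def fun_eq_iff)
  then show ?thesis by auto
qed

lemma closed_on_axis_image:
  assumes "closed K"
  shows "closed (on_axis ` K)"
proof -
  have coord: "continuous_on UNIV (\<lambda>x :: nat \<Rightarrow> real. x i)" for i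
    by (rule continuous_on_product_then_coordinatewise[OF continuous_on_id])
  have "on_axis ` K = ((\<lambda>x. x 0) -` K) \<inter> (\<Inter>i\<in>-{0}. {x. x i = 0})"
    unfolding on_axis_image_eq by auto
  also have "closed \<dots>"
    by (intro closed_Int closed_vimage closed_INT ballI closed_Collect_eq assms coord continuous_on_const)
  finally show ?thesis .
qed

text \<open>Coordinate 1 is transverse to the axis, which is where n \<ge> 2 is needed. The two open
  sides avoid the axis, the single point \<open>z\<close> of the wall between them joins them, and
  every other point of the wall lies in their closure.\<close>

lemma connected_minus_axis:
  assumes n: "n \<ge> 2" and T: "openin (Euclidean_space n) T"
    and conn: "connected (T \<inter> {x. 0 < x 1})" "connected (T \<inter> {x. x 1 < 0})"
    and z: "z \<in> T" "z \<notin> on_axis ` K" "z 1 = 0"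
  shows "connected (T - on_axis ` K)"
proof -
  define P N where "P = T \<inter> {x. 0 < x 1}" and "N = T \<inter> {x. x 1 < 0}"
  obtain W where W: "open W" "T = Rn n \<inter> W"
    using T unfolding Euclidean_space_eq openin_open by auto
  have closure: "x \<in> closure P" "x \<in> closure N" if x: "x \<in> T" "x 1 = 0" for x
  proof -
    \<comment> \<open>Moving a wall point in direction 1, forwards or backwards, reaches either
      side.\<close>
    define g where "g e = x(1 := e)" for e :: real
    have "continuous_on UNIV g"
    proof (rule continuous_on_coordinatewise_then_product)
      show "continuous_on UNIV (\<lambda>e. g e i)" for i
        by (cases "i = 1") (simp_all add: g_def)
    qed
    have g0: "g 0 = x"
      using x(2) by (auto simp: g_def)
    have mem: "\<exists>e>0. g e \<in> V \<inter> T \<and> g (- e) \<in> V \<inter> T" if V: "open V" "x \<in> V" for V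
    proof -
      have "open (g -` (V \<inter> W))"
        using \<open>continuous_on UNIV g\<close> V(1) W(1) by (intro open_vimage open_Int)
      moreover have "0 \<in> g -` (V \<inter> W)"
        using g0 V(2) x(1) W(2) by auto
      ultimately obtain e where e: "e > 0" "ball 0 e \<subseteq> g -` (V \<inter> W)"
        unfolding open_contains_ball by blast
      then have "g (e / 2) \<in> V \<inter> W" "g (- (e / 2)) \<in> V \<inter> W"
        by (auto simp: subset_iff)
      moreover have "g e' \<in> Rn n" for e'
        using x(1) W(2) n by (simp add: g_def Rn_def)
      ultimately show ?thesis
        using e(1) W(2) by (intro exI[of _ "e / 2"]) auto
    qed
    have meets: "P \<inter> V \<noteq> {}" "N \<inter> V \<noteq> {}" if V: "open V" "x \<in> V" for V
    proof -
      obtain e where "e > 0" "g e \<in> V \<inter> T" "g (- e) \<in> V \<inter> T"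
        using mem[OF V] by auto
      then have "g e \<in> P \<inter> V" "g (- e) \<in> N \<inter> V"
        by (simp_all add: P_def N_def g_def)
      then show "P \<inter> V \<noteq> {}" "N \<inter> V \<noteq> {}" by blast+
    qed
    have "P \<inter> A \<noteq> {}" "N \<inter> A \<noteq> {}" if "V \<subseteq> A" "open V" "x \<in> V" for A V
      using meets[OF that(2,3)] that(1) by blast+
    then show "x \<in> closure P" "x \<in> closure N"
      unfolding closure_iff_nhds_not_empty by simp_all
  qed
  have "connected (insert z P)"
  proof (rule connected_intermediate_closure)
    show "connected P"
      using conn(1) by (simp add: P_def)
    show "insert z P \<subseteq> closure P"
      using closure(1)[OF z(1,3)] closure_subset[of P] by (intro insert_subsetI)
  qed (rule subset_insertI)
  moreover have "connected (insert z N)"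
  proof (rule connected_intermediate_closure)
    show "connected N"
      using conn(2) by (simp add: N_def)
    show "insert z N \<subseteq> closure N"
      using closure(2)[OF z(1,3)] closure_subset[of N] by (intro insert_subsetI)
  qed (rule subset_insertI)
  ultimately have "connected (insert z P \<union> insert z N)"
    by (intro connected_Un) auto
  moreover have "insert z P \<union> insert z N \<subseteq> T - on_axis ` K"
    using z by (auto simp: P_def N_def)
  moreover have "T - on_axis ` K \<subseteq> closure (insert z P \<union> insert z N)"
  proof
    fix x assume x: "x \<in> T - on_axis ` K"
    have "x \<in> P \<or> x \<in> N \<or> x 1 = 0"
      using x by (auto simp: P_def N_def)
    then have "x \<in> closure P \<union> closure N"
      using closure x closure_subset by blast
    then show "x \<in> closure (insert z P \<union> insert z N)"
      using closure_mono[of P "insert z P \<union> insert z N"] closure_mono[of N "insert z P \<union> insert z N"] by blast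
  qed
  ultimately show ?thesis
    by (rule connected_intermediate_closure)
qed

section \<open>Boxes around segments of the axis\<close>

definition open_box :: "nat \<Rightarrow> (nat \<Rightarrow> real) \<Rightarrow> (nat \<Rightarrow> real) \<Rightarrow> (nat \<Rightarrow> real) set" where
  "open_box n l u = {x \<in> Rn n. \<forall>i<n. l i < x i \<and> x i < u i}"

definition closed_box :: "nat \<Rightarrow> (nat \<Rightarrow> real) \<Rightarrow> (nat \<Rightarrow> real) \<Rightarrow> (nat \<Rightarrow> real) set" where
  "closed_box n l u = {x \<in> Rn n. \<forall>i<n. l i \<le> x i \<and> x i \<le> u i}"

lemma Rn_coordinates:
  "{x \<in> Rn n. \<forall>i<n. x i \<in> S i} = {x. \<forall>i. x i \<in> (if i < n then S i else {0})}"
proof (rule Collect_cong)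
  fix x :: "nat \<Rightarrow> real"
  show "(x \<in> Rn n \<and> (\<forall>i<n. x i \<in> S i)) \<longleftrightarrow> (\<forall>i. x i \<in> (if i < n then S i else {0}))"
  proof
    assume *: "\<forall>i. x i \<in> (if i < n then S i else {0})"
    have "x i \<in> S i" if "i < n" for i
      using *[rule_format, of i] that by simp
    moreover have "x i = 0" if "i \<ge> n" for i
      using *[rule_format, of i] that by simp
    ultimately show "x \<in> Rn n \<and> (\<forall>i<n. x i \<in> S i)"
      by (simp add: Rn_def)
  qed (simp add: Rn_def)
qed

lemma connected_Rn_coordinates:
  assumes "\<And>i. i < n \<Longrightarrow> connected (S i)"
  shows "connected {x \<in> Rn n. \<forall>i<n. x i \<in> S i}"
proof -
  have "connected {x. \<forall>i. x i \<in> (if i < n then S i else {0})}"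
    using assms by (intro connected_product) simp
  also note Rn_coordinates[symmetric]
  finally show ?thesis .
qed

lemma compact_closed_box: "compact (closed_box n l u)"
proof -
  have "closed_box n l u = {x. \<forall>i. x i \<in> (if i < n then {l i..u i} else {0})}"
    unfolding Rn_coordinates[symmetric] by (simp add: closed_box_def)
  also have "compact \<dots>"
    by (intro compact_product) simp
  finally show ?thesis .
qed

text \<open>Outside the box some coordinate leaves its interval. The piece belonging to one side of
  a coordinate i \<noteq> 1 is connected and meets the connected set \<open>B0\<close> where
  coordinate 1 lies in \<open>H\<close>. In the application \<open>Q\<close> is a half line and
  \<open>H\<close> a shorter one, hence connected; this is why the two sides of the axis are treated
  separately.\<close>

lemma connected_outside_box:
  assumes n: "n \<ge> 2" and Q: "connected Q" and H: "connected H" "H \<noteq> {}"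
    and QH: "H = {y \<in> Q. \<not> (l 1 \<le> y \<and> y \<le> u 1)}"
  shows "connected {x \<in> Rn n. x 1 \<in> Q \<and> \<not> (\<forall>i<n. l i \<le> x i \<and> x i \<le> u i)}"
proof -
  define B where "B i A = {x \<in> Rn n. x 1 \<in> Q \<and> x i \<in> A}" for i and A :: "real set"
  define B0 where "B0 = {x \<in> Rn n. x 1 \<in> H}"
  obtain y where y: "y \<in> H"
    using H(2) by blast
  have HQ: "H \<subseteq> Q"
    using QH by blast
  have B0: "connected B0"
  proof -
    have "B0 = {x \<in> Rn n. \<forall>i<n. x i \<in> (if i = 1 then H else UNIV)}"
      using n by (auto simp: B0_def)
    also have "connected \<dots>"
      using H(1) by (intro connected_Rn_coordinates) simp
    finally show ?thesis .
  qed
  have B: "connected (B0 \<union> B i A)" if i: "i < n" "i \<noteq> 1" and A: "connected A" "A \<noteq> {}" for i A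
  proof -
    obtain a where a: "a \<in> A"
      using A(2) by blast
    have "B i A = {x \<in> Rn n. \<forall>j<n. x j \<in> (if j = 1 then Q else if j = i then A else UNIV)}"
      using n i by (auto simp: B_def split: if_splits)
    also have "connected \<dots>"
      using Q A by (intro connected_Rn_coordinates) simp
    finally have "connected (B i A)" .
    moreover have "(\<lambda>j. if j = 1 then y else if j = i then a else 0) \<in> B0 \<inter> B i A"
      using n i y a HQ by (auto simp: B0_def B_def Rn_def)
    ultimately show ?thesis
      using B0 by (intro connected_Un) auto
  qed
  define \<C> where "\<C> = insert B0
    {B0 \<union> B i A | i A. i < n \<and> i \<noteq> 1 \<and> (A = {..<l i} \<or> A = {u i<..})}"
  have "connected (\<Union>\<C>)"
  proof (rule connected_Union)
    show "connected s" if "s \<in> \<C>" for s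
      using that unfolding \<C>_def by (elim insertE CollectE exE conjE disjE) (simp_all add: B0 B)
    have "(\<lambda>j. if j = 1 then y else 0) \<in> B0"
      using n y by (auto simp: B0_def Rn_def)
    then have "(\<lambda>j. if j = 1 then y else 0) \<in> \<Inter>\<C>"
      by (auto simp: \<C>_def)
    then show "\<Inter>\<C> \<noteq> {}" by blast
  qed
  moreover have "\<Union>\<C> = {x \<in> Rn n. x 1 \<in> Q \<and> \<not> (\<forall>i<n. l i \<le> x i \<and> x i \<le> u i)}"
  proof (rule subset_antisym; rule subsetI)
    fix x assume "x \<in> \<Union>\<C>"
    then consider "x \<in> B0" | i where "i < n" "x \<in> B i {..<l i} \<or> x \<in> B i {u i<..}"
      unfolding \<C>_def by auto
    then show "x \<in> {x \<in> Rn n. x 1 \<in> Q \<and> \<not> (\<forall>i<n. l i \<le> x i \<and> x i \<le> u i)}"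
    proof cases
      case 1
      moreover have "1 < n" using n by simp
      ultimately show ?thesis
        using QH unfolding B0_def by blast
    next
      case (2 i)
      then have "\<not> (l i \<le> x i \<and> x i \<le> u i)"
        by (auto simp: B_def)
      with 2 show ?thesis
        unfolding B_def by blast
    qed
  next
    fix x assume "x \<in> {x \<in> Rn n. x 1 \<in> Q \<and> \<not> (\<forall>i<n. l i \<le> x i \<and> x i \<le> u i)}"
    then obtain i where i: "x \<in> Rn n" "x 1 \<in> Q" "i < n" "x i < l i \<or> u i < x i"
      by force
    show "x \<in> \<Union>\<C>"
    proof (cases "i = 1")
      case True
      then have "x 1 \<in> H"
        using QH i by auto
      then show ?thesis
        using i(1) by (auto simp: B0_def \<C>_def)
    next
      case False
      then show ?thesis
        using i by (auto simp: B_def \<C>_def)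
    qed
  qed
  ultimately show ?thesis by simp
qed

text \<open>With \<open>upper\<close>, the corners of a box (a,b) x (-r,r)^(n-1) centred on the
  axis.\<close>

definition lower :: "real \<Rightarrow> real \<Rightarrow> nat \<Rightarrow> real" where
  "lower a r i = (if i = 0 then a else - r)"

definition upper :: "real \<Rightarrow> real \<Rightarrow> nat \<Rightarrow> real" where
  "upper b r i = (if i = 0 then b else r)"

definition nowhere_dense_closed :: "real set \<Rightarrow> bool" where
  "nowhere_dense_closed K \<longleftrightarrow> closed K \<and> (\<forall>a b. a < b \<longrightarrow> (\<exists>s. a < s \<and> s < b \<and> s \<notin> K))"

lemma connected_Rn_minus_axis:
  assumes "n \<ge> 2" "nowhere_dense_closed K"
  shows "connected (Rn n - on_axis ` K)"
proof -
  obtain s where s: "s \<notin> K"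
    using assms(2) unfolding nowhere_dense_closed_def by (meson zero_less_one)
  have "connected {x \<in> Rn n. \<forall>i<n. x i \<in> (if i = 1 then Q else UNIV)}" if "connected Q" for Q
    using that by (intro connected_Rn_coordinates) simp
  moreover have "{x \<in> Rn n. \<forall>i<n. x i \<in> (if i = 1 then Q else UNIV)} = Rn n \<inter> {x. x 1 \<in> Q}" for Q
    using assms(1) by auto
  ultimately have "connected (Rn n \<inter> {x. x 1 \<in> Q})" if "connected Q" for Q
    using that by metis
  from this[of "{0<..}"] this[of "{..<0}"]
  have "connected (Rn n \<inter> {x. 0 < x 1})" "connected (Rn n \<inter> {x. x 1 < 0})"
    by simp_all
  moreover have "openin (Euclidean_space n) (Rn n)"
    using openin_topspace[of "Euclidean_space n"] by (simp add: topspace_Rn)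
  moreover have "on_axis s \<in> Rn n"
    using assms(1) by (intro on_axis_in_Rn) simp
  ultimately show ?thesis
    using s by (intro connected_minus_axis[OF assms(1), where z="on_axis s"]) simp_all
qed

context
  fixes n :: nat and K :: "real set" and a b r :: real
  assumes n: "n \<ge> 2" and K: "nowhere_dense_closed K"
    and ab: "a < b" "a \<notin> K" "b \<notin> K" and r: "r > 0"
begin

lemma openin_open_box: "openin (Euclidean_space n) (open_box n (lower a r) (upper b r))"
proof -
  have "open_box n (lower a r) (upper b r) = Rn n \<inter> {x. \<forall>i<n. x i \<in> {lower a r i<..<upper b r i}}"
    by (auto simp: open_box_def)
  moreover have "open {x. \<forall>i<n. x i \<in> {lower a r i<..<upper b r i}}"
    by (rule open_coordinates) simp
  ultimately show ?thesis
    by (simp add: Euclidean_space_eq openin_open_Int)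
qed

lemma openin_outside_box: "openin (Euclidean_space n) (Rn n - closed_box n (lower a r) (upper b r))"
proof -
  have "open (- closed_box n (lower a r) (upper b r))"
    by (intro open_Compl compact_imp_closed compact_closed_box)
  then show ?thesis
    by (simp add: Euclidean_space_eq Diff_eq openin_open_Int)
qed

text \<open>The axis meets the boundary of the box only at its coordinates \<open>a\<close> and
  \<open>b\<close>, which are outside \<open>K\<close>. So the box cuts the ends into two relatively
  clopen parts.\<close>

lemma axis_avoids_box_boundary:
  assumes "x \<in> on_axis ` K"
  shows "x \<in> open_box n (lower a r) (upper b r) \<union> (Rn n - closed_box n (lower a r) (upper b r))"
proof -
  obtain s where s: "s \<in> K" "x = on_axis s"
    using assms by blast
  have "x \<in> Rn n"
    using n s(2) on_axis_in_Rn[of n s] by simp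
  show ?thesis
  proof (cases "x \<in> closed_box n (lower a r) (upper b r)")
    case True
    then have "a \<le> s" "s \<le> b"
      using n unfolding closed_box_def lower_def upper_def s(2) by force+
    then have "a < s" "s < b"
      using ab s(1) by (metis order_le_less)+
    then have "x \<in> open_box n (lower a r) (upper b r)"
      using \<open>x \<in> Rn n\<close> r by (auto simp: open_box_def lower_def upper_def s(2))
    then show ?thesis by blast
  qed (use \<open>x \<in> Rn n\<close> in blast)
qed

lemma open_box_minus_axis: "connected (open_box n (lower a r) (upper b r) - on_axis ` K)" "open_box n (lower a r) (upper b r) - on_axis ` K \<noteq> {}"
proof -
  obtain s where s: "a < s" "s < b" "s \<notin> K"
    using K ab(1) unfolding nowhere_dense_closed_def by blast
  have "on_axis s \<in> Rn n"
    using n on_axis_in_Rn[of n s] by simp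
  then have z: "on_axis s \<in> open_box n (lower a r) (upper b r)"
    using s r by (auto simp: open_box_def lower_def upper_def)
  then have "on_axis s \<in> open_box n (lower a r) (upper b r) - on_axis ` K"
    using s(3) by simp
  then show "open_box n (lower a r) (upper b r) - on_axis ` K \<noteq> {}"
    by (metis empty_iff)
  have half: "connected (open_box n (lower a r) (upper b r) \<inter> {x. x 1 \<in> Q})" if "connected (Q \<inter> {-r<..<r})" for Q
  proof -
    have "open_box n (lower a r) (upper b r) \<inter> {x. x 1 \<in> Q} =
        {x \<in> Rn n. \<forall>i<n. x i \<in> (if i = 1 then Q \<inter> {-r<..<r} else {lower a r i<..<upper b r i})}"
      using n by (auto simp: open_box_def lower_def upper_def split: if_splits)
    also have "connected \<dots>"
      using that by (intro connected_Rn_coordinates) simp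
    finally show ?thesis .
  qed
  have "{0<..} \<inter> {-r<..<r} = {0<..<r}" "{..<0} \<inter> {-r<..<r} = {-r<..<0}"
    using r by auto
  then have "connected (open_box n (lower a r) (upper b r) \<inter> {x. 0 < x 1})" "connected (open_box n (lower a r) (upper b r) \<inter> {x. x 1 < 0})"
    using half[of "{0<..}"] half[of "{..<0}"] by simp_all
  then show "connected (open_box n (lower a r) (upper b r) - on_axis ` K)"
    by (rule connected_minus_axis[OF n openin_open_box _ _ z]) (use s(3) in simp_all)
qed

lemma outside_box_minus_axis:
  "connected (Rn n - closed_box n (lower a r) (upper b r) - on_axis ` K)" "Rn n - closed_box n (lower a r) (upper b r) - on_axis ` K \<noteq> {}"
proof -
  obtain s where s: "b < s" "s \<notin> K"
    using K unfolding nowhere_dense_closed_def by (meson less_add_one)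
  have "on_axis s \<in> Rn n"
    using n on_axis_in_Rn[of n s] by simp
  moreover have "on_axis s \<notin> closed_box n (lower a r) (upper b r)"
    using s(1) n by (auto simp: closed_box_def upper_def intro!: exI[of _ 0])
  ultimately have z: "on_axis s \<in> Rn n - closed_box n (lower a r) (upper b r)"
    by blast
  then have "on_axis s \<in> Rn n - closed_box n (lower a r) (upper b r) - on_axis ` K"
    using s(2) by simp
  then show "Rn n - closed_box n (lower a r) (upper b r) - on_axis ` K \<noteq> {}"
    by (metis empty_iff)
  have half: "(Rn n - closed_box n (lower a r) (upper b r)) \<inter> {x. x 1 \<in> Q} =
      {x \<in> Rn n. x 1 \<in> Q \<and> \<not> (\<forall>i<n. lower a r i \<le> x i \<and> x i \<le> upper b r i)}" for Q
    by (auto simp: closed_box_def)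
  have "connected ((Rn n - closed_box n (lower a r) (upper b r)) \<inter> {x. x 1 \<in> {0<..}})"
    unfolding half
  proof (rule connected_outside_box[OF n])
    show "{r<..} = {y \<in> {0<..}. \<not> (lower a r 1 \<le> y \<and> y \<le> upper b r 1)}"
      using r by (auto simp: lower_def upper_def)
  qed auto
  moreover have "connected ((Rn n - closed_box n (lower a r) (upper b r)) \<inter> {x. x 1 \<in> {..<0}})"
    unfolding half
  proof (rule connected_outside_box[OF n])
    show "{..<- r} = {y \<in> {..<0}. \<not> (lower a r 1 \<le> y \<and> y \<le> upper b r 1)}"
      using r by (auto simp: lower_def upper_def)
  qed auto
  ultimately show "connected (Rn n - closed_box n (lower a r) (upper b r) - on_axis ` K)"
    by (intro connected_minus_axis[OF n openin_outside_box _ _ z]) (use s(2) in simp_all)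
qed

text \<open>One box serves both kinds of ends: \<open>V\<close> is used at finite ends and
  \<open>V'\<close> at infinity, and each completes the partition for the other.\<close>

lemma box_neighbourhoods:
  fixes V V'
  defines "V \<equiv> Some ` open_box n (lower a r) (upper b r)"
    and "V' \<equiv> insert None (Some ` (Rn n - closed_box n (lower a r) (upper b r)))"
  shows "openin (Alexandroff_compactification (Euclidean_space n)) V" "openin (Alexandroff_compactification (Euclidean_space n)) V'"
    "disjnt V V'" "insert None (Some ` on_axis ` K) \<subseteq> V \<union> V'"
    "connectedin (Alexandroff_compactification (Euclidean_space n)) (V - insert None (Some ` on_axis ` K))" "V - insert None (Some ` on_axis ` K) \<noteq> {}"
    "connectedin (Alexandroff_compactification (Euclidean_space n)) (V' - insert None (Some ` on_axis ` K))" "V' - insert None (Some ` on_axis ` K) \<noteq> {}"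
proof -
  let ?X = "Alexandroff_compactification (Euclidean_space n)" and ?E = "insert None (Some ` on_axis ` K)"
  show "openin ?X V"
    using openin_open_box by (simp add: V_def)
  have "closed_box n (lower a r) (upper b r) \<subseteq> Rn n"
    by (auto simp: closed_box_def)
  then have "compactin (Euclidean_space n) (closed_box n (lower a r) (upper b r))"
    unfolding Euclidean_space_eq using compact_closed_box by (simp add: compactin_subtopology)
  moreover have "closedin (Euclidean_space n) (closed_box n (lower a r) (upper b r))"
    unfolding closedin_Euclidean_space_iff topspace_Rn
    using \<open>closed_box n (lower a r) (upper b r) \<subseteq> Rn n\<close> compact_closed_box compact_imp_closed by blast
  ultimately show "openin ?X V'"
    unfolding openin_Alexandroff_compactification topspace_Rn V'_def by blast
  show "disjnt V V'"
    by (auto simp: disjnt_def V_def V'_def open_box_def closed_box_def)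
  show "?E \<subseteq> V \<union> V'"
    using axis_avoids_box_boundary unfolding V_def V'_def by fastforce
  have conn: "connectedin ?X (Some ` S)" if "connected S" "S \<subseteq> Rn n" for S
    using connectedin_continuous_map_image[OF continuous_map_Some] that
    unfolding Euclidean_space_eq by (metis connectedin_iff_connected connectedin_subtopology)
  have VE: "V - ?E = Some ` (open_box n (lower a r) (upper b r) - on_axis ` K)"
    by (auto simp: V_def)
  have VE': "V' - ?E = Some ` (Rn n - closed_box n (lower a r) (upper b r) - on_axis ` K)"
    by (auto simp: V'_def)
  show "connectedin ?X (V - ?E)"
    unfolding VE using open_box_minus_axis(1) by (rule conn) (auto simp: open_box_def)
  show "connectedin ?X (V' - ?E)"
    unfolding VE' using outside_box_minus_axis(1) by (rule conn) auto
  show "V - ?E \<noteq> {}"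
    unfolding VE using open_box_minus_axis(2) by simp
  show "V' - ?E \<noteq> {}"
    unfolding VE' using outside_box_minus_axis(2) by simp
qed

end

lemma compact_coordinates_bounded:
  fixes C :: "(nat \<Rightarrow> real) set"
  assumes "compact C"
  obtains B where "B > 0" "\<And>x i. x \<in> C \<Longrightarrow> i < n \<Longrightarrow> \<bar>x i\<bar> \<le> B"
proof -
  have "continuous_on C (\<lambda>x. x i)" for i
    by (rule continuous_on_product_then_coordinatewise[OF continuous_on_id])
  then have "compact (\<Union>i\<in>{..<n}. (\<lambda>x. x i) ` C)"
    by (intro compact_UN ballI compact_continuous_image assms finite_lessThan)
  then have "bounded (\<Union>i<n. (\<lambda>x. x i) ` C)"
    by (rule compact_imp_bounded)
  then obtain B where "B > 0" "\<forall>y\<in>(\<Union>i<n. (\<lambda>x. x i) ` C). norm y \<le> B"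
    unfolding bounded_pos by (elim exE conjE)
  then show ?thesis
    by (intro that[of B]) auto
qed

theorem end_compactification_Rn_minus_axis:
  assumes n: "n \<ge> 2" and K: "nowhere_dense_closed K"
  shows "end_compactification (Alexandroff_compactification (Euclidean_space n)) (insert None (Some ` on_axis ` K))"
    (is "end_compactification ?X ?E")
proof -
  have gap: "\<exists>s. c < s \<and> s < d \<and> s \<notin> K" if "c < d" for c d
    using K that unfolding nowhere_dense_closed_def by blast
  have nhds: "\<exists>V V'. openin ?X V \<and> openin ?X V' \<and> disjnt V V' \<and> e \<in> V \<and> V \<subseteq> W \<and> ?E \<subseteq> V \<union> V' \<and>
      connectedin ?X (V - ?E) \<and> V - ?E \<noteq> {}" if e: "e \<in> ?E" and W: "openin ?X W" "e \<in> W" for e W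
  proof (cases e)
    case None
    then obtain C where C: "compactin (Euclidean_space n) C" "W = insert None (Some ` (Rn n - C))"
      using W unfolding openin_Alexandroff_compactification topspace_Rn by auto
    then have "compact C" "C \<subseteq> Rn n"
      unfolding Euclidean_space_eq compactin_subtopology by auto
    obtain B where B: "B > 0" "\<And>x i. x \<in> C \<Longrightarrow> i < n \<Longrightarrow> \<bar>x i\<bar> \<le> B"
      using compact_coordinates_bounded[OF \<open>compact C\<close>, of n] by blast
    \<comment> \<open>The box has to contain \<open>C\<close>; its faces across the axis are moved
      outwards by less than 1 so as to miss \<open>K\<close>.\<close>
    obtain a where a: "- B - 1 < a" "a < - B" "a \<notin> K"
      using gap[of "- B - 1" "- B"] by auto
    obtain b where b: "B < b" "b < B + 1" "b \<notin> K"
      using gap[of B "B + 1"] by auto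
    have "a < b"
      using a b B(1) by simp
    note box = box_neighbourhoods[OF n K this a(3) b(3) B(1)]
    have "C \<subseteq> closed_box n (lower a B) (upper b B)"
      using B(2) \<open>C \<subseteq> Rn n\<close> a b unfolding closed_box_def lower_def upper_def
      by (auto simp: abs_le_iff) (smt (verit))+
    then have "insert None (Some ` (Rn n - closed_box n (lower a B) (upper b B))) \<subseteq> W"
      unfolding C(2) by blast
    with box None show ?thesis
      by (intro exI[of _ "insert None (Some ` (Rn n - closed_box n (lower a B) (upper b B)))"]
          exI[of _ "Some ` open_box n (lower a B) (upper b B)"]) (auto simp: disjnt_sym)
  next
    case (Some p)
    then obtain s where s: "s \<in> K" "p = on_axis s"
      using e by auto
    obtain W0 where W0: "openin (Euclidean_space n) W0" "p \<in> W0" "Some ` W0 \<subseteq> W"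
    proof -
      have "openin (Euclidean_space n) {x \<in> topspace (Euclidean_space n). Some x \<in> W}"
        using openin_continuous_map_preimage[OF continuous_map_Some W(1)] .
      moreover have "p \<in> topspace (Euclidean_space n)"
        using n on_axis_in_Rn[of n s] by (simp add: s(2) topspace_Rn)
      ultimately show ?thesis
        using W(2) Some that by blast
    qed
    then obtain O' where O': "open O'" "W0 = Rn n \<inter> O'"
      unfolding Euclidean_space_eq openin_open by auto
    obtain d where d: "d > 0"
      "\<And>x. (\<And>i. i < n \<Longrightarrow> \<bar>x i - p i\<bar> < d) \<Longrightarrow> (\<And>i. i \<ge> n \<Longrightarrow> x i = p i) \<Longrightarrow> x \<in> O'"
      using open_contains_coordinate_cube[OF O'(1), of p n] W0(2) O'(2) by blast
    \<comment> \<open>Here the box has to fit into the cube of radius \<open>d\<close> about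
      \<open>p\<close>, with its faces across the axis again outside \<open>K\<close>.\<close>
    obtain a where a: "s - d < a" "a < s" "a \<notin> K"
      using gap[of "s - d" s] d(1) by auto
    obtain b where b: "s < b" "b < s + d" "b \<notin> K"
      using gap[of s "s + d"] d(1) by auto
    have "a < b"
      using a b by simp
    note box = box_neighbourhoods[OF n K this a(3) b(3) d(1)]
    have "open_box n (lower a d) (upper b d) \<subseteq> W0"
    proof
      fix x assume x: "x \<in> open_box n (lower a d) (upper b d)"
      have "\<bar>x i - p i\<bar> < d" if "i < n" for i
        using x that a b by (cases "i = 0") (force simp: open_box_def lower_def upper_def s(2))+
      moreover have "x i = p i" if "i \<ge> n" for i
        using x that n by (simp add: open_box_def Rn_def s(2))
      ultimately have "x \<in> O'"
        by (rule d(2))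
      then show "x \<in> W0"
        using x by (simp add: O'(2) open_box_def)
    qed
    then have "Some ` open_box n (lower a d) (upper b d) \<subseteq> W"
      using W0(3) by blast
    moreover have "p \<in> open_box n (lower a d) (upper b d)"
      using n a b d(1) on_axis_in_Rn[of n s] by (auto simp: open_box_def lower_def upper_def s(2))
    ultimately show ?thesis
      using box Some
      by (intro exI[of _ "Some ` open_box n (lower a d) (upper b d)"]
          exI[of _ "insert None (Some ` (Rn n - closed_box n (lower a d) (upper b d)))"]) auto
  qed
  have closed: "closedin ?X ?E"
  proof -
    have "closed (on_axis ` K)"
      using K by (intro closed_on_axis_image) (simp add: nowhere_dense_closed_def)
    then have "openin (Euclidean_space n) (Rn n - on_axis ` K)"
      by (simp add: Euclidean_space_eq Diff_eq open_Compl openin_open_Int)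
    moreover have "on_axis ` K \<subseteq> Rn n"
      using n on_axis_in_Rn[of n] by auto
    then have "?E = topspace ?X - Some ` (Rn n - on_axis ` K)"
      by (auto simp: topspace_Rn)
    ultimately show ?thesis
      unfolding closedin_Alexandroff_compactification by blast
  qed
  have Hausdorff: "Hausdorff_space ?X"
    unfolding Hausdorff_space_Alexandroff_compactification
    by (simp add: Hausdorff_Euclidean_space locally_compact_Euclidean_space)
  show ?thesis
    unfolding end_compactification_def
  proof (intro conjI ballI allI impI closed Hausdorff compact_space_Alexandroff_compactification)
    fix e W assume e: "e \<in> ?E" and W: "openin ?X W \<and> e \<in> W"
    from nhds[OF e conjunct1[OF W] conjunct2[OF W]] obtain V V' where
      V: "openin ?X V" "openin ?X V'" "disjnt V V'" "e \<in> V" "V \<subseteq> W" "?E \<subseteq> V \<union> V'"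
        "connectedin ?X (V - ?E)" "V - ?E \<noteq> {}"
      by (elim exE conjE)
    show "\<exists>V. openin ?X V \<and> e \<in> V \<and> V \<subseteq> W \<and> connectedin ?X (V - ?E) \<and> V - ?E \<noteq> {}"
      by (intro exI[of _ V] conjI V)
    show "\<exists>V V'. openin ?X V \<and> openin ?X V' \<and> disjnt V V' \<and> e \<in> V \<and> V \<subseteq> W \<and> ?E \<subseteq> V \<union> V'"
      by (intro exI[of _ V] exI[of _ V'] conjI V)
  qed
qed

section \<open>Category\<close>

lemma meager_in_subset:
  assumes "meager_in X A" "B \<subseteq> A"
  shows "meager_in X B"
proof -
  obtain \<N> where \<N>: "countable \<N>" "\<And>N. N \<in> \<N> \<Longrightarrow> nowhere_dense_in X N" "A = \<Union>\<N>"
    using assms(1) unfolding meager_in_def by auto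
  have "nowhere_dense_in X (N \<inter> B)" if "N \<in> \<N>" for N
    using \<N>(2)[OF that] interior_of_mono[OF closure_of_mono[of "N \<inter> B" N X]]
    unfolding nowhere_dense_in_def by (simp add: subset_iff) blast
  moreover have "B = \<Union>((\<lambda>N. N \<inter> B) ` \<N>)"
    using assms(2) \<N>(3) by auto
  ultimately show ?thesis
    unfolding meager_in_def using countable_image[OF \<N>(1)]
    by (intro exI[of _ "(\<lambda>N. N \<inter> B) ` \<N>"]) auto
qed

lemma meager_in_UN:
  assumes "countable I" "\<And>i. i \<in> I \<Longrightarrow> meager_in X (A i)"
  shows "meager_in X (\<Union>i\<in>I. A i)"
proof -
  have "\<forall>i\<in>I. \<exists>\<N>. countable \<N> \<and> (\<forall>N\<in>\<N>. nowhere_dense_in X N) \<and> A i = \<Union>\<N>"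
    using assms(2) unfolding meager_in_def by simp
  from bchoice[OF this] obtain \<N> where
    \<N>: "\<forall>i\<in>I. countable (\<N> i) \<and> (\<forall>N\<in>\<N> i. nowhere_dense_in X N) \<and> A i = \<Union>(\<N> i)"
    by (elim exE)
  then have "(\<Union>i\<in>I. A i) = (\<Union>i\<in>I. \<Union>(\<N> i))"
    by (intro SUP_cong) simp_all
  also have "\<dots> = \<Union>(\<Union>i\<in>I. \<N> i)"
    by blast
  finally have "(\<Union>i\<in>I. A i) = \<Union>(\<Union>i\<in>I. \<N> i)" .
  moreover have "countable (\<Union>i\<in>I. \<N> i)"
    using \<N> by (intro countable_UN assms(1)) simp
  ultimately show ?thesis
    unfolding meager_in_def using \<N> by (intro exI[of _ "\<Union>i\<in>I. \<N> i"]) simp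
qed

lemma meager_in_Un:
  assumes "meager_in X A" "meager_in X B"
  shows "meager_in X (A \<union> B)"
proof -
  have "meager_in X (\<Union>b\<in>{True, False}. if b then A else B)"
    using assms by (intro meager_in_UN) auto
  then show ?thesis
    by (simp add: Un_commute)
qed

lemma nowhere_dense_in_euclidean:
  "nowhere_dense_in euclidean S \<longleftrightarrow> interior (closure S) = {}"
  by (simp add: nowhere_dense_in_def)

lemma meager_in_translation:
  fixes A :: "real set"
  assumes "meager_in euclideanreal A"
  shows "meager_in euclideanreal {x. x + g \<in> A}"
proof -
  obtain \<N> where \<N>: "countable \<N>" "\<forall>N\<in>\<N>. nowhere_dense_in euclideanreal N" "A = \<Union>\<N>"
    using assms unfolding meager_in_def by auto
  have "nowhere_dense_in euclideanreal ((\<lambda>x. - g + x) ` N)" if "N \<in> \<N>" for N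
  proof -
    have "interior (closure ((\<lambda>x. - g + x) ` N)) = (\<lambda>x. - g + x) ` interior (closure N)"
      by (simp only: closure_translation interior_translation)
    then show ?thesis
      using \<N>(2) that by (simp only: nowhere_dense_in_euclidean) simp
  qed
  moreover have "{x. x + g \<in> A} = \<Union>((\<lambda>N. (\<lambda>x. - g + x) ` N) ` \<N>)"
  proof -
    have "x \<in> (\<lambda>x. - g + x) ` N \<longleftrightarrow> x + g \<in> N" for x N
      by (force simp: image_iff)
    then show ?thesis
      by (auto simp: \<N>(3))
  qed
  ultimately show ?thesis
    unfolding meager_in_def using countable_image[OF \<N>(1)]
    by (intro exI[of _ "(\<lambda>N. (\<lambda>x. - g + x) ` N) ` \<N>"]) simp
qed

lemma not_meager_in_UNIV: "\<not> meager_in euclideanreal UNIV"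
proof
  assume "meager_in euclideanreal UNIV"
  then obtain \<N> where \<N>: "countable \<N>" "\<forall>N\<in>\<N>. nowhere_dense_in euclideanreal N" "UNIV = \<Union>\<N>"
    unfolding meager_in_def by auto
  define \<G> where "\<G> = (\<lambda>N. - closure N) ` \<N>"
  have "UNIV \<subseteq> closure (\<Inter>\<G>)"
  proof (rule Baire)
    show "countable \<G>"
      using \<N>(1) by (simp add: \<G>_def)
    show "openin (top_of_set UNIV) T \<and> UNIV \<subseteq> closure T" if T: "T \<in> \<G>" for T
    proof -
      obtain N where N: "N \<in> \<N>" "T = - closure N"
        using T by (auto simp: \<G>_def)
      then have "interior (closure N) = {}"
        using \<N>(2) by (simp add: nowhere_dense_in_euclidean)
      then show ?thesis
        by (simp add: N(2) closure_complement open_Compl)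
    qed
  qed simp
  then have "\<Inter>\<G> \<noteq> {}"
    by auto
  then obtain x where "x \<in> \<Inter>\<G>"
    by auto
  then have "x \<notin> closure N" if "N \<in> \<N>" for N
    using that by (auto simp: \<G>_def)
  then have "x \<notin> \<Union>\<N>"
    using closure_subset by blast
  then show False
    using \<N>(3) by (metis UNIV_I)
qed

lemma countable_imp_meager:
  fixes A :: "real set"
  assumes "countable A"
  shows "meager_in euclideanreal A"
proof -
  have "nowhere_dense_in euclideanreal {x}" for x
    by (simp add: nowhere_dense_in_euclidean)
  then have "meager_in euclideanreal {x}" for x
    unfolding meager_in_def by (intro exI[of _ "{{x}}"]) simp
  then show ?thesis
    using meager_in_UN[OF assms, of euclideanreal "\<lambda>x. {x}"] by simp
qed

section \<open>A zero-one law for a dense group of translations\<close>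

definition irr :: real where
  "irr = (SOME x. x \<notin> \<rat>)"

lemma irr_irrational: "irr \<notin> \<rat>"
proof -
  have "\<exists>x :: real. x \<notin> \<rat>"
    using countable_rat uncountable_UNIV_real by (metis UNIV_eq_I)
  then show ?thesis
    unfolding irr_def by (rule someI_ex)
qed

text \<open>If \<open>A\<close> agrees with a nonempty open \<open>U\<close> up to a meager set, the
  dense group moves any given point outside \<open>A\<close> into a ball in \<open>U\<close>. By
  invariance it stays outside \<open>A\<close>, so it lands in the meager difference. Thus countably
  many translates of a meager set cover \<open>- A\<close>.\<close>

lemma zero_one_law:
  assumes "Baire_property_in euclideanreal A"
    and inv: "\<And>t. t + 1 \<in> A \<longleftrightarrow> t \<in> A" "\<And>t. t + irr \<in> A \<longleftrightarrow> t \<in> A"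
  shows "meager_in euclideanreal A \<or> meager_in euclideanreal (- A)"
proof -
  have inv_int: "t + of_int i * g \<in> A \<longleftrightarrow> t \<in> A" if g: "\<And>t. t + g \<in> A \<longleftrightarrow> t \<in> A" for t g and i :: int
  proof -
    have nat: "t + of_nat m * g \<in> A \<longleftrightarrow> t \<in> A" for m t
    proof (induction m)
      case (Suc m)
      then show ?case
        using g[of "t + of_nat m * g"] by (simp add: algebra_simps)
    qed simp
    show ?thesis
    proof (cases i)
      case (nonneg m)
      then show ?thesis using nat[of t m] by simp
    next
      case (neg m)
      then have i: "real_of_int i = - real (Suc m)"
        by simp
      have eq: "t + of_int i * g + of_nat (Suc m) * g = t"
        unfolding i by (simp only: mult_minus_left add_uminus_conv_diff diff_add_cancel)
      show ?thesis
        using nat[of "t + of_int i * g" "Suc m"] unfolding eq by blast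
    qed
  qed
  obtain U where U: "open U" "meager_in euclideanreal (sym_diff A U)"
    using assms(1) unfolding Baire_property_in_def by auto
  show ?thesis
  proof (cases "U = {}")
    case True
    then show ?thesis using U(2) by simp
  next
    case False
    then obtain c e where c: "e > 0" "ball c e \<subseteq> U"
      using U(1) unfolding open_contains_ball by blast
    define B where "B p = {x. x + (of_int (fst p) * irr + of_int (snd p) * 1) \<in> sym_diff A U}" for p
    have "- A \<subseteq> (\<Union>p. B p)"
    proof
      fix x assume x: "x \<in> - A"
      \<comment> \<open>Integer combinations of 1 and \<open>irr\<close> are dense; they are made to
        approximate the displacement from \<open>x\<close> to the centre of the ball.\<close>
      obtain h k where hk: "\<bar>of_int k * irr - of_int h - (c - x)\<bar> < e"
        using sequence_of_fractional_parts_is_dense[OF irr_irrational c(1)] by blast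
      define y where "y = x + (of_int k * irr + of_int (- h) * 1)"
      have "y \<in> ball c e"
        using hk by (simp add: y_def dist_real_def)
      then have "y \<in> U"
        using c(2) by blast
      moreover have "y \<notin> A"
      proof -
        have "y = x + of_int k * irr + of_int (- h) * 1"
          by (simp add: y_def)
        then show ?thesis
          using x inv_int[OF inv(2), of x k] inv_int[OF inv(1), of "x + of_int k * irr" "- h"] by simp
      qed
      ultimately have "x \<in> B (k, - h)"
        by (simp add: B_def y_def)
      then show "x \<in> (\<Union>p. B p)" by blast
    qed
    moreover have "meager_in euclideanreal (\<Union>p. B p)"
      unfolding B_def by (intro meager_in_UN meager_in_translation U(2)) simp
    ultimately show ?thesis
      using meager_in_subset by blast
  qed
qed

section \<open>Homeomorphic spaces have equivalent homeomorphism groups\<close>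

lemma term_val_hom:
  assumes "\<And>a b. a \<in> carrier G \<Longrightarrow> b \<in> carrier G \<Longrightarrow> h (a \<otimes>\<^bsub>G\<^esub> b) = h a \<otimes>\<^bsub>H\<^esub> h b"
    and "h \<one>\<^bsub>G\<^esub> = \<one>\<^bsub>H\<^esub>" "range e \<subseteq> carrier G" "group G"
  shows "term_val G e s \<in> carrier G \<and> term_val H (\<lambda>i. h (e i)) s = h (term_val G e s)"
proof (induction s)
  case (Var i)
  then show ?case using assms(3) by auto
next
  case One
  then show ?case using assms(2,4) by (simp add: group.is_monoid monoid.one_closed)
next
  case (Mult s1 s2)
  then show ?case using assms(1,4) by (simp add: group.is_monoid monoid.m_closed)
qed

lemma sat_iso:
  assumes h: "bij_betw h (carrier G) (carrier H)" "group G"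
    "\<And>a b. a \<in> carrier G \<Longrightarrow> b \<in> carrier G \<Longrightarrow> h (a \<otimes>\<^bsub>G\<^esub> b) = h a \<otimes>\<^bsub>H\<^esub> h b"
    "h \<one>\<^bsub>G\<^esub> = \<one>\<^bsub>H\<^esub>"
    and e: "range e \<subseteq> carrier G"
  shows "sat H (\<lambda>i. h (e i)) \<phi> \<longleftrightarrow> sat G e \<phi>"
  using e
proof (induction \<phi> arbitrary: e)
  case (Equal s1 s2)
  note tv = term_val_hom[OF h(3,4) Equal h(2)]
  show ?case
    using tv[of s1] tv[of s2] bij_betw_imp_inj_on[OF h(1)] by (simp add: inj_on_eq_iff)
next
  case (Exists j \<phi>)
  have upd: "(\<lambda>i. h (e i))(j := h a) = (\<lambda>i. h ((e(j := a)) i))" for a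
    by auto
  have "sat H (\<lambda>i. h (e i)) (Exists j \<phi>) \<longleftrightarrow> (\<exists>a\<in>carrier G. sat H ((\<lambda>i. h (e i))(j := h a)) \<phi>)"
    unfolding sat.simps bij_betw_imp_surj_on[OF h(1), symmetric] by simp
  also have "\<dots> \<longleftrightarrow> (\<exists>a\<in>carrier G. sat G (e(j := a)) \<phi>)"
  proof (rule bex_cong[OF refl])
    fix a assume "a \<in> carrier G"
    then have "range (e(j := a)) \<subseteq> carrier G"
      using Exists.prems by auto
    then show "sat H ((\<lambda>i. h (e i))(j := h a)) \<phi> \<longleftrightarrow> sat G (e(j := a)) \<phi>"
      unfolding upd by (rule Exists.IH)
  qed
  finally show ?case by simp
qed simp_all

lemma models_iso:
  fixes G :: "('a, 'm) monoid_scheme" and H :: "('c, 'k) monoid_scheme"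
  assumes h: "bij_betw h (carrier G) (carrier H)" "group G"
    "\<And>a b. a \<in> carrier G \<Longrightarrow> b \<in> carrier G \<Longrightarrow> h (a \<otimes>\<^bsub>G\<^esub> b) = h a \<otimes>\<^bsub>H\<^esub> h b"
    "h \<one>\<^bsub>G\<^esub> = \<one>\<^bsub>H\<^esub>"
  shows "models G \<phi> \<longleftrightarrow> models H \<phi>"
proof
  assume G: "models G \<phi>"
  show "models H \<phi>"
    unfolding models_def
  proof (intro allI impI)
    fix e :: "nat \<Rightarrow> 'c" assume e: "range e \<subseteq> carrier H"
    define e' where "e' i = inv_into (carrier G) h (e i)" for i
    have "e i \<in> h ` carrier G" for i
      using e bij_betw_imp_surj_on[OF h(1)] by auto
    then have e': "range e' \<subseteq> carrier G" "\<And>i. h (e' i) = e i"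
      by (auto simp: e'_def inv_into_into f_inv_into_f)
    then have "sat G e' \<phi>"
      using G by (simp add: models_def)
    then show "sat H e \<phi>"
      using sat_iso[OF h e'(1)] by (simp add: e'(2))
  qed
next
  assume H: "models H \<phi>"
  show "models G \<phi>"
    unfolding models_def
  proof (intro allI impI)
    fix e :: "nat \<Rightarrow> 'a" assume e: "range e \<subseteq> carrier G"
    then have "range (\<lambda>i. h (e i)) \<subseteq> carrier H"
      using bij_betw_imp_surj_on[OF h(1)] by auto
    then have "sat H (\<lambda>i. h (e i)) \<phi>"
      using H by (simp add: models_def)
    then show "sat G e \<phi>"
      using sat_iso[OF h e] by simp
  qed
qed

text \<open>Conjugation by the homeomorphism is a group isomorphism; restricting keeps the
  conjugates in extensional form.\<close>

lemma homeomorphic_space_imp_models_iff: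
  assumes "X homeomorphic_space Y"
  shows "models (Homeo X) \<phi> \<longleftrightarrow> models (Homeo Y) \<phi>"
proof -
  obtain f g where fg: "homeomorphic_maps X Y f g"
    using assms unfolding homeomorphic_space_def by auto
  then have maps: "homeomorphic_map X Y f" "homeomorphic_map Y X g"
    using homeomorphic_maps_map by auto
  have mem: "\<And>x. x \<in> topspace X \<Longrightarrow> f x \<in> topspace Y" "\<And>y. y \<in> topspace Y \<Longrightarrow> g y \<in> topspace X"
    and inv: "\<And>x. x \<in> topspace X \<Longrightarrow> g (f x) = x" "\<And>y. y \<in> topspace Y \<Longrightarrow> f (g y) = y"
    using fg unfolding homeomorphic_maps_def continuous_map_def by auto
  define h where "h a = restrict (\<lambda>y. f (a (g y))) (topspace Y)" for a
  define h' where "h' b = restrict (\<lambda>x. g (b (f x))) (topspace X)" for b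
  have self: "a x \<in> topspace X" if "a \<in> carrier (Homeo X)" "x \<in> topspace X" for a x
    using that by (auto simp: carrier_Homeo dest!: homeomorphic_imp_surjective_map)
  have self': "b y \<in> topspace Y" if "b \<in> carrier (Homeo Y)" "y \<in> topspace Y" for b y
    using that by (auto simp: carrier_Homeo dest!: homeomorphic_imp_surjective_map)
  have h: "h a \<in> carrier (Homeo Y)" if "a \<in> carrier (Homeo X)" for a
  proof -
    have "homeomorphic_map Y Y (f \<circ> (a \<circ> g))"
      using that maps by (auto simp: carrier_Homeo intro!: homeomorphic_map_compose)
    then have "homeomorphic_map Y Y (h a)"
      by (rule homeomorphic_map_eq) (simp add: h_def)
    then show ?thesis
      by (simp add: carrier_Homeo h_def)
  qed
  have h': "h' b \<in> carrier (Homeo X)" if "b \<in> carrier (Homeo Y)" for b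
  proof -
    have "homeomorphic_map X X (g \<circ> (b \<circ> f))"
      using that maps by (auto simp: carrier_Homeo intro!: homeomorphic_map_compose)
    then have "homeomorphic_map X X (h' b)"
      by (rule homeomorphic_map_eq) (simp add: h'_def)
    then show ?thesis
      by (simp add: carrier_Homeo h'_def)
  qed
  show ?thesis
  proof (rule models_iso[OF _ group_Homeo])
    show "bij_betw h (carrier (Homeo X)) (carrier (Homeo Y))"
    proof (rule bij_betw_byWitness[where f'=h'])
      show "\<forall>a\<in>carrier (Homeo X). h' (h a) = a"
      proof
        fix a assume a: "a \<in> carrier (Homeo X)"
        show "h' (h a) = a"
        proof (rule extensionalityI)
          show "h' (h a) \<in> extensional (topspace X)"
            by (simp add: h'_def)
          show "a \<in> extensional (topspace X)"
            using a by (simp add: carrier_Homeo)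
        qed (use a self mem inv in \<open>simp add: h_def h'_def\<close>)
      qed
      show "\<forall>b\<in>carrier (Homeo Y). h (h' b) = b"
      proof
        fix b assume b: "b \<in> carrier (Homeo Y)"
        show "h (h' b) = b"
        proof (rule extensionalityI)
          show "h (h' b) \<in> extensional (topspace Y)"
            by (simp add: h_def)
          show "b \<in> extensional (topspace Y)"
            using b by (simp add: carrier_Homeo)
        qed (use b self' mem inv in \<open>simp add: h_def h'_def\<close>)
      qed
    qed (use h h' in auto)
    show "h (a \<otimes>\<^bsub>Homeo X\<^esub> b) = h a \<otimes>\<^bsub>Homeo Y\<^esub> h b"
      if a: "a \<in> carrier (Homeo X)" and b: "b \<in> carrier (Homeo X)" for a b
    proof (rule extensionalityI[where A="topspace Y"])
      show "h a \<otimes>\<^bsub>Homeo Y\<^esub> h b \<in> extensional (topspace Y)"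
        using h[OF a] h[OF b] by (simp add: mult_Homeo)
      fix y assume y: "y \<in> topspace Y"
      show "h (a \<otimes>\<^bsub>Homeo X\<^esub> b) y = (h a \<otimes>\<^bsub>Homeo Y\<^esub> h b) y"
        unfolding mult_Homeo[OF a b] mult_Homeo[OF h[OF a] h[OF b]]
        using y mem inv self[OF b] by (simp add: compose_def h_def)
    qed (simp add: h_def)
    show "h \<one>\<^bsub>Homeo X\<^esub> = \<one>\<^bsub>Homeo Y\<^esub>"
      unfolding one_Homeo using mem inv by (auto simp: h_def fun_eq_iff restrict_def)
  qed
qed

section \<open>The family of manifolds\<close>

text \<open>A rational in \<open>[0,1)\<close> is marked iff it lies below the fractional part of \<open>t + k * irr\<close>. The
  rationals outside of \<open>[0,1)\<close> carry no information. This form makes the relation open in \<open>t\<close> even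
  where the fractional part is discontinuous.\<close>

definition marks :: "real \<Rightarrow> int \<Rightarrow> nat \<Rightarrow> bool" where
  "marks t k a \<longleftrightarrow> (\<exists>z :: int. of_int z + of_rat (from_nat a) < t + of_int k * irr \<and> t + of_int k * irr < of_int z + 1)"

lemma marks_add_1: "marks (t + 1) k a \<longleftrightarrow> marks t k a"
proof
  assume "marks (t + 1) k a"
  then obtain z :: int where "of_int z + of_rat (from_nat a) < t + 1 + of_int k * irr"
    "t + 1 + of_int k * irr < of_int z + 1"
    unfolding marks_def by auto
  then show "marks t k a"
    unfolding marks_def by (intro exI[of _ "z - 1"]) simp
next
  assume "marks t k a"
  then obtain z :: int where "of_int z + of_rat (from_nat a) < t + of_int k * irr"
    "t + of_int k * irr < of_int z + 1"
    unfolding marks_def by auto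
  then show "marks (t + 1) k a"
    unfolding marks_def by (intro exI[of _ "z + 1"]) simp
qed

lemma marks_add_irr: "marks (t + irr) k a \<longleftrightarrow> marks t (k + 1) a"
  unfolding marks_def by (simp add: algebra_simps)

text \<open>Within [0,1) the marked rationals form the lower cut of the fractional part. A rational
  strictly between \<open>frac t\<close> and \<open>frac s\<close> would be marked for
  \<open>s\<close> but not for \<open>t\<close>.\<close>

lemma frac_le_if_marks_subset:
  assumes "{a. marks s 0 a} \<subseteq> {a. marks t 0 a}"
  shows "frac s \<le> frac t"
proof (rule ccontr)
  assume "\<not> frac s \<le> frac t"
  then obtain q where q: "frac t < of_rat q" "of_rat q < frac s"
    using of_rat_dense[of "frac t" "frac s"] by auto
  have a: "from_nat (to_nat q) = q"
    by simp
  have "marks s 0 (to_nat q)"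
    unfolding marks_def a using q(2)
    by (intro exI[of _ "\<lfloor>s\<rfloor>"]) (simp add: frac_def)
  then have "marks t 0 (to_nat q)"
    using assms by blast
  then obtain z :: int where z: "of_int z + of_rat q < t" "t < of_int z + 1"
    unfolding marks_def a by auto
  \<comment> \<open>Positivity of \<open>q\<close> identifies the integer \<open>z\<close> from
    \<open>marks\<close> as the integer part of \<open>t\<close>.\<close>
  have "0 < (of_rat q :: real)"
    using q(1) frac_ge_0[of t] by linarith
  then have "\<lfloor>t\<rfloor> = z"
    using z by linarith
  then show False
    using z(1) q(1) by (simp add: frac_def)
qed

lemma countable_same_marks: "countable {s. {a. marks s 0 a} = L}"
proof (cases "\<exists>t. {a. marks t 0 a} = L")
  case True
  then obtain t where t: "{a. marks t 0 a} = L" by auto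
  have "{s. {a. marks s 0 a} = L} \<subseteq> range (\<lambda>z :: int. frac t + of_int z)"
  proof
    fix s assume "s \<in> {s. {a. marks s 0 a} = L}"
    then have "{a. marks s 0 a} = {a. marks t 0 a}"
      using t by simp
    then have "frac s = frac t"
      using frac_le_if_marks_subset[of s t] frac_le_if_marks_subset[of t s] by simp
    then have "s = frac t + of_int \<lfloor>s\<rfloor>"
      by (simp add: frac_def)
    then show "s \<in> range (\<lambda>z :: int. frac t + of_int z)"
      by (rule image_eqI) simp
  qed
  then show ?thesis
    by (rule countable_subset) simp
next
  case False
  then have "{s. {a. marks s 0 a} = L} = {}" by auto
  then show ?thesis by simp
qed

section \<open>Removed sets and punctured spaces\<close>

definition removed :: "real \<Rightarrow> real set" where
  "removed t = real_code ` end_codes (marks t)"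

definition punctured :: "nat \<Rightarrow> real \<Rightarrow> (nat \<Rightarrow> real) set" where
  "punctured n t = Rn n - on_axis ` removed t"

lemma removed_nowhere_dense: "nowhere_dense_closed (removed t)"
  unfolding nowhere_dense_closed_def
proof (intro conjI allI impI)
  show "closed (removed t)"
    unfolding removed_def by (intro closed_real_code_image closed_end_codes)
  show "\<exists>s. a < s \<and> s < b \<and> s \<notin> removed t" if "a < b" for a b
    using not_in_range_real_code[OF that] by (auto simp: removed_def)
qed

lemma removed_add_1: "removed (t + 1) = removed t"
  unfolding removed_def by (simp add: marks_add_1[abs_def])

text \<open>Adding \<open>irr\<close> to the parameter renumbers the clusters by one, and
  \<open>real_code\<close> places consecutive clusters at distance one, so the removed set is merely
  translated.\<close>

lemma mem_removed_add_irr: "s \<in> removed (t + irr) \<longleftrightarrow> s + 1 \<in> removed t"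
proof -
  have shift: "real_code (k + 1, F, G) = real_code (k, F, G) + 1" for k F G
    by (simp add: real_code_def)
  have iff: "(k, F, G) \<in> end_codes (marks (t + irr)) \<longleftrightarrow> (k + 1, F, G) \<in> end_codes (marks t)" for k F G
    by (simp add: end_codes_def marks_add_irr)
  show ?thesis
  proof
    assume "s \<in> removed (t + irr)"
    then obtain k F G where "(k, F, G) \<in> end_codes (marks (t + irr))" "s = real_code (k, F, G)"
      unfolding removed_def by auto
    then show "s + 1 \<in> removed t"
      unfolding removed_def iff shift[symmetric] by (intro image_eqI[of _ _ "(k + 1, F, G)"]) (simp_all add: shift)
  next
    assume "s + 1 \<in> removed t"
    then obtain k F G where *: "(k, F, G) \<in> end_codes (marks t)" "s + 1 = real_code (k, F, G)"
      unfolding removed_def by auto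
    then have "(k - 1, F, G) \<in> end_codes (marks (t + irr))" "s = real_code (k - 1, F, G)"
      using iff[of "k - 1" F G] shift[of "k - 1" F G] by simp_all
    then show "s \<in> removed (t + irr)"
      unfolding removed_def by (intro image_eqI[of _ _ "(k - 1, F, G)"])
  qed
qed

lemma openin_punctured: "openin (Euclidean_space n) (punctured n t)"
proof -
  have "closed (on_axis ` removed t)"
    using removed_nowhere_dense by (intro closed_on_axis_image) (simp add: nowhere_dense_closed_def)
  then show ?thesis
    by (simp add: punctured_def Euclidean_space_eq Diff_eq open_Compl openin_open_Int)
qed

lemma top_of_set_punctured: "top_of_set (punctured n t) = subtopology (Euclidean_space n) (punctured n t)"
  by (simp add: Euclidean_space_eq subtopology_subtopology punctured_def Int_absorb1 Diff_subset)

lemma second_countable_euclidean: "second_countable (euclidean :: 'a::second_countable_topology topology)"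
proof -
  obtain B :: "'a set set" where B: "countable B" "topological_basis B"
    using ex_countable_basis by auto
  show ?thesis
    unfolding second_countable_def
  proof (intro exI[of _ B] conjI ballI allI impI)
    show "openin euclidean V" if "V \<in> B" for V
      using B(2) that topological_basis_open by auto
    show "\<exists>V\<in>B. x \<in> V \<and> V \<subseteq> W" if "openin euclidean W \<and> x \<in> W" for W x
    proof -
      have "open W" "x \<in> W"
        using that by auto
      from topological_basisE[OF B(2) this] show ?thesis by metis
    qed
  qed (rule B(1))
qed

text \<open>Being open in Euclidean space, the set serves as its own chart around every
  point.\<close>

lemma manifold_punctured:
  assumes "n \<ge> 2"
  shows "manifold n (top_of_set (punctured n t))"
  unfolding manifold_def
proof (intro conjI)
  obtain s where "s \<notin> removed t"
    using removed_nowhere_dense[of t] unfolding nowhere_dense_closed_def by (meson zero_less_one)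
  moreover have "on_axis s \<in> Rn n"
    using assms by (intro on_axis_in_Rn) simp
  ultimately have "on_axis s \<in> punctured n t"
    by (simp add: punctured_def)
  then show "topspace (top_of_set (punctured n t)) \<noteq> {}"
    by (metis empty_iff topspace_euclidean_subtopology)
  show "connected_space (top_of_set (punctured n t))"
    using connected_Rn_minus_axis[OF assms removed_nowhere_dense[of t]]
    by (simp add: punctured_def flip: connectedin_iff_connected) (simp add: connectedin_def)
  show "second_countable (top_of_set (punctured n t))"
    by (intro second_countable_subtopology second_countable_euclidean)
  show "Hausdorff_space (top_of_set (punctured n t))"
    by (intro Hausdorff_space_subtopology Hausdorff_space_euclidean)
  show "locally_Euclidean_space n (top_of_set (punctured n t))"
    unfolding locally_Euclidean_space_def
  proof (intro ballI exI conjI)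
    fix x assume "x \<in> topspace (top_of_set (punctured n t))"
    then show "x \<in> punctured n t" by simp
    show "openin (top_of_set (punctured n t)) (punctured n t)"
      by simp
    show "openin (Euclidean_space n) (punctured n t)"
      by (rule openin_punctured)
    show "subtopology (top_of_set (punctured n t)) (punctured n t) homeomorphic_space subtopology (Euclidean_space n) (punctured n t)"
      unfolding top_of_set_punctured[symmetric] by (simp add: subtopology_subtopology homeomorphic_space_refl)
  qed
qed (use assms in simp)

lemma punctured_add_irr_homeomorphic:
  assumes "n \<ge> 2"
  shows "top_of_set (punctured n (t + irr)) homeomorphic_space top_of_set (punctured n t)"
proof -
  define sh where "sh c x = x(0 := x 0 + c)" for c :: real and x :: "nat \<Rightarrow> real"
  have cont: "continuous_on S (sh c)" for S c
  proof (rule continuous_on_coordinatewise_then_product)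
    fix i
    have "continuous_on S (\<lambda>x :: nat \<Rightarrow> real. x i)"
      by (rule continuous_on_product_then_coordinatewise[OF continuous_on_id])
    then show "continuous_on S (\<lambda>x. sh c x i)"
      by (cases "i = 0") (simp_all add: sh_def continuous_on_add)
  qed
  have inv: "sh (- c) (sh c x) = x" "sh c (sh (- c) x) = x" for c x
    by (simp_all add: sh_def)
  have Rn: "sh c x \<in> Rn n \<longleftrightarrow> x \<in> Rn n" for c x
    using assms by (simp add: sh_def Rn_def)
  have mem: "x \<in> punctured n (t + irr) \<longleftrightarrow> sh 1 x \<in> punctured n t" for x
    unfolding punctured_def on_axis_image_eq Diff_iff Rn by (simp add: sh_def mem_removed_add_irr)
  have "homeomorphism (punctured n (t + irr)) (punctured n t) (sh 1) (sh (- 1))"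
    unfolding homeomorphism_def
  proof (intro conjI ballI cont inv)
    show "sh 1 ` punctured n (t + irr) = punctured n t"
      using mem inv(2)[of 1] by (auto simp: image_iff) metis
    show "sh (- 1) ` punctured n t = punctured n (t + irr)"
      using mem inv[of 1] by (auto simp: image_iff) metis
  qed
  then show ?thesis
    unfolding homeomorphic_space_def homeomorphic_maps_top_of_set by blast
qed

section \<open>Counting the members homeomorphic to a given one\<close>

abbreviation ends :: "nat \<Rightarrow> real \<Rightarrow> (nat \<Rightarrow> real) option topology" where
  "ends n t \<equiv> subtopology (Alexandroff_compactification (Euclidean_space n))
     (insert None (Some ` on_axis ` removed t))"

lemma embedding_map_restrict:
  assumes "embedding_map X Y f" "S \<subseteq> topspace X"
  shows "homeomorphic_map (subtopology X S) (subtopology Y (f ` S)) f"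
proof -
  have f: "homeomorphic_map X (subtopology Y (f ` topspace X)) f"
    using assms(1) by (simp add: embedding_map_def)
  have "f ` (topspace X \<inter> S) = topspace (subtopology Y (f ` topspace X)) \<inter> f ` S"
    unfolding homeomorphic_imp_surjective_map[OF f, symmetric] using assms(2) by blast
  from homeomorphic_map_subtopologies[OF f this]
  have "homeomorphic_map (subtopology X S) (subtopology Y (f ` topspace X \<inter> f ` S)) f"
    by (simp add: subtopology_subtopology)
  moreover have "f ` topspace X \<inter> f ` S = f ` S"
    using assms(2) by blast
  ultimately show ?thesis by simp
qed

lemma homeomorphic_ends:
  assumes n: "n \<ge> 2" and hom: "top_of_set (punctured n s) homeomorphic_space top_of_set (punctured n t)"
  shows "ends n s homeomorphic_space ends n t"
proof (rule homeomorphic_end_spaces)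
  let ?X = "Alexandroff_compactification (Euclidean_space n)"
  let ?E = "\<lambda>t. insert None (Some ` on_axis ` removed t)"
  show "end_compactification ?X (?E s)" "end_compactification ?X (?E t)"
    by (intro end_compactification_Rn_minus_axis n removed_nowhere_dense)+
  have *: "top_of_set (punctured n t) homeomorphic_space subtopology ?X (topspace ?X - ?E t)" for t
  proof -
    have "homeomorphic_map (top_of_set (punctured n t)) (subtopology ?X (Some ` punctured n t)) Some"
      unfolding top_of_set_punctured
      by (rule embedding_map_restrict[OF embedding_map_Some openin_subset[OF openin_punctured]])
    moreover have "topspace ?X - ?E t = Some ` punctured n t"
      by (auto simp: punctured_def topspace_Rn)
    ultimately show ?thesis
      using homeomorphic_map_imp_homeomorphic_space by metis
  qed
  show "subtopology ?X (topspace ?X - ?E s) homeomorphic_space subtopology ?X (topspace ?X - ?E t)"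
    by (rule homeomorphic_space_trans[OF homeomorphic_space_trans
          [OF homeomorphic_space_sym[THEN iffD1, OF *[of s]] hom] *[of t]])
qed

lemma homeomorphic_map_on_axis:
  "homeomorphic_map (top_of_set K) (top_of_set (on_axis ` K)) on_axis"
proof -
  have "continuous_on K on_axis"
  proof (rule continuous_on_coordinatewise_then_product)
    show "continuous_on K (\<lambda>s. on_axis s i)" for i
      by (cases "i = 0") simp_all
  qed
  moreover have "continuous_on (on_axis ` K) (\<lambda>x. x 0)"
    by (rule continuous_on_product_then_coordinatewise[OF continuous_on_id])
  ultimately have "homeomorphism K (on_axis ` K) on_axis (\<lambda>x. x 0)"
    unfolding homeomorphism_def by (auto simp: image_image)
  then show ?thesis
    unfolding homeomorphic_map_maps homeomorphic_maps_top_of_set by blast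
qed

lemma end_codes_embedding:
  assumes n: "n \<ge> 2"
  shows "homeomorphic_map (top_of_set (end_codes (marks t)))
    (subtopology (ends n t) (Some ` on_axis ` removed t)) (\<lambda>p. Some (on_axis (real_code p)))"
    (is "homeomorphic_map ?Z ?O ?f")
proof -
  let ?X = "Alexandroff_compactification (Euclidean_space n)"
  obtain g where "homeomorphism (end_codes (marks t)) (removed t) real_code g"
    using homeomorphism_real_code[OF closed_end_codes[of "marks t"]] unfolding removed_def by auto
  then have 1: "homeomorphic_map ?Z (top_of_set (removed t)) real_code"
    unfolding homeomorphic_map_maps homeomorphic_maps_top_of_set by blast
  have sub: "on_axis ` removed t \<subseteq> Rn n"
    using n on_axis_in_Rn[of n] by auto
  then have "top_of_set (on_axis ` removed t) = subtopology (Euclidean_space n) (on_axis ` removed t)"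
    by (simp add: Euclidean_space_eq subtopology_subtopology Int_absorb1)
  then have 2: "homeomorphic_map (top_of_set (on_axis ` removed t)) (subtopology ?X (Some ` on_axis ` removed t)) Some"
    using embedding_map_restrict[OF embedding_map_Some, of "on_axis ` removed t" "Euclidean_space n"] sub
    by (simp add: topspace_Rn)
  have "subtopology ?X (Some ` on_axis ` removed t) = ?O"
    by (simp add: subtopology_subtopology Int_absorb1 subset_insertI)
  then show ?thesis
    using homeomorphic_map_compose[OF homeomorphic_map_compose[OF 1 homeomorphic_map_on_axis] 2]
    by (simp add: o_def)
qed

text \<open>The finite ends are the complement of the end at infinity. Their openness brings
  locality of the invariant to bear, so that labels can be computed in
  \<open>end_codes\<close>.\<close>

lemma openin_finite_ends:
  assumes "n \<ge> 2"
  shows "openin (ends n t) (Some ` on_axis ` removed t)"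
proof -
  have "openin (Alexandroff_compactification (Euclidean_space n)) (Some ` Rn n)"
    using openin_topspace[of "Euclidean_space n"] by (simp add: topspace_Rn)
  moreover have "Some ` on_axis ` removed t = insert None (Some ` on_axis ` removed t) \<inter> Some ` Rn n"
    using assms on_axis_in_Rn[of n] by auto
  ultimately show ?thesis
    using openin_subtopology_Int2 by metis
qed

text \<open>Only the centre of cluster 0 is followed; its label encodes the fractional part of
  \<open>s\<close>. Its image may be the centre of some other cluster, and no control over it is
  attempted beyond its membership in \<open>rank_ge (ends n t) 0\<close>.\<close>

lemma homeomorphic_imp_same_label:
  assumes n: "n \<ge> 2" and hom: "top_of_set (punctured n s) homeomorphic_space top_of_set (punctured n t)"
  shows "Suc ` {a. marks s 0 a} \<in> label (ends n t) ` rank_ge (ends n t) 0"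
proof -
  obtain f where f: "homeomorphic_map (ends n s) (ends n t) f"
    using homeomorphic_ends[OF assms] homeomorphic_space by blast
  let ?p = "(0, emp, emp) :: code_point" and ?O = "Some ` on_axis ` removed s"
  let ?Z = "top_of_set (end_codes (marks s))"
  define q where "q = Some (on_axis (real_code ?p))"
  have pZ: "?p \<in> end_codes (marks s)"
    by (simp add: end_codes_def)
  note emb = end_codes_embedding[OF n, of s] and opn = openin_finite_ends[OF n, of s]
  have qO: "q \<in> ?O"
    using pZ by (simp add: q_def removed_def)
  have "label (ends n s) q = label (subtopology (ends n s) ?O) q"
    using label_open_subtopology[OF opn qO] by simp
  also have "\<dots> = label ?Z ?p"
    unfolding q_def using label_homeomorphic[OF emb, of ?p] pZ by simp
  also have "\<dots> = Suc ` {a. marks s 0 a}"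
    by (rule label_end_codes)
  finally have label: "label (ends n s) q = Suc ` {a. marks s 0 a}" .
  have "?p \<in> rank_ge ?Z 0"
    unfolding rank_ge_end_codes by (simp add: scattered_def)
  then have "q \<in> rank_ge (subtopology (ends n s) ?O) 0"
    unfolding rank_ge_homeomorphic[OF emb] q_def by (rule imageI)
  then have q: "q \<in> rank_ge (ends n s) 0"
    unfolding rank_ge_open_subtopology[OF opn] by (rule IntD2)
  then have "f q \<in> rank_ge (ends n t) 0"
    unfolding rank_ge_homeomorphic[OF f] by (rule imageI)
  moreover have "label (ends n t) (f q) = Suc ` {a. marks s 0 a}"
    using label_homeomorphic[OF f subsetD[OF rank_ge_subset q]] label by simp
  ultimately show ?thesis
    by (metis image_eqI)
qed

lemma countable_rank_ge_ends:
  assumes n: "n \<ge> 2"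
  shows "countable (rank_ge (ends n t) 0)"
proof -
  let ?O = "Some ` on_axis ` removed t"
  have "countable (?O \<inter> rank_ge (ends n t) 0)"
    unfolding rank_ge_open_subtopology[OF openin_finite_ends[OF n], symmetric]
      rank_ge_homeomorphic[OF end_codes_embedding[OF n]]
    by (intro countable_image countable_rank_ge_end_codes)
  then have "countable (insert None (?O \<inter> rank_ge (ends n t) 0))"
    by simp
  moreover have "rank_ge (ends n t) 0 \<subseteq> insert None (?O \<inter> rank_ge (ends n t) 0)"
    using rank_ge_subset[of "ends n t" 0] by auto
  ultimately show ?thesis
    using countable_subset by blast
qed

text \<open>The end space for \<open>t\<close> offers countably many labels, and each of them
  determines the parameter up to an integer.\<close>

lemma countable_homeomorphic:
  assumes n: "n \<ge> 2"
  shows "countable {s. top_of_set (punctured n s) homeomorphic_space top_of_set (punctured n t)}"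
proof -
  let ?L = "label (ends n t) ` rank_ge (ends n t) 0"
  have "{s. top_of_set (punctured n s) homeomorphic_space top_of_set (punctured n t)} \<subseteq>
      (\<Union>L\<in>?L. {s. {a. marks s 0 a} = {a. Suc a \<in> L}})"
  proof
    fix s assume "s \<in> {s. top_of_set (punctured n s) homeomorphic_space top_of_set (punctured n t)}"
    then have "Suc ` {a. marks s 0 a} \<in> ?L"
      using homeomorphic_imp_same_label[OF n] by blast
    then show "s \<in> (\<Union>L\<in>?L. {s. {a. marks s 0 a} = {a. Suc a \<in> L}})"
      by (rule UN_I) auto
  qed
  moreover have "countable (\<Union>L\<in>?L. {s. {a. marks s 0 a} = {a. Suc a \<in> L}})"
    by (intro countable_UN countable_image countable_rank_ge_ends n countable_same_marks)
  ultimately show ?thesis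
    by (rule countable_subset)
qed

section \<open>Definability of the family\<close>

lemma projective_mem_closed:
  fixes f :: "'w::metric_space \<Rightarrow> 'a::topological_space"
    and h :: "'w \<Rightarrow> 'b::discrete_topology" and g :: "'w \<Rightarrow> 'c::discrete_topology"
  assumes "\<And>i j. closed (C i j)" "continuous_on UNIV f" "continuous_on UNIV h" "continuous_on UNIV g"
  shows "projective (\<lambda>w. f w \<in> C (h w) (g w))"
proof -
  have "{w. f w \<notin> C (h w) (g w)} = (\<Union>i j. h -` {i} \<inter> g -` {j} \<inter> f -` (- C i j))"
    by auto
  also have "open \<dots>"
    by (intro open_UN ballI open_Int open_vimage open_discrete open_Compl assms)
  finally have "projective (\<lambda>w. f w \<notin> C (h w) (g w))"
    by (rule projective_open)
  from projective_not[OF this] show ?thesis by simp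
qed

lemma projective_mem_closed1:
  fixes f :: "'w::metric_space \<Rightarrow> 'a::topological_space" and h :: "'w \<Rightarrow> 'b::discrete_topology"
  assumes "\<And>i. closed (C i)" "continuous_on UNIV f" "continuous_on UNIV h"
  shows "projective (\<lambda>w. f w \<in> C (h w))"
  using projective_mem_closed[of "\<lambda>i (_ :: nat). C i" f h "\<lambda>_. 0"] assms by simp

lemma projective_marks:
  fixes t :: "'w::metric_space \<Rightarrow> real" and k :: "'w \<Rightarrow> int" and a :: "'w \<Rightarrow> nat"
  assumes "continuous_on UNIV t" "continuous_on UNIV k" "continuous_on UNIV a"
  shows "projective (\<lambda>w. marks (t w) (k w) (a w))"
proof -
  have t: "continuous_on UNIV (\<lambda>p :: 'w \<times> int. t (fst p))"
    by (rule continuous_on_compose2[OF assms(1) continuous_on_fst[OF continuous_on_id]]) simp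
  have k: "continuous_on UNIV (\<lambda>p :: 'w \<times> int. real_of_int (k (fst p)))"
    by (rule continuous_on_discrete_fun)
      (rule continuous_on_compose2[OF assms(2) continuous_on_fst[OF continuous_on_id]], simp)
  have a: "continuous_on UNIV (\<lambda>p :: 'w \<times> int. (of_rat (from_nat (a (fst p))) :: real))"
    by (rule continuous_on_discrete_fun[where h="\<lambda>a. of_rat (from_nat a)"])
      (rule continuous_on_compose2[OF assms(3) continuous_on_fst[OF continuous_on_id]], simp)
  have z: "continuous_on UNIV (\<lambda>p :: 'w \<times> int. real_of_int (snd p))"
    by (rule continuous_on_discrete_fun) (rule continuous_on_snd[OF continuous_on_id])
  show ?thesis
    unfolding marks_def
    by (intro projective_ex projective_conj projective_less continuous_on_add continuous_on_mult
        t k a z continuous_on_const)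
qed

text \<open>With \<open>attached_part\<close>, this writes the removed set as a countable union of
  closed sets that do not depend on \<open>t\<close>. The parameter only decides, through
  \<open>marks\<close>, which attached Cantor sets take part.\<close>

definition base_part :: "int \<Rightarrow> real set" where
  "base_part k = real_code ` {(k', F, G). k' = k \<and> F \<in> family 0 \<and> G = emp}"

definition attached_part :: "int \<Rightarrow> nat \<Rightarrow> real set" where
  "attached_part k m = real_code ` {(k', F, G). k' = k \<and> F = sing m \<and> (\<forall>i. G i \<longrightarrow> m \<le> i)}"

lemma closed_fst_eq: "closed {p :: code_point. fst p = k}"
  by (intro closed_Collect_eq continuous_intros)

lemma closed_base_part: "closed (base_part k)"
proof -
  have "{(k', F, G). k' = k \<and> F \<in> family 0 \<and> G = emp} = end_codes (\<lambda>_ _. False) \<inter> {p. fst p = k}"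
    by (auto simp: end_codes_def)
  then show ?thesis
    unfolding base_part_def by (simp only:) (intro closed_real_code_image closed_Int closed_end_codes closed_fst_eq)
qed

lemma closed_attached_part: "closed (attached_part k m)"
proof -
  have "closed ((\<lambda>p :: code_point. fst (snd p) i) -` {b})" for i b
  proof (rule closed_vimage[OF closed_singleton])
    show "continuous_on UNIV (\<lambda>p :: code_point. fst (snd p) i)"
      by (rule continuous_on_product_then_coordinatewise) (intro continuous_intros)
  qed
  moreover have "closed ((\<lambda>p :: code_point. snd (snd p) i) -` {b})" for i b
  proof (rule closed_vimage[OF closed_singleton])
    show "continuous_on UNIV (\<lambda>p :: code_point. snd (snd p) i)"
      by (rule continuous_on_product_then_coordinatewise) (intro continuous_intros)
  qed
  ultimately have "closed ({p. fst p = k} \<inter> (\<Inter>i. (\<lambda>p. fst (snd p) i) -` {i = m}) \<inter>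
      (\<Inter>i\<in>{..<m}. (\<lambda>p. snd (snd p) i) -` {False}))"
    by (intro closed_Int closed_INT ballI closed_fst_eq)
  also have "{p. fst p = k} \<inter> (\<Inter>i. (\<lambda>p. fst (snd p) i) -` {i = m}) \<inter>
      (\<Inter>i\<in>{..<m}. (\<lambda>p. snd (snd p) i) -` {False}) =
      {(k', F, G). k' = k \<and> F = sing m \<and> (\<forall>i. G i \<longrightarrow> m \<le> i)}"
  unfolding set_eq_iff
  proof
    fix p :: code_point
    obtain k' F G where p: "p = (k', F, G)"
      by (cases p)
    have "(\<forall>i. F i = (i = m)) \<longleftrightarrow> F = sing m"
      by (simp add: fun_eq_iff)
    moreover have "(\<forall>i\<in>{..<m}. G i = False) \<longleftrightarrow> (\<forall>i. G i \<longrightarrow> m \<le> i)"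
      by (meson lessThan_iff not_le)
    ultimately show "p \<in> {p. fst p = k} \<inter> (\<Inter>i. (\<lambda>p. fst (snd p) i) -` {i = m}) \<inter>
        (\<Inter>i\<in>{..<m}. (\<lambda>p. snd (snd p) i) -` {False}) \<longleftrightarrow>
        p \<in> {(k', F, G). k' = k \<and> F = sing m \<and> (\<forall>i. G i \<longrightarrow> m \<le> i)}"
      by (simp add: p)
  qed
  finally show ?thesis
    unfolding attached_part_def by (rule closed_real_code_image)
qed

lemma mem_removed_iff:
  "s \<in> removed t \<longleftrightarrow> (\<exists>k. s \<in> base_part k \<or> (\<exists>m. marks t k (level m) \<and> s \<in> attached_part k m))"
proof
  assume "s \<in> removed t"
  then obtain k F G where s: "s = real_code (k, F, G)" "(k, F, G) \<in> end_codes (marks t)"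
    by (auto simp: removed_def)
  show "\<exists>k. s \<in> base_part k \<or> (\<exists>m. marks t k (level m) \<and> s \<in> attached_part k m)"
  proof (cases "G = emp")
    case True
    then have "s \<in> base_part k"
      using s unfolding base_part_def end_codes_def by auto
    then show ?thesis by blast
  next
    case False
    then obtain m where m: "F = sing m" "marks t k (level m)" "\<forall>i. G i \<longrightarrow> m \<le> i"
      using s(2) unfolding end_codes_def by auto
    then have "s \<in> attached_part k m"
      unfolding attached_part_def s(1) by (intro imageI) simp
    then show ?thesis
      using m(2) by blast
  qed
next
  assume "\<exists>k. s \<in> base_part k \<or> (\<exists>m. marks t k (level m) \<and> s \<in> attached_part k m)"
  then obtain k where "s \<in> base_part k \<or> (\<exists>m. marks t k (level m) \<and> s \<in> attached_part k m)"
    by (elim exE)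
  then show "s \<in> removed t"
  proof (elim disjE exE conjE)
    assume "s \<in> base_part k"
    then show ?thesis
      unfolding base_part_def removed_def by (auto simp: end_codes_def)
  next
    fix m assume m: "marks t k (level m)" "s \<in> attached_part k m"
    then obtain G where "s = real_code (k, sing m, G)" "\<forall>i. G i \<longrightarrow> m \<le> i"
      unfolding attached_part_def by auto
    moreover from this m(1) have "(k, sing m, G) \<in> end_codes (marks t)"
      unfolding end_codes_def by (auto simp: sing_in_family)
    ultimately show ?thesis
      unfolding removed_def by (intro image_eqI[of _ _ "(k, sing m, G)"])
  qed
qed

text \<open>Lying on the removed part of the axis splits into coordinate 0 belonging to
  \<open>removed t\<close> and the point lying on the whole axis, a closed condition. So the
  dependence on \<open>t\<close> is confined to real numbers.\<close>

lemma projective_mem_punctured: "projective (\<lambda>x. snd x \<in> punctured n (fst x))"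
proof -
  have level: "continuous_on UNIV (\<lambda>p :: ((real \<times> real) \<times> int) \<times> nat. level (snd p))"
    by (rule continuous_on_discrete_fun) (rule continuous_on_snd[OF continuous_on_id])
  have "projective (\<lambda>x :: real \<times> real. snd x \<in> removed (fst x))"
    unfolding mem_removed_iff
    by (intro projective_ex projective_disj projective_conj projective_marks level
        projective_mem_closed1[OF closed_base_part] projective_mem_closed[OF closed_attached_part]
        continuous_on_fst continuous_on_snd continuous_on_id)
  moreover have coord: "continuous_on UNIV (\<lambda>x :: real \<times> (nat \<Rightarrow> real). snd x 0)"
    by (rule continuous_on_product_then_coordinatewise[OF continuous_on_snd[OF continuous_on_id]])
  ultimately have removed: "projective (\<lambda>x :: real \<times> (nat \<Rightarrow> real). snd x 0 \<in> removed (fst x))"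
    using projective_comp[of "\<lambda>x. snd x \<in> removed (fst x)" "\<lambda>x. (fst x, snd x 0)"]
      continuous_on_Pair[OF continuous_on_fst[OF continuous_on_id] coord] by simp
  have closed: "projective (\<lambda>x :: real \<times> (nat \<Rightarrow> real). snd x \<in> C)" if "closed C" for C
    using projective_mem_closed1[of "\<lambda>(_ :: nat). C" snd "\<lambda>_. 0"] that
    by (simp add: continuous_on_snd continuous_on_id)
  have "x \<in> punctured n t \<longleftrightarrow> x \<in> Rn n \<and> \<not> (x 0 \<in> removed t \<and> x \<in> on_axis ` UNIV)" for x t
    unfolding punctured_def on_axis_image_eq by auto
  then show ?thesis
    using projective_conj[OF closed[OF closed_Rn[of n]]
        projective_not[OF projective_conj[OF removed closed[OF closed_on_axis_image[OF closed_UNIV]]]]]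
    by simp
qed

section \<open>Two generic parameters\<close>

instance grp_term :: countable by countable_datatype
instance grp_fm :: countable by countable_datatype

theorem theorem1p2:
  fixes n :: nat
  assumes "PBP" and "n \<ge> 2"
  shows "\<exists>(M :: (nat \<Rightarrow> real) topology) (N :: (nat \<Rightarrow> real) topology).
           manifold n M \<and> manifold n N \<and> \<not> M homeomorphic_space N \<and>
           elementarily_equivalent (Homeo M) (Homeo N)"
proof -
  define M where "M t = top_of_set (punctured n t)" for t
  define A where "A \<phi> = {t. models (Homeo (M t)) \<phi>}" for \<phi>
  have dichotomy: "meager_in euclideanreal (A \<phi>) \<or> meager_in euclideanreal (- A \<phi>)" for \<phi>
  proof (rule zero_one_law)
    have "projective_in euclideanreal (A \<phi>)"
      unfolding A_def M_def
      by (intro projective_imp_projective_in projective_family.projective_models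
          projective_family.intro projective_mem_punctured)
    then show "Baire_property_in euclideanreal (A \<phi>)"
      using assms(1) by (simp add: PBP_def)
    \<comment> \<open>Adding 1 leaves the space itself unchanged, while adding \<open>irr\<close>
      changes it by a homeomorphism, which \<open>models\<close> cannot detect.\<close>
    show "t + 1 \<in> A \<phi> \<longleftrightarrow> t \<in> A \<phi>" for t
      by (simp add: A_def M_def punctured_def removed_add_1)
    show "t + irr \<in> A \<phi> \<longleftrightarrow> t \<in> A \<phi>" for t
      unfolding A_def M_def
      using homeomorphic_space_imp_models_iff[OF punctured_add_irr_homeomorphic[OF assms(2)]] by simp
  qed
  \<comment> \<open>For each formula the meager one of the two sets is discarded. There are
    countably many formulas, so the total is meager, and all remaining parameters satisfy the same
    formulas.\<close>
  define B where "B \<phi> = (if meager_in euclideanreal (A \<phi>) then A \<phi> else - A \<phi>)" for \<phi>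
  have "meager_in euclideanreal (\<Union>\<phi>. B \<phi>)"
    using dichotomy by (intro meager_in_UN) (auto simp: B_def)
  obtain t where t: "t \<notin> (\<Union>\<phi>. B \<phi>)"
    using not_meager_in_UNIV \<open>meager_in euclideanreal (\<Union>\<phi>. B \<phi>)\<close> by (metis UNIV_eq_I)
  \<comment> \<open>The homeomorphism class of \<open>t\<close> is countable, hence meager, and can
    be avoided along with the discarded parameters.\<close>
  have "meager_in euclideanreal ((\<Union>\<phi>. B \<phi>) \<union> {s. M s homeomorphic_space M t})"
    unfolding M_def
    by (intro meager_in_Un countable_imp_meager[OF countable_homeomorphic[OF assms(2)]]
        \<open>meager_in euclideanreal (\<Union>\<phi>. B \<phi>)\<close>)
  then obtain s where s: "s \<notin> (\<Union>\<phi>. B \<phi>) \<union> {s. M s homeomorphic_space M t}"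
    using not_meager_in_UNIV by (metis UNIV_eq_I)
  have "models (Homeo (M s)) \<phi> \<longleftrightarrow> models (Homeo (M t)) \<phi>" for \<phi>
  proof -
    have "s \<notin> B \<phi>" "t \<notin> B \<phi>"
      using s t by auto
    then show ?thesis
      by (simp add: B_def A_def split: if_splits)
  qed
  then have "elementarily_equivalent (Homeo (M s)) (Homeo (M t))"
    by (simp add: elementarily_equivalent_def)
  moreover have "\<not> M s homeomorphic_space M t"
    using s by simp
  moreover have "manifold n (M s)" "manifold n (M t)"
    unfolding M_def by (intro manifold_punctured assms(2))+
  ultimately show ?thesis by blast
qed

end
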